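(* Let $p>1$, assume that $X$ supports a $(p,p)$-Poincar\'e inequality for $N^{1,p}_0$, and let $E\subset X$ be a bounded measurable set with $C_p(X\setminus E)>0$. Let $f\in D^p(E)$ and $\psi_1,\psi_2:E\to[-\infty,\infty]$. If $\mathcal{K}_{\psi_1,\psi_2,f}(E)\ne\varnothing$, then there is a unique solution (up to sets of capacity zero in $X$) of the $\mathcal{K}_{\psi_1,\psi_2,f}(E)$-obstacle problem.
   Context: $1\le p<\infty$ and $X=(X,d,\mu)$ is a metric space with a Borel regular measure $\mu$ (defined on the completion of the Borel $\sigma$-algebra) such that $0<\mu(B)<\infty$ for all balls $B$ (balls are nonempty and open). Curves are nonconstant, compact and rectifiable, parameterized by arc length as $\gamma:[0,l_\gamma]\to X$. A property holds for $p$-almost every curve if the family $\Gamma$ of curves for which it fails has zero $p$-modulus, i.e. there is a nonnegative Borel $\rho\in L^p(X)$ with $\int_\gamma\rho\,ds=\infty$ for every $\gamma\in\Gamma$. A nonnegative Borel function $g$ is an upper gradient of $u:X\to[-\infty,\infty]$ if $|u(\gamma(0))-u(\gamma(l_\gamma))|\le\int_\gamma g\,ds$ for all curves $\gamma$ (the left-hand side is $\infty$ whenever both terms are infinite); a nonnegative measurable $g$ is a $p$-weak upper gradient if this holds for $p$-almost every curve. If $u$ has an upper gradient in $L^p_{\rm loc}(X)$ (local: each point has a ball on which the property holds), its minimal $p$-weak upper gradient $g_u\in L^p_{\rm loc}(X)$ is the (a.e. unique) $p$-weak upper gradient satisfying $g_u\le g$ a.e. for every $p$-weak upper gradient $g\in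 L^p_{\rm loc}(X)$ of $u$. $N^{1,p}(X)$ is the set of everywhere defined measurable $u:X\to[-\infty,\infty]$ having an upper gradient in $L^p_{\rm loc}(X)$ with $\|u\|_{N^{1,p}(X)}=(\int_X|u|^p\,d\mu+\int_X g_u^p\,d\mu)^{1/p}<\infty$. $D^p(X)$ is the set of everywhere defined measurable functions having an upper gradient in $L^p(X)$. For measurable $E\subset X$, the spaces $N^{1,p}(E)$, $D^p(E)$ and the minimal $p$-weak upper gradient $g_{u,E}$ are defined by regarding $E$ as a metric space on its own (with $d$, $\mu$ restricted to $E$, and only curves in $E$); $g_u:=g_{u,X}$. The capacity of $A\subset X$ is $C_p(A)=\inf\|u\|_{N^{1,p}(X)}^p$ over all $u\in N^{1,p}(X)$ with $u=1$ on $A$; q.e. means outside a set of $C_p$-capacity zero (always with respect to $X$). For $E\subset X$, $N^{1,p}_0(E)=\{h|_E: h\in N^{1,p}(X),\ h=0 \text{ on } X\setminus E\}$; functions in $N^{1,p}_0(E)$ are regarded as extended by $0$ outside $E$ when needed. $\mathcal{K}_{\psi_1,\psi_2,f}(E)=\{v\in D^p(E): v-f\in N^{1,p}_0(E)\text{ and }\psi_1\le v\le\psi_2\text{ q.e. in }E\}$. A function $u\in\mathcal{K}_{\psi_1,\psi_2,f}(E)$ is a solution of the $\mathcal{K}_{\psi_1,\psi_2,f}(E)$-obstacle problem if $\int_E g_{u,E}^p\,d\mu\le\int_E g_{v,E}^p\,d\mu$ for all $v\in\mathcal{K}_{\psi_1,\psi_2,f}(E)$. $X$ supports a $(p,p)$-Poincar\'e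 inequality for $N^{1,p}_0$ if for every bounded $E\subset X$ with $C_p(X\setminus E)>0$ there is $C_E>0$ such that $\int_X|u|^p\,d\mu\le C_E\int_X g_u^p\,d\mu$ for all $u\in N^{1,p}_0(E)$ (extended by $0$ outside $E$). *)

theory Defs
  imports "HOL-Analysis.Analysis"
begin

text \<open>
  The ambient space $X$ is a type of class \<^class>\<open>metric_space\<close>. All notions are relative to a
  measure \<open>M\<close>, and the underlying metric space is \<open>space M\<close> with the metric of the type. For
  measurable \<open>E\<close>, regarding \<open>E\<close> as a metric space on its own is then the passage from \<open>M\<close> to
  \<open>restrict_space M E\<close>. Functions on \<open>E\<close> are total functions on the type, whose values outside
  \<open>E\<close> are ignored.
\<close>

definition metric_measure_space :: "'a::metric_space measure \<Rightarrow> bool" where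
  "metric_measure_space M \<longleftrightarrow>
     (\<exists>N. sets N = sets borel \<and> M = completion N) \<and>
     (\<forall>x r. 0 < r \<longrightarrow> 0 < emeasure M (ball x r) \<and> emeasure M (ball x r) < \<infinity>)"

text \<open>Powers with real exponent on $[0,\infty]$; only positive exponents are used.\<close>

definition epow :: "ennreal \<Rightarrow> real \<Rightarrow> ennreal" where
  "epow a p = (if a = \<infinity> then \<infinity> else ennreal (enn2real a powr p))"


section \<open>Curves\<close>

definition curve_length :: "(real \<Rightarrow> 'a::metric_space) \<Rightarrow> real \<Rightarrow> real \<Rightarrow> ennreal" where
  "curve_length \<gamma> a b =
     (SUP (n, s) \<in> {(n::nat, s::nat \<Rightarrow> real). mono_on {..n} s \<and> s ` {..n} \<subseteq> {a..b}}.
        \<Sum>i<n. ennreal (dist (\<gamma> (s i)) (\<gamma> (s (Suc i)))))"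

text \<open>
  A curve is a pair $(l,\gamma)$ with $\gamma : [0,l] \to S$ parameterized by arc length; $l > 0$
  says that it is nonconstant.
\<close>

definition curves :: "'a::metric_space set \<Rightarrow> (real \<times> (real \<Rightarrow> 'a)) set" where
  "curves S = {(l, \<gamma>). 0 < l \<and> continuous_on {0..l} \<gamma> \<and> \<gamma> ` {0..l} \<subseteq> S \<and>
                 (\<forall>t\<in>{0..l}. curve_length \<gamma> 0 t = ennreal t)}"

definition curve_integral :: "('a \<Rightarrow> ennreal) \<Rightarrow> real \<times> (real \<Rightarrow> 'a) \<Rightarrow> ennreal" where
  "curve_integral g = (\<lambda>(l, \<gamma>). \<integral>\<^sup>+ t. g (\<gamma> t) \<partial>lebesgue_on {0..l})"

definition measurable_along :: "('a \<Rightarrow> ennreal) \<Rightarrow> real \<times> (real \<Rightarrow> 'a) \<Rightarrow> bool" where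
  "measurable_along g = (\<lambda>(l, \<gamma>). (\<lambda>t. g (\<gamma> t)) \<in> borel_measurable (lebesgue_on {0..l}))"

definition zero_modulus ::
    "real \<Rightarrow> 'a::metric_space measure \<Rightarrow> (real \<times> (real \<Rightarrow> 'a)) set \<Rightarrow> bool" where
  "zero_modulus p M \<Gamma> \<longleftrightarrow>
     (\<exists>\<rho> \<in> borel_measurable (restrict_space borel (space M)).
        (\<integral>\<^sup>+ x. epow (\<rho> x) p \<partial>M) < \<infinity> \<and> (\<forall>c\<in>\<Gamma>. curve_integral \<rho> c = \<infinity>))"

definition ae_curve ::
    "real \<Rightarrow> 'a::metric_space measure \<Rightarrow> (real \<times> (real \<Rightarrow> 'a) \<Rightarrow> bool) \<Rightarrow> bool" where
  "ae_curve p M P \<longleftrightarrow> zero_modulus p M {c \<in> curves (space M). \<not> P c}"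


section \<open>Upper gradients\<close>

definition endpoint_gap :: "('a \<Rightarrow> ereal) \<Rightarrow> real \<times> (real \<Rightarrow> 'a) \<Rightarrow> ennreal" where
  "endpoint_gap u = (\<lambda>(l, \<gamma>).
     if \<bar>u (\<gamma> 0)\<bar> = \<infinity> \<and> \<bar>u (\<gamma> l)\<bar> = \<infinity> then \<infinity>
     else e2ennreal \<bar>u (\<gamma> 0) - u (\<gamma> l)\<bar>)"

definition upper_gradient ::
    "'a::metric_space measure \<Rightarrow> ('a \<Rightarrow> ereal) \<Rightarrow> ('a \<Rightarrow> ennreal) \<Rightarrow> bool" where
  "upper_gradient M u g \<longleftrightarrow>
     g \<in> borel_measurable (restrict_space borel (space M)) \<and>
     (\<forall>c\<in>curves (space M). endpoint_gap u c \<le> curve_integral g c)"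

text \<open>
  For merely measurable \<open>g\<close> the integral along a curve need not make sense. The inequality is
  understood to include that the integral is defined.
\<close>

definition weak_upper_gradient ::
    "real \<Rightarrow> 'a::metric_space measure \<Rightarrow> ('a \<Rightarrow> ereal) \<Rightarrow> ('a \<Rightarrow> ennreal) \<Rightarrow> bool" where
  "weak_upper_gradient p M u g \<longleftrightarrow>
     g \<in> borel_measurable M \<and>
     ae_curve p M (\<lambda>c. measurable_along g c \<and> endpoint_gap u c \<le> curve_integral g c)"

definition Lp_fun :: "real \<Rightarrow> 'a measure \<Rightarrow> ('a \<Rightarrow> ennreal) \<Rightarrow> bool" where
  "Lp_fun p M g \<longleftrightarrow> g \<in> borel_measurable M \<and> (\<integral>\<^sup>+ x. epow (g x) p \<partial>M) < \<infinity>"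

definition Lp_loc :: "real \<Rightarrow> 'a::metric_space measure \<Rightarrow> ('a \<Rightarrow> ennreal) \<Rightarrow> bool" where
  "Lp_loc p M g \<longleftrightarrow> g \<in> borel_measurable M \<and>
     (\<forall>x\<in>space M. \<exists>r>0. (\<integral>\<^sup>+ y\<in>ball x r \<inter> space M. epow (g y) p \<partial>M) < \<infinity>)"

definition is_minimal_weak_upper_gradient ::
    "real \<Rightarrow> 'a::metric_space measure \<Rightarrow> ('a \<Rightarrow> ereal) \<Rightarrow> ('a \<Rightarrow> ennreal) \<Rightarrow> bool" where
  "is_minimal_weak_upper_gradient p M u g \<longleftrightarrow>
     weak_upper_gradient p M u g \<and> Lp_loc p M g \<and>
     (\<forall>g'. weak_upper_gradient p M u g' \<and> Lp_loc p M g' \<longrightarrow> (AE x in M. g x \<le> g' x))"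

text \<open>
  The minimal weak upper gradient is determined only up to null sets; it is used only under
  integrals.
\<close>

definition min_grad ::
    "real \<Rightarrow> 'a::metric_space measure \<Rightarrow> ('a \<Rightarrow> ereal) \<Rightarrow> 'a \<Rightarrow> ennreal" where
  "min_grad p M u = (SOME g. is_minimal_weak_upper_gradient p M u g)"

definition energy :: "real \<Rightarrow> 'a::metric_space measure \<Rightarrow> ('a \<Rightarrow> ereal) \<Rightarrow> ennreal" where
  "energy p M u = (\<integral>\<^sup>+ x. epow (min_grad p M u x) p \<partial>M)"


section \<open>Sobolev spaces and capacity\<close>

definition N1p_norm :: "real \<Rightarrow> 'a::metric_space measure \<Rightarrow> ('a \<Rightarrow> ereal) \<Rightarrow> ennreal" where
  "N1p_norm p M u = epow ((\<integral>\<^sup>+ x. epow (e2ennreal \<bar>u x\<bar>) p \<partial>M) + energy p M u) (1 / p)"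

definition N1p :: "real \<Rightarrow> 'a::metric_space measure \<Rightarrow> ('a \<Rightarrow> ereal) set" where
  "N1p p M = {u \<in> borel_measurable M.
                (\<exists>g. upper_gradient M u g \<and> Lp_loc p M g) \<and> N1p_norm p M u < \<infinity>}"

definition Dp :: "real \<Rightarrow> 'a::metric_space measure \<Rightarrow> ('a \<Rightarrow> ereal) set" where
  "Dp p M = {u \<in> borel_measurable M. \<exists>g. upper_gradient M u g \<and> Lp_fun p M g}"

definition capacity :: "real \<Rightarrow> 'a::metric_space measure \<Rightarrow> 'a set \<Rightarrow> ennreal" where
  "capacity p M A = (INF u \<in> {u \<in> N1p p M. \<forall>x\<in>A. u x = 1}. epow (N1p_norm p M u) p)"

definition quasi_everywhere ::
    "real \<Rightarrow> 'a::metric_space measure \<Rightarrow> 'a set \<Rightarrow> ('a \<Rightarrow> bool) \<Rightarrow> bool" where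
  "quasi_everywhere p M E P \<longleftrightarrow> capacity p M {x \<in> E. \<not> P x} = 0"

definition N1p0 :: "real \<Rightarrow> 'a::metric_space measure \<Rightarrow> 'a set \<Rightarrow> ('a \<Rightarrow> ereal) set" where
  "N1p0 p M E = {w. \<exists>h\<in>N1p p M. (\<forall>x\<in>space M - E. h x = 0) \<and> (\<forall>x\<in>E. w x = h x)}"

definition zero_ext :: "'a set \<Rightarrow> ('a \<Rightarrow> ereal) \<Rightarrow> 'a \<Rightarrow> ereal" where
  "zero_ext E w x = (if x \<in> E then w x else 0)"

definition supports_Poincare_N0 :: "real \<Rightarrow> 'a::metric_space measure \<Rightarrow> bool" where
  "supports_Poincare_N0 p M \<longleftrightarrow>
     (\<forall>E. E \<subseteq> space M \<and> bounded E \<and> 0 < capacity p M (space M - E) \<longrightarrow>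
        (\<exists>C::real. 0 < C \<and>
           (\<forall>u\<in>N1p0 p M E.
              (\<integral>\<^sup>+ x. epow (e2ennreal \<bar>zero_ext E u x\<bar>) p \<partial>M)
                \<le> ennreal C * energy p M (zero_ext E u))))"


section \<open>The obstacle problem\<close>

text \<open>
  Pointwise difference with the convention that equal infinite values have difference $0$.
  The library instead has \<open>\<infinity> - \<infinity> = \<infinity>\<close> on \<^typ>\<open>ereal\<close>, which would make \<open>f - f\<close> infinite
  wherever \<open>f\<close> is. If \<open>f\<close> is finite outside a set of capacity zero the choice is immaterial,
  but a function in \<open>Dp p (restrict_space M E)\<close> may be infinite on a larger set when \<open>E\<close> has
  few curves.
\<close>

definition fun_diff :: "('a \<Rightarrow> ereal) \<Rightarrow> ('a \<Rightarrow> ereal) \<Rightarrow> 'a \<Rightarrow> ereal" where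
  "fun_diff v f x = (if v x = f x then 0 else v x - f x)"

definition obstacle_class ::
    "real \<Rightarrow> 'a::metric_space measure \<Rightarrow> ('a \<Rightarrow> ereal) \<Rightarrow> ('a \<Rightarrow> ereal) \<Rightarrow> ('a \<Rightarrow> ereal) \<Rightarrow>
     'a set \<Rightarrow> ('a \<Rightarrow> ereal) set" where
  "obstacle_class p M \<psi>\<^sub>1 \<psi>\<^sub>2 f E =
     {v \<in> Dp p (restrict_space M E). fun_diff v f \<in> N1p0 p M E \<and>
        quasi_everywhere p M E (\<lambda>x. \<psi>\<^sub>1 x \<le> v x \<and> v x \<le> \<psi>\<^sub>2 x)}"

definition obstacle_solution ::
    "real \<Rightarrow> 'a::metric_space measure \<Rightarrow> ('a \<Rightarrow> ereal) \<Rightarrow> ('a \<Rightarrow> ereal) \<Rightarrow> ('a \<Rightarrow> ereal) \<Rightarrow>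
     'a set \<Rightarrow> ('a \<Rightarrow> ereal) \<Rightarrow> bool" where
  "obstacle_solution p M \<psi>\<^sub>1 \<psi>\<^sub>2 f E u \<longleftrightarrow>
     u \<in> obstacle_class p M \<psi>\<^sub>1 \<psi>\<^sub>2 f E \<and>
     (\<forall>v\<in>obstacle_class p M \<psi>\<^sub>1 \<psi>\<^sub>2 f E.
        energy p (restrict_space M E) u \<le> energy p (restrict_space M E) v)"

end

theory Submission
  imports Defs "HOL-Probability.Distribution_Functions"
begin

text \<open>
  The direct method works without reflexivity of $L^p$. Among admissible functions with energy within
  $1/n$ of the infimum one takes an almost minimiser of the $L^p$ norm, which is bounded by the
  Poincar\'e inequality. Midpoints stay admissible, so uniform convexity makes both these functions and
  their gradients Cauchy in $L^p$. A fast subsequence is dominated pointwise by a single $\rho \in L^p$,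
  and finiteness of $\int_\gamma \rho\,ds$ passes all inequalities to the limit on almost every curve.

  For uniqueness, strict convexity gives two solutions the same gradient $g$. Truncating between them
  at a level $c$ yields a competitor whose gradient vanishes where the truncation is active, so
  $g = 0$ a.e. where the solutions differ, and the Poincar\'e inequality applies to their difference.

  The existence of minimal weak upper gradients reduces to minima of two gradients. These are treated
  on curves via Stieltjes measures, without differentiating along curves.
\<close>


section \<open>Powers on the extended half line\<close>

text \<open>\<open>E\<close> is merely measurable, and this shapes the proof. Gradients of
  competitors are known along curves inside \<open>E\<close>, while \<open>N1p0\<close> and the
  Poincare inequality concern all curves of the space, so differences must be extended by zero
  across an irregular set. A curve is cut at the zeros of a majorant that is continuous along it;
  the same cutting lets a gradient be set to 0 on a level set, which uniqueness needs. Moreover,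
  \<open>f\<close> may be infinite on a large set met by few curves in \<open>E\<close>, so the
  class is rewritten with real functions added to \<open>f\<close>. Capacity zero is traded for
  being null and missed by almost every curve; in this form quasi-everywhere statements can be
  checked curve by curve. The limit is a pointwise limsup, defined everywhere, so the obstacle
  inequalities survive it. Closeness of two minimal gradients says nothing about the gradient of the
  difference; hence the functions need a minimisation of their own, over sets closed under
  midpoints. The assumption p > 1 enters through strict convexity of the p-th power.\<close>

lemma epow_top [simp]: "epow \<infinity> p = \<infinity>" "epow top p = \<infinity>"
  by (simp_all add: epow_def infinity_ennreal_def)

lemma epow_0 [simp]: "epow 0 p = 0"
  by (simp add: epow_def)

lemma epow_ennreal: "0 \<le> r \<Longrightarrow> epow (ennreal r) p = ennreal (r powr p)"
  by (simp add: epow_def)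

lemma epow_eq_0_iff [simp]: "epow a p = 0 \<longleftrightarrow> a = 0"
  by (cases a) (auto simp: epow_ennreal)

lemma epow_less_top_iff: "epow a p < \<infinity> \<longleftrightarrow> a < \<infinity>"
  by (cases a) (auto simp: epow_ennreal)

lemma epow_mono: "0 < p \<Longrightarrow> a \<le> b \<Longrightarrow> epow a p \<le> epow b p"
  by (cases a; cases b) (auto simp: epow_ennreal powr_mono2 top_unique)

lemma epow_mult: "0 < p \<Longrightarrow> epow (a * b) p = epow a p * epow b p"
proof (cases a; cases b)
  fix r s assume "0 < p" "0 \<le> r" "0 \<le> s" "a = ennreal r" "b = ennreal s"
  then show ?thesis by (simp add: epow_def powr_mult enn2real_mult ennreal_mult' ennreal_mult_eq_top_iff)
qed (auto simp: epow_ennreal ennreal_top_mult ennreal_mult_top)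

lemma epow_epow: "epow (epow a p) q = epow a (p * q)"
  by (cases a) (auto simp: epow_ennreal powr_powr)

lemma epow_1 [simp]: "epow a 1 = a"
  by (cases a) (auto simp: epow_ennreal)

lemma epow_measurable [measurable (raw)]:
  assumes [measurable]: "f \<in> borel_measurable N"
  shows "(\<lambda>x. epow (f x) p) \<in> borel_measurable N"
  unfolding epow_def by measurable

lemma epow_add_le:
  assumes "0 < p"
  shows "epow (a + b) p \<le> ennreal (2 powr p) * (epow a p + epow b p)"
proof -
  have "epow (a + b) p \<le> epow (ennreal 2 * max a b) p"
    using assms by (intro epow_mono) (simp_all add: mult_2 add_mono)
  also have "\<dots> = ennreal (2 powr p) * epow (max a b) p"
    using assms by (simp add: epow_mult epow_ennreal del: ennreal_numeral)
  also have "\<dots> \<le> ennreal (2 powr p) * (epow a p + epow b p)"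
    by (intro mult_left_mono) (auto simp: max_def)
  finally show ?thesis .
qed

text \<open>Every term is at most the series, so each \<open>a n\<close> is at most the p-th root of
  the series, and hence so is the supremum.\<close>

lemma epow_SUP_le_suminf:
  fixes a :: "nat \<Rightarrow> ennreal"
  assumes "0 < p"
  shows "epow (SUP n. a n) p \<le> (\<Sum>n. epow (a n) p)"
proof -
  let ?S = "\<Sum>n. epow (a n) p"
  have "a n \<le> epow ?S (1 / p)" for n
  proof -
    have "epow (a n) p \<le> ?S"
      using sum_le_suminf[OF summableI, of "{n}" "\<lambda>n. epow (a n) p"] by simp
    then have "epow (epow (a n) p) (1 / p) \<le> epow ?S (1 / p)"
      using assms by (intro epow_mono) auto
    then show ?thesis using assms by (simp add: epow_epow)
  qed
  then have "epow (SUP n. a n) p \<le> epow (epow ?S (1 / p)) p"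
    using assms by (intro epow_mono SUP_least) auto
  also have "\<dots> = ?S" using assms by (simp add: epow_epow)
  finally show ?thesis .
qed

lemma N1p_norm_powr:
  "0 < p \<Longrightarrow> epow (N1p_norm p M u) p = (\<integral>\<^sup>+ x. epow (e2ennreal \<bar>u x\<bar>) p \<partial>M) + energy p M u"
  by (simp add: N1p_norm_def epow_epow)


section \<open>Curves and their subcurves\<close>

text \<open>The indicator of a closed interval against \<open>lborel\<close> gives monotonicity in
  the interval without any measurability. It agrees with \<open>curve_integral\<close> because
  Lebesgue measure is the completion of \<open>lborel\<close>.\<close>

definition segment_integral :: "('a \<Rightarrow> ennreal) \<Rightarrow> (real \<Rightarrow> 'a) \<Rightarrow> real \<Rightarrow> real \<Rightarrow> ennreal" where
  "segment_integral g \<gamma> a b = (\<integral>\<^sup>+ t. g (\<gamma> t) * indicator {a..b} t \<partial>lborel)"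

definition subcurve :: "(real \<Rightarrow> 'a) \<Rightarrow> real \<Rightarrow> real \<Rightarrow> real \<times> (real \<Rightarrow> 'a)" where
  "subcurve \<gamma> a b = (b - a, \<lambda>t. \<gamma> (a + t))"

lemma curve_integral_eq: "curve_integral g (l, \<gamma>) = segment_integral g \<gamma> 0 l"
  by (simp add: curve_integral_def segment_integral_def nn_integral_restrict_space
      nn_integral_completion)

lemma segment_integral_mono:
  "(\<And>t. a \<le> t \<Longrightarrow> t \<le> b \<Longrightarrow> g (\<gamma> t) \<le> g' (\<gamma> t)) \<Longrightarrow> segment_integral g \<gamma> a b \<le> segment_integral g' \<gamma> a b"
  unfolding segment_integral_def by (intro nn_integral_mono) (auto split: split_indicator)

lemma segment_integral_mono_interval:
  "a' \<le> a \<Longrightarrow> b \<le> b' \<Longrightarrow> segment_integral g \<gamma> a b \<le> segment_integral g \<gamma> a' b'"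
  unfolding segment_integral_def by (intro nn_integral_mono) (auto split: split_indicator)

lemma curves_iff:
  "(l, \<gamma>) \<in> curves S \<longleftrightarrow> 0 < l \<and> continuous_on {0..l} \<gamma> \<and> \<gamma> ` {0..l} \<subseteq> S \<and>
     (\<forall>t\<in>{0..l}. curve_length \<gamma> 0 t = ennreal t)"
  by (simp add: curves_def)

lemma curves_mono: "S \<subseteq> T \<Longrightarrow> curves S \<subseteq> curves T"
  by (auto simp: curves_def)

section \<open>Arc length and its restriction to subcurves\<close>

lemma curve_length_ge:
  assumes "mono_on {..n} s" "s ` {..n} \<subseteq> {a..b}"
  shows "(\<Sum>i<n. ennreal (dist (\<gamma> (s i)) (\<gamma> (s (Suc i))))) \<le> curve_length \<gamma> a b"
  unfolding curve_length_def using assms by (intro SUP_upper2[of "(n, s)"]) auto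

lemma curve_length_le:
  assumes "\<And>n s. mono_on {..n} s \<Longrightarrow> s ` {..n} \<subseteq> {a..b} \<Longrightarrow>
    (\<Sum>i<n. ennreal (dist (\<gamma> (s i)) (\<gamma> (s (Suc i))))) \<le> C"
  shows "curve_length \<gamma> a b \<le> C"
  unfolding curve_length_def using assms by (intro SUP_least) auto

text \<open>A partition of [a,s] prolonged by the points s and t is a partition of [a,t]. This weak
  superadditivity already yields the Lipschitz bound for arc length parametrisations.\<close>

lemma curve_length_add_dist:
  assumes "a \<le> s" "s \<le> t"
  shows "curve_length \<gamma> a s + ennreal (dist (\<gamma> s) (\<gamma> t)) \<le> curve_length \<gamma> a t"
proof -
  have "(\<Sum>i<n. ennreal (dist (\<gamma> (r i)) (\<gamma> (r (Suc i))))) + ennreal (dist (\<gamma> s) (\<gamma> t))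
      \<le> curve_length \<gamma> a t"
    if r: "mono_on {..n} r" "r ` {..n} \<subseteq> {a..s}" for n and r :: "nat \<Rightarrow> real"
  proof -
    \<comment> \<open>Indices n+1 and n+2 carry s and t, so the term with index n, from
      \<open>r n\<close> to s, is simply dropped.\<close>
    let ?r = "\<lambda>i. if i \<le> n then r i else if i = Suc n then s else t"
    have "(\<Sum>i<n. ennreal (dist (\<gamma> (r i)) (\<gamma> (r (Suc i))))) + ennreal (dist (\<gamma> s) (\<gamma> t))
      \<le> (\<Sum>i<n+2. ennreal (dist (\<gamma> (?r i)) (\<gamma> (?r (Suc i)))))"
      by (simp add: add.assoc add_increasing)
    also have "\<dots> \<le> curve_length \<gamma> a t"
    proof (rule curve_length_ge)
      show "mono_on {..n+2} ?r"
        unfolding mono_on_def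
      proof safe
        fix i j :: nat assume ij: "i \<le> n + 2" "j \<le> n + 2" "i \<le> j"
        have "r i \<le> r j" if "j \<le> n" using r that ij by (auto simp: mono_on_def)
        moreover have "r i \<le> s" if "i \<le> n" using r that by (auto simp: image_subset_iff)
        ultimately show "?r i \<le> ?r j" using ij assms by auto
      qed
      show "?r ` {..n+2} \<subseteq> {a..t}"
        using r assms by (force simp: image_subset_iff)
    qed
    finally show ?thesis .
  qed
  note * = this
  let ?P = "{(n::nat, r::nat \<Rightarrow> real). mono_on {..n} r \<and> r ` {..n} \<subseteq> {a..s}}"
  \<comment> \<open>Moving the constant into the supremum requires at least one partition.\<close>
  have "(0, \<lambda>_. a) \<in> ?P" using assms by (auto simp: mono_on_def)
  then have ne: "?P \<noteq> {}" by blast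
  show ?thesis
    unfolding curve_length_def[of \<gamma> a s] ennreal_SUP_add_left[OF ne, symmetric]
    using * by (intro SUP_least) auto
qed

lemma curve_lipschitz:
  assumes "(l, \<gamma>) \<in> curves S" "0 \<le> s" "s \<le> t" "t \<le> l"
  shows "dist (\<gamma> s) (\<gamma> t) \<le> t - s"
proof -
  have "ennreal s + ennreal (dist (\<gamma> s) (\<gamma> t)) \<le> ennreal t"
    using curve_length_add_dist[of 0 s t \<gamma>] assms by (auto simp: curves_iff)
  then have "ennreal (s + dist (\<gamma> s) (\<gamma> t)) \<le> ennreal t"
    using assms by simp
  then show ?thesis using assms by (subst (asm) ennreal_le_iff) auto
qed

lemma mono_on_minmax:
  fixes s :: "nat \<Rightarrow> real"
  assumes "mono_on {..n} s"
  shows "mono_on {..n} (\<lambda>i. min a (s i))" "mono_on {..n} (\<lambda>i. max a (s i))"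
  using assms unfolding mono_on_def by (meson min.mono max.mono order_refl)+

text \<open>Truncating a partition at \<open>a\<close> from above and from below gives partitions of
  the two halves; only a step that straddles \<open>a\<close> needs the triangle inequality.\<close>

lemma curve_length_split:
  assumes "c \<le> a" "a \<le> b"
  shows "curve_length \<gamma> c b \<le> curve_length \<gamma> c a + curve_length \<gamma> a b"
proof (rule curve_length_le)
  fix n and s :: "nat \<Rightarrow> real" assume s: "mono_on {..n} s" "s ` {..n} \<subseteq> {c..b}"
  let ?d = "\<lambda>s i. ennreal (dist (\<gamma> (s i)) (\<gamma> (s (Suc i))))"
  have "(\<Sum>i<n. ?d s i) \<le> (\<Sum>i<n. ?d (\<lambda>i. min a (s i)) i + ?d (\<lambda>i. max a (s i)) i)"
  proof (rule sum_mono)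
    fix i assume "i \<in> {..<n}"
    then have le: "s i \<le> s (Suc i)" using s by (auto simp: mono_on_def)
    show "?d s i \<le> ?d (\<lambda>i. min a (s i)) i + ?d (\<lambda>i. max a (s i)) i"
    proof (cases "s i \<le> a \<and> a \<le> s (Suc i)")
      case True
      then show ?thesis
        using dist_triangle[of "\<gamma> (s i)" "\<gamma> (s (Suc i))" "\<gamma> a"]
        by (simp add: min_absorb2 min_absorb1 max_absorb1 max_absorb2 flip: ennreal_plus)
    next
      case False
      then have "a \<le> s i \<or> s (Suc i) \<le> a" by auto
      then show ?thesis using le by (auto simp: min_def max_def)
    qed
  qed
  also have "\<dots> = (\<Sum>i<n. ?d (\<lambda>i. min a (s i)) i) + (\<Sum>i<n. ?d (\<lambda>i. max a (s i)) i)"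
    by (simp add: sum.distrib)
  also have "\<dots> \<le> curve_length \<gamma> c a + curve_length \<gamma> a b"
  proof (intro add_mono)
    show "(\<Sum>i<n. ?d (\<lambda>i. min a (s i)) i) \<le> curve_length \<gamma> c a"
      using s assms by (intro curve_length_ge mono_on_minmax) (auto simp: image_subset_iff)
    show "(\<Sum>i<n. ?d (\<lambda>i. max a (s i)) i) \<le> curve_length \<gamma> a b"
      using s assms by (intro curve_length_ge mono_on_minmax) (auto simp: image_subset_iff)
  qed
  finally show "(\<Sum>i<n. ?d s i) \<le> curve_length \<gamma> c a + curve_length \<gamma> a b" .
qed

lemma curve_length_shift: "curve_length (\<lambda>t. \<gamma> (a + t)) 0 t = curve_length \<gamma> a (a + t)"
proof (rule antisym)
  show "curve_length (\<lambda>t. \<gamma> (a + t)) 0 t \<le> curve_length \<gamma> a (a + t)"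
  proof (rule curve_length_le)
    fix n and s :: "nat \<Rightarrow> real" assume "mono_on {..n} s" "s ` {..n} \<subseteq> {0..t}"
    then show "(\<Sum>i<n. ennreal (dist (\<gamma> (a + s i)) (\<gamma> (a + s (Suc i))))) \<le> curve_length \<gamma> a (a + t)"
      by (intro curve_length_ge[where s="\<lambda>i. a + s i"]) (auto simp: mono_on_def image_subset_iff)
  qed
  show "curve_length \<gamma> a (a + t) \<le> curve_length (\<lambda>t. \<gamma> (a + t)) 0 t"
  proof (rule curve_length_le)
    fix n and s :: "nat \<Rightarrow> real" assume "mono_on {..n} s" "s ` {..n} \<subseteq> {a..a + t}"
    then have "(\<Sum>i<n. ennreal (dist (\<gamma> (a + (s i - a))) (\<gamma> (a + (s (Suc i) - a)))))
        \<le> curve_length (\<lambda>t. \<gamma> (a + t)) 0 t"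
      by (intro curve_length_ge[where s="\<lambda>i. s i - a"]) (auto simp: mono_on_def image_subset_iff algebra_simps)
    then show "(\<Sum>i<n. ennreal (dist (\<gamma> (s i)) (\<gamma> (s (Suc i))))) \<le> curve_length (\<lambda>t. \<gamma> (a + t)) 0 t"
      by simp
  qed
qed

text \<open>A piece has at most its parameter length by the Lipschitz bound, and at least that much
  because length is subadditive and the part before the piece accounts for exactly \<open>a\<close>.
  The set \<open>T\<close> need not contain the whole curve, so pieces that stay in a smaller set
  become curves there.\<close>

lemma subcurve_in_curves:
  assumes c: "(l, \<gamma>) \<in> curves S" and "0 \<le> a" "a < b" "b \<le> l" "\<gamma> ` {a..b} \<subseteq> T"
  shows "subcurve \<gamma> a b \<in> curves T"
  unfolding subcurve_def curves_iff
proof (intro conjI ballI)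
  show "0 < b - a" using assms by simp
  have "continuous_on {a..b} \<gamma>"
    using c assms by (auto simp: curves_iff intro: continuous_on_subset)
  then show "continuous_on {0..b - a} (\<lambda>t. \<gamma> (a + t))"
    by (rule continuous_on_compose2) (auto intro!: continuous_on_add continuous_on_const continuous_on_id)
  show "(\<lambda>t. \<gamma> (a + t)) ` {0..b - a} \<subseteq> T"
    using assms(5) by (auto simp: image_subset_iff)
  fix t assume t: "t \<in> {0..b - a}"
  have "curve_length \<gamma> a (a + t) \<le> ennreal t"
  proof (rule curve_length_le)
    fix n and s :: "nat \<Rightarrow> real" assume s: "mono_on {..n} s" "s ` {..n} \<subseteq> {a..a + t}"
    have "(\<Sum>i<n. ennreal (dist (\<gamma> (s i)) (\<gamma> (s (Suc i))))) \<le> (\<Sum>i<n. ennreal (s (Suc i) - s i))"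
    proof (intro sum_mono ennreal_leI curve_lipschitz[OF c])
      fix i assume "i \<in> {..<n}"
      then have "i \<in> {..n}" "Suc i \<in> {..n}" by auto
      then have "s i \<in> {a..a + t}" "s (Suc i) \<in> {a..a + t}" using s(2) by blast+
      then show "0 \<le> s i" "s (Suc i) \<le> l" using t assms by auto
      show "s i \<le> s (Suc i)" using s(1) \<open>i \<in> {..<n}\<close> by (auto simp: mono_on_def)
    qed
    also have "\<dots> = ennreal (\<Sum>i<n. s (Suc i) - s i)"
      using s by (intro sum_ennreal) (auto simp: mono_on_def)
    also have "\<dots> \<le> ennreal t"
    proof -
      have "a \<le> s 0" "s n \<le> a + t" using s by (auto simp: image_subset_iff)
      then have "s n - s 0 \<le> t" by linarith
      then show ?thesis by (simp add: sum_lessThan_telescope ennreal_leI)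
    qed
    finally show "(\<Sum>i<n. ennreal (dist (\<gamma> (s i)) (\<gamma> (s (Suc i))))) \<le> ennreal t" .
  qed
  moreover have "ennreal t \<le> curve_length \<gamma> a (a + t)"
  proof -
    have "ennreal a + ennreal t \<le> ennreal a + curve_length \<gamma> a (a + t)"
      using curve_length_split[of 0 a "a + t" \<gamma>] c t assms by (auto simp: curves_iff ennreal_plus)
    then show ?thesis by (simp add: ennreal_add_left_cancel_le)
  qed
  ultimately show "curve_length (\<lambda>t. \<gamma> (a + t)) 0 t = ennreal t"
    by (simp add: curve_length_shift)
qed

lemma curve_measurable:
  assumes c: "(l, \<gamma>) \<in> curves S" and g: "g \<in> borel_measurable borel" and "0 \<le> a" "b \<le> l"
  shows "(\<lambda>t. g (\<gamma> t) * indicator {a..b} t :: ennreal) \<in> borel_measurable borel"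
proof -
  have "continuous_on {a..b} \<gamma>"
    using c assms by (auto simp: curves_iff intro: continuous_on_subset)
  then have "\<gamma> \<in> measurable (restrict_space borel {a..b}) borel"
    by (rule borel_measurable_continuous_on_restrict)
  then have "(\<lambda>t. g (\<gamma> t)) \<in> measurable (restrict_space borel {a..b}) borel"
    using g by (rule measurable_compose)
  then show ?thesis
    by (subst (asm) borel_measurable_restrict_space_iff_ennreal) auto
qed

lemma segment_integral_add:
  assumes "(l, \<gamma>) \<in> curves S" "g \<in> borel_measurable borel" "h \<in> borel_measurable borel" "0 \<le> a" "b \<le> l"
  shows "segment_integral (\<lambda>x. g x + h x) \<gamma> a b = segment_integral g \<gamma> a b + segment_integral h \<gamma> a b"
  unfolding segment_integral_def distrib_right
  using curve_measurable[OF assms(1,2,4,5)] curve_measurable[OF assms(1,3,4,5)]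
  by (intro nn_integral_add) simp_all

lemma segment_integral_cmult:
  assumes "(l, \<gamma>) \<in> curves S" "g \<in> borel_measurable borel" "0 \<le> a" "b \<le> l"
  shows "segment_integral (\<lambda>x. c * g x) \<gamma> a b = c * segment_integral g \<gamma> a b"
  unfolding segment_integral_def mult.assoc
  using curve_measurable[OF assms] by (intro nn_integral_cmult) simp

lemma segment_integral_shift:
  assumes "(l, \<gamma>) \<in> curves S" "g \<in> borel_measurable borel" "0 \<le> a" "a \<le> s" "t \<le> b" "b \<le> l"
  shows "segment_integral g (\<lambda>t. \<gamma> (a + t)) (s - a) (t - a) = segment_integral g \<gamma> s t"
proof -
  have "segment_integral g \<gamma> s t
      = (\<integral>\<^sup>+ r. g (\<gamma> (a + r)) * indicator {s..t} (a + r) \<partial>lborel)"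
    unfolding segment_integral_def
    using nn_integral_real_affine[of "\<lambda>r. g (\<gamma> r) * indicator {s..t} r" 1 a]
      curve_measurable[OF assms(1,2), of s t] assms by simp
  also have "\<dots> = segment_integral g (\<lambda>t. \<gamma> (a + t)) (s - a) (t - a)"
    unfolding segment_integral_def by (intro nn_integral_cong) (auto split: split_indicator)
  finally show ?thesis ..
qed

lemma curve_integral_subcurve:
  assumes "(l, \<gamma>) \<in> curves S" "g \<in> borel_measurable borel" "0 \<le> a" "b \<le> l"
  shows "curve_integral g (subcurve \<gamma> a b) = segment_integral g \<gamma> a b"
  using segment_integral_shift[OF assms(1,2,3) order_refl order_refl assms(4)]
  by (simp add: subcurve_def curve_integral_eq)


section \<open>Exceptional families of curves\<close>

locale sobolev_setting =
  fixes M :: "'a::metric_space measure" and p :: real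
  assumes mms: "metric_measure_space M" and p_gt_1: "1 < p"
begin

abbreviation Lp_int :: "('a \<Rightarrow> ennreal) \<Rightarrow> ennreal" where
  "Lp_int g \<equiv> (\<integral>\<^sup>+ x. epow (g x) p \<partial>M)"

lemma p_pos: "0 < p"
  using p_gt_1 by simp

lemma sets_completion_borel:
  obtains N where "sets N = sets borel" "M = completion N"
  using mms by (auto simp: metric_measure_space_def)

lemma space_M [simp]: "space M = UNIV"
proof -
  obtain N where N: "sets N = sets (borel :: 'a measure)" "M = completion N"
    by (rule sets_completion_borel) (rule that)
  then show ?thesis using sets_eq_imp_space_eq[OF N(1)] by simp
qed

lemma borel_sets_M: "A \<in> sets borel \<Longrightarrow> A \<in> sets M"
  by (rule sets_completion_borel) (auto simp: sets_completion)

sublocale complete_measure M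
  by (rule sets_completion_borel) (use completion.complete_measure_axioms in blast)

lemma borel_measurable_M: "f \<in> borel_measurable borel \<Longrightarrow> f \<in> borel_measurable M"
  using borel_sets_M by (auto simp: measurable_def)

lemma null_set_cover:
  assumes "A \<in> null_sets M"
  obtains N where "N \<in> sets borel" "A \<subseteq> N" "N \<in> null_sets M"
proof -
  obtain M' where M': "sets M' = sets (borel :: 'a measure)" "M = completion M'"
    by (rule sets_completion_borel) (rule that)
  then obtain N where "N \<in> null_sets M'" "A \<subseteq> N"
    using assms unfolding M'(2) null_sets_completion_iff2 by blast
  then show ?thesis
    using that[of N] null_sets_completionI[of N M'] M' by (metis null_setsD2)
qed

lemma AE_M_iff: "(AE x in M. P x) \<longleftrightarrow> {x. \<not> P x} \<in> null_sets M"
  by (simp add: AE_iff_null_sets)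

text \<open>A Borel null set covering the points of disagreement receives the value infinity.
  Domination at every point means that no line integral decreases, while equality almost everywhere
  preserves the p-integral.\<close>

lemma borel_majorant:
  fixes g :: "'a \<Rightarrow> ennreal"
  assumes "g \<in> borel_measurable M"
  obtains g' where "g' \<in> borel_measurable borel" "\<And>x. g x \<le> g' x" "AE x in M. g' x = g x"
proof -
  obtain M' where M': "sets M' = sets (borel :: 'a measure)" "M = completion M'"
    by (rule sets_completion_borel) (rule that)
  obtain h where h: "h \<in> borel_measurable M'" "AE x in M'. g x = h x"
    using completion_ex_borel_measurable[of g M'] assms unfolding M'(2) by blast
  have hb [measurable]: "h \<in> borel_measurable borel"
    using h(1) M'(1) by (simp cong: measurable_cong_sets)
  have "AE x in M. g x = h x" using AE_completion[OF h(2)] unfolding M'(2) .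
  then obtain N where N: "N \<in> sets borel" "{x. g x \<noteq> h x} \<subseteq> N" "N \<in> null_sets M"
    using null_set_cover unfolding AE_M_iff by blast
  then have eq: "g x = h x" if "x \<notin> N" for x using that by blast
  show ?thesis
  proof (rule that)
    show "(\<lambda>x. if x \<in> N then \<infinity> else h x) \<in> borel_measurable borel"
      using N(1) by measurable
    show "g x \<le> (if x \<in> N then \<infinity> else h x)" for x using eq[of x] by auto
    show "AE x in M. (if x \<in> N then \<infinity> else h x) = g x"
      using AE_not_in[OF N(3)] by eventually_elim (use eq in auto)
  qed
qed

text \<open>This supplies the strictly positive integrable weight used to construct minimal
  gradients.\<close>

lemma sigma_finite_M: "sigma_finite_measure M"
proof
  fix x :: 'a
  let ?B = "range (\<lambda>n::nat. ball x (Suc n))"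
  have "(\<Union>n::nat. ball x (Suc n)) = UNIV"
  proof -
    have "\<exists>n::nat. dist x y < Suc n" for y
      using reals_Archimedean2[of "dist x y"] less_trans by (metis lessI of_nat_less_iff)
    then show ?thesis by auto
  qed
  moreover have "emeasure M (ball x (Suc n)) < \<infinity>" for n
    using mms by (auto simp: metric_measure_space_def)
  ultimately show "\<exists>A. countable A \<and> A \<subseteq> sets M \<and> \<Union>A = space M \<and> (\<forall>a\<in>A. emeasure M a \<noteq> \<infinity>)"
    by (intro exI[of _ ?B]) (auto intro: borel_sets_M simp: less_top[symmetric])
qed

section \<open>Families of curves of zero modulus\<close>

lemma zero_modulus_iff:
  "zero_modulus p M \<Gamma> \<longleftrightarrow> (\<exists>\<rho>\<in>borel_measurable borel. Lp_int \<rho> < \<infinity> \<and>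
     (\<forall>c\<in>\<Gamma>. curve_integral \<rho> c = \<infinity>))"
proof -
  have "borel_measurable (restrict_space borel UNIV) = (borel_measurable borel :: ('a \<Rightarrow> ennreal) set)"
    by (rule measurable_cong_sets) auto
  then show ?thesis by (simp add: zero_modulus_def)
qed

lemma zero_modulus_subset: "zero_modulus p M \<Gamma> \<Longrightarrow> \<Gamma>' \<subseteq> \<Gamma> \<Longrightarrow> zero_modulus p M \<Gamma>'"
  unfolding zero_modulus_iff by blast

text \<open>Using suprema instead of sums of densities avoids the triangle inequality in $L^p$.\<close>

lemma SUP_Lp:
  fixes \<rho> :: "nat \<Rightarrow> 'a \<Rightarrow> ennreal"
  assumes [measurable]: "\<And>n. \<rho> n \<in> borel_measurable M"
    and le: "\<And>n. Lp_int (\<rho> n) \<le> ennreal (r n)"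
    and r: "summable r" "\<And>n. 0 \<le> r n"
  shows "Lp_int (\<lambda>x. SUP n. \<rho> n x) < \<infinity>"
proof -
  have "Lp_int (\<lambda>x. SUP n. \<rho> n x) \<le> (\<integral>\<^sup>+ x. (\<Sum>n. epow (\<rho> n x) p) \<partial>M)"
    by (intro nn_integral_mono epow_SUP_le_suminf p_pos)
  also have "\<dots> = (\<Sum>n. \<integral>\<^sup>+ x. epow (\<rho> n x) p \<partial>M)"
    by (intro nn_integral_suminf) measurable
  also have "\<dots> \<le> (\<Sum>n. ennreal (r n))"
    by (intro suminf_le le) auto
  also have "\<dots> = ennreal (suminf r)"
    using r by (intro suminf_ennreal2) auto
  also have "\<dots> < \<infinity>" by simp
  finally show ?thesis .
qed

text \<open>Each density is scaled until the p-integrals are summable; the supremum of the scaled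
  densities is then infinite along every curve of every family. Membership in
  \<open>curves UNIV\<close> makes densities measurable along the curve, so that the scaling factor
  can leave the integral.\<close>

lemma zero_modulus_UN:
  assumes "\<And>n::nat. zero_modulus p M (\<Gamma> n)" and curves: "\<And>n. \<Gamma> n \<subseteq> curves UNIV"
  shows "zero_modulus p M (\<Union>n. \<Gamma> n)"
proof -
  have "\<exists>\<rho>. \<forall>n. \<rho> n \<in> borel_measurable borel \<and> Lp_int (\<rho> n) < \<infinity> \<and>
     (\<forall>c\<in>\<Gamma> n. curve_integral (\<rho> n) c = \<infinity>)"
    using assms(1) unfolding zero_modulus_iff by (intro choice) blast
  then obtain \<rho> where \<rho> [measurable]: "\<And>n. \<rho> n \<in> borel_measurable borel"
    and fin: "\<And>n. Lp_int (\<rho> n) < \<infinity>"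
    and inf: "\<And>n c. c \<in> \<Gamma> n \<Longrightarrow> curve_integral (\<rho> n) c = \<infinity>" by blast
  define I where "I n = enn2real (Lp_int (\<rho> n))" for n
  have I: "Lp_int (\<rho> n) = ennreal (I n)" "0 \<le> I n" for n
    using fin[of n] by (auto simp: I_def)
  \<comment> \<open>With this choice \<open>c n powr p * I n\<close> is at most
    \<open>(1/2) ^ n\<close>; the summand 1 guards against \<open>I n = 0\<close>.\<close>
  define c where "c n = ((1/2) ^ n / (1 + I n)) powr (1 / p)" for n
  have c: "0 < c n" "c n powr p = (1/2) ^ n / (1 + I n)" for n
  proof -
    have "0 < (1/2) ^ n / (1 + I n)" using I[of n] by (intro divide_pos_pos) auto
    then show "0 < c n" "c n powr p = (1/2) ^ n / (1 + I n)"
      using p_pos I(2)[of n] by (auto simp: c_def powr_powr)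
  qed
  let ?\<rho> = "\<lambda>n x. ennreal (c n) * \<rho> n x"
  have rho_M [measurable]: "\<rho> n \<in> borel_measurable M" for n
    by (rule borel_measurable_M) (rule \<rho>)
  show ?thesis
    unfolding zero_modulus_iff
  proof (intro bexI conjI ballI)
    show "(\<lambda>x. SUP n. ?\<rho> n x) \<in> borel_measurable borel" by measurable
    show "Lp_int (\<lambda>x. SUP n. ?\<rho> n x) < \<infinity>"
    proof (rule SUP_Lp)
      show "summable (\<lambda>n. (1/2::real) ^ n)" by (rule summable_geometric) simp
      fix n
      have "Lp_int (\<lambda>x. ?\<rho> n x) = ennreal (c n powr p) * ennreal (I n)"
        using p_pos c(1)[of n] by (simp add: epow_mult epow_ennreal nn_integral_cmult I)
      also have "\<dots> = ennreal ((1/2) ^ n * (I n / (1 + I n)))"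
        using I(2)[of n] by (simp add: c(2) ennreal_mult'[symmetric])
      also have "\<dots> \<le> ennreal ((1/2) ^ n)"
        using I(2)[of n] by (intro ennreal_leI mult_right_le_one_le) auto
      finally show "Lp_int (\<lambda>x. ?\<rho> n x) \<le> ennreal ((1/2) ^ n)" .
    qed auto
    fix d assume "d \<in> (\<Union>n. \<Gamma> n)"
    then obtain n where n: "d \<in> \<Gamma> n" by auto
    obtain l \<gamma> where d: "d = (l, \<gamma>)" by force
    have lg: "(l, \<gamma>) \<in> curves UNIV" using n curves d by blast
    have "segment_integral (\<rho> n) \<gamma> 0 l = \<infinity>" using inf[OF n] by (simp add: d curve_integral_eq)
    moreover have "segment_integral (\<rho> n) \<gamma> 0 l
        \<le> ennreal (1 / c n) * segment_integral (\<lambda>x. SUP n. ?\<rho> n x) \<gamma> 0 l"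
    proof -
      have "ennreal (1 / c n) * segment_integral (\<lambda>x. SUP n. ?\<rho> n x) \<gamma> 0 l
          = (\<integral>\<^sup>+ t. ennreal (1 / c n) * ((SUP n. ?\<rho> n (\<gamma> t)) * indicator {0..l} t) \<partial>lborel)"
        unfolding segment_integral_def
        using curve_measurable[OF lg, of "\<lambda>x. SUP n. ?\<rho> n x" 0 l] by (subst nn_integral_cmult) auto
      moreover have "segment_integral (\<rho> n) \<gamma> 0 l \<le> \<dots>"
        unfolding segment_integral_def
      proof (rule nn_integral_mono)
        fix t
        have "\<rho> n (\<gamma> t) = ennreal (1 / c n) * ?\<rho> n (\<gamma> t)"
          using c(1)[of n] by (simp add: mult.assoc[symmetric] ennreal_mult'[symmetric])
        also have "\<dots> \<le> ennreal (1 / c n) * (SUP n. ?\<rho> n (\<gamma> t))"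
          by (intro mult_left_mono SUP_upper) auto
        finally show "\<rho> n (\<gamma> t) * indicator {0..l} t
          \<le> ennreal (1 / c n) * ((SUP n. ?\<rho> n (\<gamma> t)) * indicator {0..l} t)"
          by (auto split: split_indicator)
      qed
      ultimately show ?thesis by simp
    qed
    ultimately show "curve_integral (\<lambda>x. SUP n. ?\<rho> n x) d = \<infinity>"
      by (auto simp: d curve_integral_eq top_unique ennreal_mult_eq_top_iff)
  qed
qed

section \<open>Modulus computed in a subset and in the whole space\<close>

lemma id_restrict_measurable: "(\<lambda>x. x) \<in> measurable (restrict_space M S) (restrict_space borel S)"
proof (rule measurable_restrict_space3)
  show "(\<lambda>x. x) \<in> measurable M borel" by (rule borel_measurable_M) simp
qed simp

lemma nn_integral_restrict_M:
  "S \<in> sets M \<Longrightarrow> (\<integral>\<^sup>+ x. f x \<partial>restrict_space M S) = (\<integral>\<^sup>+ x. f x * indicator S x \<partial>M)"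
  by (rule nn_integral_restrict_space) auto

lemma zero_modulus_restrict_iff:
  assumes S: "S \<in> sets M" and \<Gamma>: "\<Gamma> \<subseteq> curves S"
  shows "zero_modulus p (restrict_space M S) \<Gamma> \<longleftrightarrow> zero_modulus p M \<Gamma>"
proof
  assume "zero_modulus p M \<Gamma>"
  then obtain \<rho> where \<rho>: "\<rho> \<in> borel_measurable borel" "Lp_int \<rho> < \<infinity>"
    "\<And>c. c \<in> \<Gamma> \<Longrightarrow> curve_integral \<rho> c = \<infinity>" by (auto simp: zero_modulus_iff)
  have "(\<integral>\<^sup>+ x. epow (\<rho> x) p \<partial>restrict_space M S) \<le> Lp_int \<rho>"
    using S by (auto simp: nn_integral_restrict_M split: split_indicator intro!: nn_integral_mono)
  then show "zero_modulus p (restrict_space M S) \<Gamma>"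
    using \<rho> by (auto simp: zero_modulus_def intro!: bexI[of _ \<rho>] measurable_restrict_space1)
next
  assume z: "zero_modulus p (restrict_space M S) \<Gamma>"
  have sp: "space (restrict_space M S) = S" by (simp add: space_restrict_space)
  from z obtain \<rho> where \<rho>: "\<rho> \<in> borel_measurable (restrict_space borel S)"
    "(\<integral>\<^sup>+ x. epow (\<rho> x) p \<partial>restrict_space M S) < \<infinity>"
    "\<And>c. c \<in> \<Gamma> \<Longrightarrow> curve_integral \<rho> c = \<infinity>" unfolding zero_modulus_def sp by blast
  have "\<rho> \<in> borel_measurable (restrict_space M S)"
    using measurable_compose[OF id_restrict_measurable \<rho>(1)] by simp
  \<comment> \<open>\<open>S\<close> is only \<open>M\<close>-measurable, so the extension of
    \<open>\<rho>\<close> by zero need not be Borel and is replaced by a Borel majorant.\<close>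
  then have "(\<lambda>x. \<rho> x * indicator S x) \<in> borel_measurable M"
    using S by (simp add: borel_measurable_restrict_space_iff_ennreal)
  then obtain \<rho>' where \<rho>': "\<rho>' \<in> borel_measurable borel" "\<And>x. \<rho> x * indicator S x \<le> \<rho>' x"
    "AE x in M. \<rho>' x = \<rho> x * indicator S x" by (rule borel_majorant) (rule that)
  have "Lp_int \<rho>' = (\<integral>\<^sup>+ x. epow (\<rho> x) p * indicator S x \<partial>M)"
    using \<rho>'(3) by (intro nn_integral_cong_AE) (auto elim!: eventually_mono split: split_indicator)
  also have "\<dots> < \<infinity>" using \<rho>(2) S by (simp add: nn_integral_restrict_M)
  finally have fin: "Lp_int \<rho>' < \<infinity>" .
  have "curve_integral \<rho>' (l, \<gamma>) = \<infinity>" if "(l, \<gamma>) \<in> \<Gamma>" for l \<gamma>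
  proof -
    have "(l, \<gamma>) \<in> curves S" using that \<Gamma> by blast
    then have "\<gamma> ` {0..l} \<subseteq> S" by (simp add: curves_iff)
    then have "segment_integral \<rho> \<gamma> 0 l \<le> segment_integral \<rho>' \<gamma> 0 l"
      using \<rho>'(2) by (intro segment_integral_mono) (metis atLeastAtMost_iff image_subset_iff indicator_simps(1) mult.right_neutral)
    then show ?thesis using \<rho>(3)[OF that] by (simp add: curve_integral_eq top_unique)
  qed
  then show "zero_modulus p M \<Gamma>"
    unfolding zero_modulus_iff using \<rho>' fin by auto
qed

text \<open>
  By the previous lemma, the modulus of a family of curves in \<open>S\<close> does not depend on whether it is
  computed in \<open>S\<close> or in the whole space, so that a single notion of \<open>p\<close>-a.e. curve in \<open>S\<close> suffices.
\<close>

definition aec :: "'a set \<Rightarrow> (real \<Rightarrow> (real \<Rightarrow> 'a) \<Rightarrow> bool) \<Rightarrow> bool" where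
  "aec S P \<longleftrightarrow> zero_modulus p M {(l, \<gamma>). (l, \<gamma>) \<in> curves S \<and> \<not> P l \<gamma>}"

abbreviation finite_on :: "'a set \<Rightarrow> ('a \<Rightarrow> ennreal) \<Rightarrow> bool" where
  "finite_on S g \<equiv> aec S (\<lambda>l \<gamma>. segment_integral g \<gamma> 0 l < \<infinity>)"

text \<open>All subintervals are included so that a single good curve yields a one-variable
  statement about increments; \<open>wugI_endpoints\<close> obtains this on almost every curve from
  the end points alone.\<close>

abbreviation controls :: "('a \<Rightarrow> real) \<Rightarrow> ('a \<Rightarrow> ennreal) \<Rightarrow> real \<Rightarrow> (real \<Rightarrow> 'a) \<Rightarrow> bool" where
  "controls u g l \<gamma> \<equiv> \<forall>a b. 0 \<le> a \<longrightarrow> a \<le> b \<longrightarrow> b \<le> l \<longrightarrow>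
     ennreal \<bar>u (\<gamma> a) - u (\<gamma> b)\<bar> \<le> segment_integral g \<gamma> a b"

lemma ae_curve_iff_aec:
  assumes "S \<in> sets M"
  shows "ae_curve p (restrict_space M S) P \<longleftrightarrow> aec S (\<lambda>l \<gamma>. P (l, \<gamma>))"
proof -
  have eq: "{c \<in> curves S. \<not> P c} = {(l, \<gamma>). (l, \<gamma>) \<in> curves S \<and> \<not> P (l, \<gamma>)}" by auto
  have sp: "space (restrict_space M S) = S" by (simp add: space_restrict_space)
  show ?thesis
    unfolding ae_curve_def aec_def sp eq[symmetric]
    by (rule zero_modulus_restrict_iff[OF assms]) blast
qed

lemma aec_mono:
  "aec S P \<Longrightarrow> (\<And>l \<gamma>. (l, \<gamma>) \<in> curves S \<Longrightarrow> P l \<gamma> \<Longrightarrow> Q l \<gamma>) \<Longrightarrow> aec S Q"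
  unfolding aec_def by (erule zero_modulus_subset) auto

lemma aec_all_nat:
  assumes "\<And>n::nat. aec S (P n)"
  shows "aec S (\<lambda>l \<gamma>. \<forall>n. P n l \<gamma>)"
proof -
  have "zero_modulus p M (\<Union>n. {(l, \<gamma>). (l, \<gamma>) \<in> curves S \<and> \<not> P n l \<gamma>})"
    using assms curves_mono[of S UNIV] by (intro zero_modulus_UN) (auto simp: aec_def)
  then show ?thesis unfolding aec_def by (rule zero_modulus_subset) auto
qed

lemma aec_all_countable:
  assumes "countable I" "\<And>i. i \<in> I \<Longrightarrow> aec S (P i)"
  shows "aec S (\<lambda>l \<gamma>. \<forall>i\<in>I. P i l \<gamma>)"
proof (cases "I = {}")
  case True
  have "zero_modulus p M {}"
    unfolding zero_modulus_iff by (intro bexI[of _ "\<lambda>_. 0"]) auto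
  then show ?thesis using True by (simp add: aec_def)
next
  case False
  have "aec S (\<lambda>l \<gamma>. \<forall>n. P (from_nat_into I n) l \<gamma>)"
    using False by (intro aec_all_nat assms) (rule from_nat_into)
  then show ?thesis
    by (rule aec_mono) (metis assms(1) from_nat_into_surj)
qed

lemma aec_conj:
  assumes "aec S P" "aec S Q"
  shows "aec S (\<lambda>l \<gamma>. P l \<gamma> \<and> Q l \<gamma>)"
proof -
  have "aec S (\<lambda>l \<gamma>. \<forall>b\<in>(UNIV::bool set). if b then P l \<gamma> else Q l \<gamma>)"
  proof (rule aec_all_countable)
    fix b :: bool
    show "aec S (\<lambda>l \<gamma>. if b then P l \<gamma> else Q l \<gamma>)" using assms by (cases b) auto
  qed auto
  then show ?thesis by (rule aec_mono) (auto simp: UNIV_bool)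
qed

lemma aec_subset: "aec T P \<Longrightarrow> S \<subseteq> T \<Longrightarrow> aec S P"
  unfolding aec_def using curves_mono[of S T] by (erule_tac zero_modulus_subset) auto

text \<open>A density with infinite integral along a piece has infinite integral along the whole
  curve, so curves with a bad piece are as negligible as the bad pieces. \<open>S\<close> and
  \<open>E\<close> are unrelated: pieces inside \<open>E\<close> of curves in a larger set are
  covered.\<close>

lemma aec_subcurves:
  assumes "aec E P"
  shows "aec S (\<lambda>l \<gamma>. \<forall>a b. 0 \<le> a \<longrightarrow> a < b \<longrightarrow> b \<le> l \<longrightarrow> \<gamma> ` {a..b} \<subseteq> E \<longrightarrow> P (b - a) (\<lambda>t. \<gamma> (a + t)))"
proof -
  obtain \<rho> where \<rho>: "\<rho> \<in> borel_measurable borel" "Lp_int \<rho> < \<infinity>"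
    and inf: "\<And>l \<gamma>. (l, \<gamma>) \<in> curves E \<Longrightarrow> \<not> P l \<gamma> \<Longrightarrow> curve_integral \<rho> (l, \<gamma>) = \<infinity>"
    using assms unfolding aec_def zero_modulus_iff by blast
  show ?thesis
    unfolding aec_def zero_modulus_iff
  proof (intro bexI[OF _ \<rho>(1)] conjI \<rho>(2) ballI)
    fix d assume "d \<in> {(l, \<gamma>). (l, \<gamma>) \<in> curves S \<and> \<not> (\<forall>a b. 0 \<le> a \<longrightarrow> a < b \<longrightarrow> b \<le> l \<longrightarrow>
      \<gamma> ` {a..b} \<subseteq> E \<longrightarrow> P (b - a) (\<lambda>t. \<gamma> (a + t)))}"
    then obtain l \<gamma> a b where d: "d = (l, \<gamma>)"
      and c: "(l, \<gamma>) \<in> curves S" "0 \<le> a" "a < b" "b \<le> l" "\<gamma> ` {a..b} \<subseteq> E"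
      "\<not> P (b - a) (\<lambda>t. \<gamma> (a + t))" by blast
    have "curve_integral \<rho> (subcurve \<gamma> a b) = \<infinity>"
      using subcurve_in_curves[OF c(1-5)] c(6) inf by (simp add: subcurve_def)
    then have "segment_integral \<rho> \<gamma> a b = \<infinity>"
      using curve_integral_subcurve[OF c(1) \<rho>(1) c(2) c(4)] by simp
    moreover have "segment_integral \<rho> \<gamma> a b \<le> segment_integral \<rho> \<gamma> 0 l"
      using c by (intro segment_integral_mono_interval) auto
    ultimately show "curve_integral \<rho> d = \<infinity>"
      by (simp add: d curve_integral_eq top_unique)
  qed
qed

text \<open>The density itself witnesses that the curves with infinite integral have zero
  modulus.\<close>

lemma aec_finite:
  assumes "\<rho> \<in> borel_measurable borel" "Lp_int \<rho> < \<infinity>"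
  shows "finite_on S \<rho>"
  unfolding aec_def zero_modulus_iff
  by (rule bexI[OF _ assms(1)]) (use assms(2) in \<open>auto simp: curve_integral_eq less_top[symmetric]\<close>)

lemma segment_integral_finite_AE:
  assumes "(l, \<gamma>) \<in> curves S" "\<rho> \<in> borel_measurable borel" "segment_integral \<rho> \<gamma> 0 l < \<infinity>"
  shows "AE t in lborel. t \<in> {0..l} \<longrightarrow> \<rho> (\<gamma> t) < \<infinity>"
proof -
  have "AE t in lborel. \<rho> (\<gamma> t) * indicator {0..l} t \<noteq> \<infinity>"
    using assms curve_measurable[OF assms(1,2), of 0 l]
    by (intro nn_integral_noteq_infinite) (auto simp: segment_integral_def)
  then show ?thesis by eventually_elim (auto simp: less_top[symmetric])
qed

text \<open>The density that is infinite on a Borel null set covering \<open>A\<close> has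
  p-integral 0, and its line integral is finite only along curves that spend no time in that
  set.\<close>

lemma aec_null:
  assumes "A \<in> null_sets M"
  shows "aec S (\<lambda>l \<gamma>. AE t in lborel. t \<in> {0..l} \<longrightarrow> \<gamma> t \<notin> A)"
proof -
  obtain N where N: "N \<in> sets borel" "A \<subseteq> N" "N \<in> null_sets M"
    using null_set_cover[OF assms] .
  let ?\<rho> = "\<lambda>x. if x \<in> N then \<infinity> else 0 :: ennreal"
  have m: "?\<rho> \<in> borel_measurable borel" using N(1) by measurable
  have "Lp_int (\<lambda>x. ?\<rho> x) = (\<integral>\<^sup>+ x. 0 \<partial>M)"
    by (rule nn_integral_cong_AE) (use AE_not_in[OF N(3)] in eventually_elim, auto)
  then have "aec S (\<lambda>l \<gamma>. segment_integral ?\<rho> \<gamma> 0 l < \<infinity>)"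
    by (intro aec_finite m) simp
  then show ?thesis
  proof (rule aec_mono)
    fix l \<gamma> assume "(l, \<gamma>) \<in> curves S" "segment_integral ?\<rho> \<gamma> 0 l < \<infinity>"
    from segment_integral_finite_AE[OF this(1) m this(2)]
    show "AE t in lborel. t \<in> {0..l} \<longrightarrow> \<gamma> t \<notin> A"
      by eventually_elim (use N(2) in \<open>auto split: if_splits\<close>)
  qed
qed

lemma AE_exists_in_interval:
  assumes "AE t in lborel. t \<in> {0..l::real} \<longrightarrow> P t" "0 < l"
  obtains t where "t \<in> {0..l}" "P t"
proof (rule ccontr)
  assume "\<not> thesis"
  then have "\<forall>t\<in>{0..l}. \<not> P t" using that by blast
  then have "AE t in lborel. t \<notin> {0..l}" using assms(1) by (auto elim!: eventually_mono)
  then have "emeasure lborel {0..l} = 0"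
    using AE_iff_measurable[of "{0..l}" lborel "\<lambda>t. t \<notin> {0..l}"]
    by (simp add: Collect_conj_eq[symmetric] atLeastAtMost_def atLeast_def atMost_def)
  then show False using assms(2) by simp
qed

text \<open>The curve-wise description of capacity zero, see \<open>capacity_zero_iff\<close>.
  Nullity is a separate requirement because a space may have too few curves for the second condition
  to say anything.\<close>

definition exceptional :: "'a set \<Rightarrow> bool" where
  "exceptional A \<longleftrightarrow> A \<in> null_sets M \<and> aec UNIV (\<lambda>l \<gamma>. \<forall>t\<in>{0..l}. \<gamma> t \<notin> A)"

lemma exceptional_subset:
  assumes "exceptional B" "A \<subseteq> B"
  shows "exceptional A"
  unfolding exceptional_def
proof
  show "A \<in> null_sets M" using assms complete2[of A B] by (simp add: exceptional_def)
  have "aec UNIV (\<lambda>l \<gamma>. \<forall>t\<in>{0..l}. \<gamma> t \<notin> B)" using assms by (simp add: exceptional_def)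
  then show "aec UNIV (\<lambda>l \<gamma>. \<forall>t\<in>{0..l}. \<gamma> t \<notin> A)" by (rule aec_mono) (use assms(2) in blast)
qed

lemma exceptional_UN:
  assumes "\<And>n::nat. exceptional (A n)"
  shows "exceptional (\<Union>n. A n)"
  unfolding exceptional_def
proof
  show "(\<Union>n. A n) \<in> null_sets M" using assms by (intro null_sets_UN) (simp add: exceptional_def)
  have "aec UNIV (\<lambda>l \<gamma>. \<forall>n. \<forall>t\<in>{0..l}. \<gamma> t \<notin> A n)"
    using assms by (intro aec_all_nat) (simp add: exceptional_def)
  then show "aec UNIV (\<lambda>l \<gamma>. \<forall>t\<in>{0..l}. \<gamma> t \<notin> (\<Union>n. A n))" by (rule aec_mono) blast
qed

lemma exceptional_Un:
  assumes "exceptional A" "exceptional B"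
  shows "exceptional (A \<union> B)"
proof -
  have "exceptional (\<Union>n. if n = (0::nat) then A else B)"
    using assms by (intro exceptional_UN) auto
  then show ?thesis by (rule exceptional_subset) (auto split: if_splits)
qed

lemma exceptional_AE: "exceptional A \<Longrightarrow> AE x in M. x \<notin> A"
  unfolding exceptional_def by (blast intro: AE_not_in)

lemma exceptional_aec: "exceptional A \<Longrightarrow> aec S (\<lambda>l \<gamma>. \<forall>t\<in>{0..l}. \<gamma> t \<notin> A)"
  unfolding exceptional_def by (blast intro: aec_subset)

end


section \<open>Functions of one variable with an integrable majorant for their increments\<close>

text \<open>This is \<open>m1 - n1 = m2 - n2\<close> written without subtraction. Half-open
  intervals are stable under intersection, and finiteness of the total on the interval permits the
  cancellation needed for complements.\<close>

lemma emeasure_add_eq_on_Ioc: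
  fixes m1 m2 n1 n2 :: "real measure"
  assumes sets: "sets m1 = sets borel" "sets m2 = sets borel" "sets n1 = sets borel" "sets n2 = sets borel"
    and fin: "emeasure m1 {a<..b} + emeasure n2 {a<..b} < \<infinity>"
    and eq: "\<And>s t. a \<le> s \<Longrightarrow> s \<le> t \<Longrightarrow> t \<le> b \<Longrightarrow>
      emeasure m1 {s<..t} + emeasure n2 {s<..t} = emeasure m2 {s<..t} + emeasure n1 {s<..t}"
    and "a \<le> b" and X: "X \<in> sets borel"
  shows "emeasure m1 (X \<inter> {a<..b}) + emeasure n2 (X \<inter> {a<..b})
    = emeasure m2 (X \<inter> {a<..b}) + emeasure n1 (X \<inter> {a<..b})"
proof -
  let ?I = "{a<..b}" and ?G = "range (\<lambda>(a, b). {a<..b::real})"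
  let ?l = "\<lambda>X. emeasure m1 X + emeasure n2 X" and ?r = "\<lambda>X. emeasure m2 X + emeasure n1 X"
  have borel: "sigma_sets UNIV ?G = sets borel"
    by (simp add: borel_sigma_sets_Ioc)
  have Int: "{s<..t} \<inter> {s'<..t'} = {max s s'<..min t t'}" for s t s' t' :: real by auto
  have "Int_stable ?G"
    by (auto simp: Int_stable_def)
  moreover have "?G \<subseteq> Pow UNIV" by simp
  moreover have "X \<in> sigma_sets UNIV ?G" using X borel by simp
  ultimately show ?thesis
  proof (induction rule: sigma_sets_induct_disjoint)
    case (basic A)
    then obtain s t where A: "A = {s<..t}" by auto
    show ?case
    proof (cases "max s a \<le> min t b")
      case True
      then show ?thesis unfolding A Int by (intro eq) auto
    next
      case False
      then have "{max s a<..min t b} = {}" by (intro greaterThanAtMost_empty) linarith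
      then show ?thesis unfolding A Int by (simp only: emeasure_empty)
    qed
  next
    case empty
    show ?case by simp
  next
    case (compl A)
    have A [measurable]: "A \<in> sets borel" using compl borel by simp
    have split: "emeasure m ?I = emeasure m (A \<inter> ?I) + emeasure m ((UNIV - A) \<inter> ?I)"
      if [measurable_cong]: "sets m = sets borel" for m :: "real measure"
    proof -
      have "A \<inter> ?I \<in> sets m" "(UNIV - A) \<inter> ?I \<in> sets m"
        using that A by auto
      then have "emeasure m (A \<inter> ?I) + emeasure m ((UNIV - A) \<inter> ?I) = emeasure m (A \<inter> ?I \<union> (UNIV - A) \<inter> ?I)"
        by (intro plus_emeasure) auto
      also have "A \<inter> ?I \<union> (UNIV - A) \<inter> ?I = ?I" by auto
      finally show ?thesis ..
    qed
    have "?l (A \<inter> ?I) + ?l ((UNIV - A) \<inter> ?I) = ?l ?I"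
      using split[OF sets(1)] split[OF sets(4)] by (simp add: ac_simps)
    also have "\<dots> = ?r ?I" using eq[of a b] \<open>a \<le> b\<close> by simp
    also have "\<dots> = ?r (A \<inter> ?I) + ?r ((UNIV - A) \<inter> ?I)"
      using split[OF sets(2)] split[OF sets(3)] by (simp add: ac_simps)
    finally have e: "?l (A \<inter> ?I) + ?l ((UNIV - A) \<inter> ?I) = ?l (A \<inter> ?I) + ?r ((UNIV - A) \<inter> ?I)"
      using compl by simp
    have "?l (A \<inter> ?I) \<le> ?l ?I"
      using split[OF sets(1)] split[OF sets(4)] by (simp add: add_mono)
    then have "?l (A \<inter> ?I) \<noteq> \<infinity>" using fin by (auto simp: top_unique)
    then show ?case using e by (simp add: ennreal_add_left_cancel)
  next
    case (union A)
    have *: "emeasure m ((\<Union>i. A i) \<inter> ?I) = (\<Sum>i. emeasure m (A i \<inter> ?I))"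
      if "sets m = sets borel" for m :: "real measure"
    proof -
      have "(\<Sum>i. emeasure m (A i \<inter> ?I)) = emeasure m (\<Union>i. A i \<inter> ?I)"
      proof (rule suminf_emeasure)
        show "range (\<lambda>i. A i \<inter> ?I) \<subseteq> sets m"
          using union(2) borel that by auto
        show "disjoint_family (\<lambda>i. A i \<inter> ?I)"
          using union(1) by (auto simp: disjoint_family_on_def)
      qed
      then show ?thesis by (simp add: Int_UN_distrib2)
    qed
    have "?l ((\<Union>i. A i) \<inter> ?I) = (\<Sum>i. ?l (A i \<inter> ?I))"
      by (simp add: * sets suminf_add[symmetric])
    also have "\<dots> = (\<Sum>i. ?r (A i \<inter> ?I))" using union(3) by simp
    also have "\<dots> = ?r ((\<Union>i. A i) \<inter> ?I)"
      by (simp add: * sets suminf_add[symmetric])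
    finally show ?case .
  qed
qed

locale increment_majorant =
  fixes h :: "real \<Rightarrow> real" and G :: "real \<Rightarrow> ennreal" and a b :: real
  assumes ab: "a \<le> b"
    and meas [measurable]: "(\<lambda>t. G t * indicator {a..b} t) \<in> borel_measurable borel"
    and fin: "(\<integral>\<^sup>+ t. G t * indicator {a..b} t \<partial>lborel) < \<infinity>"
    and incr: "\<And>s t. a \<le> s \<Longrightarrow> s \<le> t \<Longrightarrow> t \<le> b \<Longrightarrow>
      ennreal \<bar>h s - h t\<bar> \<le> (\<integral>\<^sup>+ r. G r * indicator {s..t} r \<partial>lborel)"
begin

definition \<nu> :: "real measure" where "\<nu> = density lborel (\<lambda>t. G t * indicator {a..b} t)"

text \<open>Serves to continue \<open>h\<close> constantly beyond the interval, because
  \<open>interval_measure\<close> asks for a function that is nondecreasing and right continuous on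
  the whole line.\<close>

definition clamp :: "real \<Rightarrow> real" where "clamp t = max a (min b t)"

definition rest :: "real \<Rightarrow> real" where "rest t = cdf \<nu> t - h (clamp t)"

lemma sets_nu [simp, measurable_cong]: "sets \<nu> = sets borel"
  by (simp add: \<nu>_def)

lemma emeasure_nu:
  "A \<in> sets borel \<Longrightarrow> emeasure \<nu> A = (\<integral>\<^sup>+ t. G t * indicator {a..b} t * indicator A t \<partial>lborel)"
  unfolding \<nu>_def by (subst emeasure_density) auto

sublocale finite_borel_measure \<nu>
proof (intro finite_borel_measure.intro finite_borel_measure_axioms.intro finite_measureI)
  show "emeasure \<nu> (space \<nu>) \<noteq> \<infinity>"
    using fin by (simp add: \<nu>_def emeasure_density)
qed simp

lemma nu_singleton: "measure \<nu> {t} = 0"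
proof -
  have "emeasure \<nu> {t} = (\<integral>\<^sup>+ r. G r * indicator {a..b} r * indicator {t} r \<partial>lborel)"
    by (rule emeasure_nu) simp
  also have "\<dots> = (\<integral>\<^sup>+ (r::real). 0 \<partial>lborel)"
    by (rule nn_integral_cong_AE) (use AE_lborel_singleton[of t] in \<open>auto elim!: eventually_mono\<close>)
  finally have "emeasure \<nu> {t} = (\<integral>\<^sup>+ (r::real). 0 \<partial>lborel)" .
  then show ?thesis by (simp add: measure_def)
qed

lemma cdf_diff: "s \<le> t \<Longrightarrow> cdf \<nu> t - cdf \<nu> s = measure \<nu> {s<..t}"
  using cdf_diff_eq[of s t] by (cases "s = t") auto

lemma increment_le_cdf:
  assumes "a \<le> s" "s \<le> t" "t \<le> b"
  shows "\<bar>h s - h t\<bar> \<le> cdf \<nu> t - cdf \<nu> s"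
proof -
  have "ennreal \<bar>h s - h t\<bar> \<le> (\<integral>\<^sup>+ r. G r * indicator {s..t} r \<partial>lborel)"
    using assms by (rule incr)
  also have "\<dots> = (\<integral>\<^sup>+ r. G r * indicator {a..b} r * indicator {s<..t} r \<partial>lborel)"
    by (rule nn_integral_cong_AE)
      (use AE_lborel_singleton[of s] assms in \<open>auto elim!: eventually_mono split: split_indicator\<close>)
  also have "\<dots> = emeasure \<nu> {s<..t}" by (rule emeasure_nu[symmetric]) simp
  also have "\<dots> = ennreal (cdf \<nu> t - cdf \<nu> s)"
    using assms by (simp add: cdf_diff emeasure_eq_measure)
  finally show ?thesis
    using assms by (subst (asm) ennreal_le_iff) (auto simp: cdf_diff)
qed

lemma clamp_increment:
  assumes "s \<le> t"
  shows "\<bar>h (clamp s) - h (clamp t)\<bar> \<le> cdf \<nu> t - cdf \<nu> s"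
proof (cases "clamp s = clamp t")
  case True
  then show ?thesis using assms by (simp add: cdf_diff)
next
  case False
  have "\<bar>h (clamp s) - h (clamp t)\<bar> \<le> cdf \<nu> (clamp t) - cdf \<nu> (clamp s)"
    using assms ab by (intro increment_le_cdf) (auto simp: clamp_def)
  also have "\<dots> \<le> cdf \<nu> t - cdf \<nu> s"
    using False assms by (intro diff_mono cdf_nondecreasing) (auto simp: clamp_def min_def max_def split: if_splits)
  finally show ?thesis .
qed

text \<open>The increments are dominated by those of the distribution function, which is continuous
  because \<open>\<nu>\<close> has no atoms.\<close>

lemma continuous: "continuous_on {a..b} h"
  unfolding continuous_on_def
proof
  fix x assume x: "x \<in> {a..b}"
  have "isCont (cdf \<nu>) x" by (simp add: isCont_cdf nu_singleton)
  then have lim: "((\<lambda>y. \<bar>cdf \<nu> y - cdf \<nu> x\<bar>) \<longlongrightarrow> 0) (at x within {a..b})"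
    by (intro tendsto_rabs_zero LIM_zero) (auto simp: isCont_def intro: tendsto_within_subset)
  have "((\<lambda>y. h y - h x) \<longlongrightarrow> 0) (at x within {a..b})"
  proof (rule Lim_null_comparison[OF _ lim])
    show "\<forall>\<^sub>F y in at x within {a..b}. norm (h y - h x) \<le> \<bar>cdf \<nu> y - cdf \<nu> x\<bar>"
      unfolding eventually_at_filter
    proof (intro always_eventually allI impI)
      fix y assume "y \<in> {a..b}"
      then show "norm (h y - h x) \<le> \<bar>cdf \<nu> y - cdf \<nu> x\<bar>"
        using increment_le_cdf[of x y] increment_le_cdf[of y x] x by (cases "x \<le> y") auto
    qed
  qed
  then show "(h \<longlongrightarrow> h x) (at x within {a..b})" by (simp add: LIM_zero_iff)
qed

lemma rest_mono: "s \<le> t \<Longrightarrow> rest s \<le> rest t"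
  using clamp_increment[of s t] by (auto simp: rest_def)

lemma rest_right_cont: "continuous (at_right s) rest"
proof -
  have c: "continuous (at_right s) (cdf \<nu>)" by (rule cdf_is_right_cont)
  then have lim: "((\<lambda>y. cdf \<nu> y - cdf \<nu> s) \<longlongrightarrow> 0) (at_right s)"
    by (simp add: continuous_within LIM_zero)
  have "((\<lambda>y. h (clamp y) - h (clamp s)) \<longlongrightarrow> 0) (at_right s)"
  proof (rule Lim_null_comparison[OF _ lim])
    show "\<forall>\<^sub>F y in at_right s. norm (h (clamp y) - h (clamp s)) \<le> cdf \<nu> y - cdf \<nu> s"
      unfolding eventually_at_filter
    proof (intro always_eventually allI impI)
      fix y assume "y \<in> {s<..}"
      then show "norm (h (clamp y) - h (clamp s)) \<le> cdf \<nu> y - cdf \<nu> s"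
        using clamp_increment[of s y] by auto
    qed
  qed
  then have "continuous (at_right s) (\<lambda>y. h (clamp y))"
    by (simp add: continuous_within LIM_zero_iff)
  then show ?thesis
    unfolding rest_def using c by (intro continuous_diff)
qed

lemma emeasure_rest: "s \<le> t \<Longrightarrow> emeasure (interval_measure rest) {s<..t} = ennreal (rest t - rest s)"
  by (intro emeasure_interval_measure_Ioc rest_mono rest_right_cont)

lemma emeasure_nu_Ioc: "s \<le> t \<Longrightarrow> emeasure \<nu> {s<..t} = ennreal (cdf \<nu> t - cdf \<nu> s)"
  by (simp add: cdf_diff emeasure_eq_measure)

end

text \<open>
  With \<open>\<nu>\<^sub>i\<close> the measure with density \<open>G\<^sub>i\<close> and \<open>m\<^sub>i\<close> the Stieltjes measure of the increasing function
  $\int G_i - h$, one has \<open>m\<^sub>1 + \<nu>\<^sub>2 = m\<^sub>2 + \<nu>\<^sub>1\<close> on intervals, hence on Borel sets. This transfers the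
  bounds from intervals to the sets where \<open>G\<^sub>1\<close> or \<open>G\<^sub>2\<close> is smaller.
\<close>

lemma increment_le_min:
  assumes 1: "increment_majorant h G1 a b" and 2: "increment_majorant h G2 a b"
  shows "ennreal \<bar>h a - h b\<bar> \<le> (\<integral>\<^sup>+ t. min (G1 t) (G2 t) * indicator {a..b} t \<partial>lborel)"
proof -
  \<comment> \<open>Only the signed increment is bounded here; the other sign follows by applying
    this to \<open>- h\<close>.\<close>
  have one_sided: "ennreal (h b - h a) \<le> (\<integral>\<^sup>+ t. min (G1 t) (G2 t) * indicator {a..b} t \<partial>lborel)"
    if 1: "increment_majorant h G1 a b" and 2: "increment_majorant h G2 a b" for h
  proof (cases "h a \<le> h b")
    case False
    then show ?thesis by (simp add: ennreal_neg)
  next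
    case True
    interpret i1: increment_majorant h G1 a b by fact
    interpret i2: increment_majorant h G2 a b by fact
    let ?I = "{a<..b}"
    let ?m1 = "interval_measure i1.rest" and ?m2 = "interval_measure i2.rest"
    \<comment> \<open>On \<open>X\<close> the measure with density \<open>G1\<close> is kept; off
      \<open>X\<close> it is exchanged for the one with density \<open>G2\<close>.\<close>
    define X where "X = {t. G1 t * indicator {a..b} t \<le> G2 t * indicator {a..b} t}"
    have X [measurable]: "X \<in> sets borel" unfolding X_def by measurable
    note ab = i1.ab
    have clamp: "i1.clamp t = t" "i2.clamp t = t" if "a \<le> t" "t \<le> b" for t
      using that by (auto simp: i1.clamp_def i2.clamp_def)
    have eq: "emeasure ?m1 (Y \<inter> ?I) + emeasure i2.\<nu> (Y \<inter> ?I) = emeasure ?m2 (Y \<inter> ?I) + emeasure i1.\<nu> (Y \<inter> ?I)"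
      if "Y \<in> sets borel" for Y
    proof (rule emeasure_add_eq_on_Ioc)
      fix s t assume st: "a \<le> s" "s \<le> t" "t \<le> b"
      show "emeasure ?m1 {s<..t} + emeasure i2.\<nu> {s<..t} = emeasure ?m2 {s<..t} + emeasure i1.\<nu> {s<..t}"
        using st i1.rest_mono[of s t] i2.rest_mono[of s t] i1.cdf_nondecreasing[of s t] i2.cdf_nondecreasing[of s t]
        by (simp add: i1.emeasure_rest i2.emeasure_rest i1.emeasure_nu_Ioc i2.emeasure_nu_Ioc
            i1.rest_def i2.rest_def clamp flip: ennreal_plus)
    qed (use ab that in \<open>auto simp: i1.emeasure_rest i2.emeasure_nu_Ioc\<close>)
    have "ennreal (h b - h a) + emeasure ?m1 ?I = emeasure i1.\<nu> ?I"
      using ab True i1.rest_mono[of a b] clamp[of a] clamp[of b]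
      by (simp add: i1.emeasure_rest i1.emeasure_nu_Ioc i1.rest_def flip: ennreal_plus)
    also have "\<dots> = emeasure i1.\<nu> (X \<inter> ?I) + emeasure i1.\<nu> ((UNIV - X) \<inter> ?I)"
      by (subst plus_emeasure) (auto intro!: arg_cong[where f="emeasure i1.\<nu>"])
    \<comment> \<open>The exchange: \<open>i1.\<nu>\<close> is at most \<open>?m2\<close> plus
      \<open>i1.\<nu>\<close>, which equals \<open>?m1\<close> plus \<open>i2.\<nu>\<close>. The
      surplus \<open>?m1\<close> is at most its total on the interval, which also stands on the left
      and cancels.\<close>
    also have "emeasure i1.\<nu> ((UNIV - X) \<inter> ?I) \<le> emeasure ?m1 ((UNIV - X) \<inter> ?I) + emeasure i2.\<nu> ((UNIV - X) \<inter> ?I)"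
      using eq[of "UNIV - X"] X by (simp add: sets.Diff)
    also have "emeasure ?m1 ((UNIV - X) \<inter> ?I) \<le> emeasure ?m1 ?I"
      by (rule emeasure_mono) auto
    finally have "ennreal (h b - h a) + emeasure ?m1 ?I
        \<le> (emeasure i1.\<nu> (X \<inter> ?I) + emeasure i2.\<nu> ((UNIV - X) \<inter> ?I)) + emeasure ?m1 ?I"
      by (simp add: ac_simps add_left_mono)
    moreover have "emeasure ?m1 ?I \<noteq> \<infinity>" using ab by (simp add: i1.emeasure_rest)
    ultimately have "ennreal (h b - h a) \<le> emeasure i1.\<nu> (X \<inter> ?I) + emeasure i2.\<nu> ((UNIV - X) \<inter> ?I)"
      by (simp add: add.commute[of _ "emeasure ?m1 ?I"] ennreal_add_left_cancel_le)
    also have "\<dots> = (\<integral>\<^sup>+ t. G1 t * indicator {a..b} t * indicator (X \<inter> ?I) t \<partial>lborel)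
        + (\<integral>\<^sup>+ t. G2 t * indicator {a..b} t * indicator ((UNIV - X) \<inter> ?I) t \<partial>lborel)"
      by (simp add: i1.emeasure_nu i2.emeasure_nu sets.Diff)
    also have "\<dots> = (\<integral>\<^sup>+ t. G1 t * indicator {a..b} t * indicator (X \<inter> ?I) t
        + G2 t * indicator {a..b} t * indicator ((UNIV - X) \<inter> ?I) t \<partial>lborel)"
      by (rule nn_integral_add[symmetric]) measurable
    also have "\<dots> \<le> (\<integral>\<^sup>+ t. min (G1 t) (G2 t) * indicator {a..b} t \<partial>lborel)"
    proof (rule nn_integral_mono)
      fix t
      have ind: "indicator {a..b} t = (1::ennreal)" if "t \<in> ?I" using that by simp
      show "G1 t * indicator {a..b} t * indicator (X \<inter> ?I) t
          + G2 t * indicator {a..b} t * indicator ((UNIV - X) \<inter> ?I) t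
        \<le> min (G1 t) (G2 t) * indicator {a..b} t"
      proof (cases "t \<in> ?I")
        case True
        note i = ind[OF True]
        show ?thesis
        proof (cases "t \<in> X")
          case X: True
          then have "G1 t \<le> G2 t" using i by (simp add: X_def)
          then show ?thesis using True X by (simp add: i indicator_def)
        next
          case X: False
          then have "G2 t \<le> G1 t" using i by (simp add: X_def)
          then show ?thesis using True X by (simp add: i indicator_def)
        qed
      qed (simp add: indicator_def)
    qed
    finally show ?thesis .
  qed
  have neg: "increment_majorant (\<lambda>t. - h t) G a b" if "increment_majorant h G a b" for G
  proof -
    interpret increment_majorant h G a b by fact
    show ?thesis
      by standard (use ab meas fin incr in \<open>auto simp: abs_minus_commute\<close>)
  qed
  show ?thesis
    using one_sided[OF 1 2] one_sided[OF neg[OF 1] neg[OF 2]] by (auto simp: abs_if)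
qed

text \<open>The set where \<open>H\<close> vanishes is cut out between its first and its last point.\<close>

lemma increment_le_off_zeros:
  fixes K H :: "real \<Rightarrow> real" and G :: "real \<Rightarrow> ennreal"
  assumes ab: "a \<le> b" and meas [measurable]: "(\<lambda>t. G t * indicator {a..b} t) \<in> borel_measurable borel"
    and cont: "continuous_on {a..b} H" and K: "\<And>t. a \<le> t \<Longrightarrow> t \<le> b \<Longrightarrow> \<bar>K t\<bar> \<le> H t"
    and incr: "\<And>s t. a \<le> s \<Longrightarrow> s \<le> t \<Longrightarrow> t \<le> b \<Longrightarrow> (\<And>r. s \<le> r \<Longrightarrow> r \<le> t \<Longrightarrow> 0 < H r) \<Longrightarrow>
      ennreal \<bar>K s - K t\<bar> \<le> (\<integral>\<^sup>+ r. G r * indicator {s..t} r \<partial>lborel)"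
  shows "ennreal \<bar>K a - K b\<bar> \<le> (\<integral>\<^sup>+ t. G t * indicator {a..b} t \<partial>lborel)"
proof (cases "\<exists>t\<in>{a..b}. H t = 0")
  case False
  then have "0 < H t" if "a \<le> t" "t \<le> b" for t
    using K[OF that] that by (metis abs_ge_zero atLeastAtMost_iff less_le order_trans)
  then show ?thesis using ab by (intro incr) auto
next
  case True
  define Z where "Z = {t\<in>{a..b}. H t = 0}"
  have Z: "closed Z" "Z \<noteq> {}" "Z \<subseteq> {a..b}"
    using True continuous_closed_preimage_constant[OF cont, of 0] by (auto simp: Z_def)
  then have bdd: "bdd_below Z" "bdd_above Z" by (auto intro: bdd_below_mono bdd_above_mono)
  define z1 z2 where "z1 = Inf Z" and "z2 = Sup Z"
  have z: "z1 \<in> Z" "z2 \<in> Z" "z1 \<le> z2"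
    using closed_contains_Inf[OF Z(2) bdd(1) Z(1)] closed_contains_Sup[OF Z(2) bdd(2) Z(1)]
      cInf_lower[OF _ bdd(1)] by (auto simp: z1_def z2_def)
  then have zab: "a \<le> z1" "z2 \<le> b" "z1 \<le> b" "a \<le> z2" and H0: "H z1 = 0" "H z2 = 0"
    using Z(3) by (auto simp: Z_def)
  have pos: "0 < H t" if "a \<le> t" "t \<le> b" "t < z1 \<or> z2 < t" for t
  proof -
    have "t \<notin> Z" using that cInf_lower[OF _ bdd(1), of t] cSup_upper[OF _ bdd(2), of t]
      by (auto simp: z1_def z2_def)
    then show ?thesis using K[of t] that by (auto simp: Z_def)
  qed
  let ?J = "\<lambda>s t. \<integral>\<^sup>+ r. G r * indicator {s..t} r \<partial>lborel"
  have Jmono: "?J s t \<le> ?J s' t'" if "s' \<le> s" "t \<le> t'" for s t s' t'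
    using that by (intro nn_integral_mono) (auto split: split_indicator)
  \<comment> \<open>The hypothesis \<open>incr\<close> covers only intervals without zeros of
    \<open>H\<close>, hence [a,s] with s < z1. As s tends to z1, the remainder
    \<open>\<bar>K s\<bar>\<close> vanishes because it is at most \<open>H s\<close>. The limit is
    taken in \<open>H\<close>, whose continuity is known, and not in \<open>K\<close>.\<close>
  have Ka: "ennreal \<bar>K a\<bar> \<le> ?J a z1"
  proof (cases "a = z1")
    case True
    then show ?thesis using K[of a] H0 ab by simp
  next
    case False
    then have "a < z1" using zab by simp
    have "(H \<longlongrightarrow> H z1) (at z1 within {a..b})"
      using cont zab by (simp add: continuous_on_def)
    then have lim: "(H \<longlongrightarrow> 0) (at z1 within {a..z1})"
      unfolding H0 by (rule tendsto_within_subset) (use zab in auto)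
    then have "((\<lambda>s. ?J a z1 + ennreal (H s)) \<longlongrightarrow> ?J a z1 + ennreal 0) (at z1 within {a..z1})"
      by (intro tendsto_add tendsto_ennrealI tendsto_const)
    moreover have "\<forall>\<^sub>F s in at z1 within {a..z1}. ennreal \<bar>K a\<bar> \<le> ?J a z1 + ennreal (H s)"
      unfolding eventually_at_filter
    proof (intro always_eventually allI impI)
      fix s assume s: "s \<noteq> z1" "s \<in> {a..z1}"
      have "ennreal \<bar>K a\<bar> \<le> ennreal (\<bar>K a - K s\<bar> + \<bar>K s\<bar>)" by (intro ennreal_leI) auto
      also have "\<dots> = ennreal \<bar>K a - K s\<bar> + ennreal \<bar>K s\<bar>" by simp
      also have "\<dots> \<le> ?J a s + ennreal (H s)"
        using s zab K[of s] by (intro add_mono ennreal_leI incr pos) auto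
      also have "\<dots> \<le> ?J a z1 + ennreal (H s)" using s by (intro add_right_mono Jmono) auto
      finally show "ennreal \<bar>K a\<bar> \<le> ?J a z1 + ennreal (H s)" .
    qed
    moreover have "at z1 within {a..z1} \<noteq> bot"
      using \<open>a < z1\<close> by (simp add: trivial_limit_within islimpt_Icc)
    ultimately show ?thesis
      using tendsto_lowerbound by fastforce
  qed
  have Kb: "ennreal \<bar>K b\<bar> \<le> ?J z2 b"
  proof (cases "b = z2")
    case True
    then show ?thesis using K[of b] H0 ab by simp
  next
    case False
    then have "z2 < b" using zab by simp
    have "(H \<longlongrightarrow> H z2) (at z2 within {a..b})"
      using cont zab by (simp add: continuous_on_def)
    then have lim: "(H \<longlongrightarrow> 0) (at z2 within {z2..b})"
      unfolding H0 by (rule tendsto_within_subset) (use zab in auto)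
    then have "((\<lambda>s. ?J z2 b + ennreal (H s)) \<longlongrightarrow> ?J z2 b + ennreal 0) (at z2 within {z2..b})"
      by (intro tendsto_add tendsto_ennrealI tendsto_const)
    moreover have "\<forall>\<^sub>F s in at z2 within {z2..b}. ennreal \<bar>K b\<bar> \<le> ?J z2 b + ennreal (H s)"
      unfolding eventually_at_filter
    proof (intro always_eventually allI impI)
      fix s assume s: "s \<noteq> z2" "s \<in> {z2..b}"
      have "ennreal \<bar>K b\<bar> \<le> ennreal (\<bar>K s - K b\<bar> + \<bar>K s\<bar>)" by (intro ennreal_leI) auto
      also have "\<dots> = ennreal \<bar>K s - K b\<bar> + ennreal \<bar>K s\<bar>" by simp
      also have "\<dots> \<le> ?J s b + ennreal (H s)"
        using s zab K[of s] by (intro add_mono ennreal_leI incr pos) auto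
      also have "\<dots> \<le> ?J z2 b + ennreal (H s)" using s by (intro add_right_mono Jmono) auto
      finally show "ennreal \<bar>K b\<bar> \<le> ?J z2 b + ennreal (H s)" .
    qed
    moreover have "at z2 within {z2..b} \<noteq> bot"
      using \<open>z2 < b\<close> by (simp add: trivial_limit_within islimpt_Icc)
    ultimately show ?thesis
      using tendsto_lowerbound by fastforce
  qed
  have sub: "(\<lambda>t. G t * indicator {s..t'} t) \<in> borel_measurable borel" if "a \<le> s" "t' \<le> b" for s t'
  proof -
    have "(\<lambda>t. G t * indicator {a..b} t * indicator {s..t'} t) \<in> borel_measurable borel" by measurable
    also have "(\<lambda>t. G t * indicator {a..b} t * indicator {s..t'} t) = (\<lambda>t. G t * indicator {s..t'} t)"
      using that by (auto split: split_indicator)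
    finally show ?thesis .
  qed
  have "ennreal \<bar>K a - K b\<bar> \<le> ennreal (\<bar>K a\<bar> + \<bar>K b\<bar>)" by (intro ennreal_leI) auto
  also have "\<dots> = ennreal \<bar>K a\<bar> + ennreal \<bar>K b\<bar>" by simp
  also have "\<dots> \<le> ?J a z1 + ?J z2 b" by (intro add_mono Ka Kb)
  also have "\<dots> = (\<integral>\<^sup>+ r. G r * indicator {a..z1} r + G r * indicator {z2..b} r \<partial>lborel)"
    using zab by (intro nn_integral_add[symmetric]) (auto intro: sub)
  \<comment> \<open>The two intervals meet in at most the point z1 = z2, a null set.\<close>
  also have "\<dots> \<le> ?J a b"
    by (rule nn_integral_mono_AE)
      (use AE_lborel_singleton[of z1] zab z(3) in \<open>auto elim!: eventually_mono split: split_indicator\<close>)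
  finally show ?thesis .
qed


section \<open>Weak upper gradients of real functions\<close>

context sobolev_setting
begin

text \<open>A real function and a Borel density make differences along a curve and measurability of
  line integrals unproblematic. The translation to and from \<open>weak_upper_gradient\<close> is
  done by \<open>weak_to_borel\<close>, \<open>wug_of_gap\<close> and
  \<open>weak_of_wug\<close>.\<close>

definition wug :: "'a set \<Rightarrow> ('a \<Rightarrow> real) \<Rightarrow> ('a \<Rightarrow> ennreal) \<Rightarrow> bool" where
  "wug S u g \<longleftrightarrow> g \<in> borel_measurable borel \<and>
     aec S (\<lambda>l \<gamma>. controls u g l \<gamma>)"

lemma wug_borel: "wug S u g \<Longrightarrow> g \<in> borel_measurable borel"
  by (simp add: wug_def)

lemma wug_borel_M: "wug S u g \<Longrightarrow> g \<in> borel_measurable M"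
  by (intro borel_measurable_M) (rule wug_borel)

lemma wug_aec: "wug S u g \<Longrightarrow> aec S (\<lambda>l \<gamma>. controls u g l \<gamma>)"
  by (simp add: wug_def)

text \<open>On almost every curve all subcurves obey the end-point bound, and every nondegenerate
  subinterval is such a subcurve after a shift.\<close>

lemma wugI_endpoints:
  assumes g: "g \<in> borel_measurable borel"
    and "aec S (\<lambda>l \<gamma>. ennreal \<bar>u (\<gamma> 0) - u (\<gamma> l)\<bar> \<le> segment_integral g \<gamma> 0 l)"
  shows "wug S u g"
  unfolding wug_def
proof (rule conjI[OF g], rule aec_mono[OF aec_subcurves[OF assms(2), of S]], intro allI impI)
  fix l \<gamma> a b
  assume c: "(l, \<gamma>) \<in> curves S"
    and sub: "\<forall>a b. 0 \<le> a \<longrightarrow> a < b \<longrightarrow> b \<le> l \<longrightarrow> \<gamma> ` {a..b} \<subseteq> S \<longrightarrow>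
      ennreal \<bar>u (\<gamma> (a + 0)) - u (\<gamma> (a + (b - a)))\<bar> \<le> segment_integral g (\<lambda>t. \<gamma> (a + t)) 0 (b - a)"
    and ab: "0 \<le> a" "a \<le> b" "b \<le> l"
  have sh: "segment_integral g (\<lambda>t. \<gamma> (a + t)) 0 (b - a) = segment_integral g \<gamma> a b"
    using segment_integral_shift[OF c g ab(1) order_refl order_refl ab(3)] by simp
  have "\<gamma> ` {a..b} \<subseteq> S" using c ab by (auto simp: curves_iff image_subset_iff)
  then show "ennreal \<bar>u (\<gamma> a) - u (\<gamma> b)\<bar> \<le> segment_integral g \<gamma> a b"
    using sub[rule_format, of a b] ab sh by (cases "a = b") auto
qed

text \<open>Almost every curve spends no time in the null set where \<open>g'\<close> falls below
  \<open>g\<close>.\<close>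

lemma wug_AE_mono:
  assumes "wug S u g" "g' \<in> borel_measurable borel" "AE x in M. x \<in> S \<longrightarrow> g x \<le> g' x"
  shows "wug S u g'"
proof -
  let ?N = "{x. \<not> (x \<in> S \<longrightarrow> g x \<le> g' x)}"
  have "?N \<in> null_sets M" using assms(3) by (simp add: AE_M_iff)
  then have "aec S (\<lambda>l \<gamma>. AE t in lborel. t \<in> {0..l} \<longrightarrow> \<gamma> t \<notin> ?N)" by (rule aec_null)
  from aec_conj[OF wug_aec[OF assms(1)] this] show ?thesis
    unfolding wug_def
  proof (intro conjI assms(2), elim aec_mono conjE, intro allI impI)
    fix l \<gamma> a b
    assume c: "(l, \<gamma>) \<in> curves S" and ab: "0 \<le> a" "a \<le> b" "b \<le> l"
      and *: "controls u g l \<gamma>"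
      and AE: "AE t in lborel. t \<in> {0..l} \<longrightarrow> \<gamma> t \<notin> ?N"
    have S: "\<gamma> t \<in> S" if "t \<in> {0..l}" for t using c that by (auto simp: curves_iff image_subset_iff)
    have "segment_integral g \<gamma> a b \<le> segment_integral g' \<gamma> a b"
      unfolding segment_integral_def
      by (rule nn_integral_mono_AE, use AE in eventually_elim)
        (use ab S in \<open>auto split: split_indicator\<close>)
    then show "ennreal \<bar>u (\<gamma> a) - u (\<gamma> b)\<bar> \<le> segment_integral g' \<gamma> a b"
      using * ab by (meson order_trans)
  qed
qed

lemma wug_cong:
  assumes "wug S u g" "aec S (\<lambda>l \<gamma>. \<forall>t\<in>{0..l}. u (\<gamma> t) = v (\<gamma> t))"
  shows "wug S v g"
  unfolding wug_def
  by (rule conjI[OF wug_borel[OF assms(1)]], rule aec_mono[OF aec_conj[OF wug_aec[OF assms(1)] assms(2)]]) auto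

lemma wug_combine:
  assumes "wug S u g1" "wug S v g2" "g \<in> borel_measurable borel"
    and "\<And>l \<gamma> a b. (l, \<gamma>) \<in> curves S \<Longrightarrow> 0 \<le> a \<Longrightarrow> a \<le> b \<Longrightarrow> b \<le> l \<Longrightarrow>
      ennreal \<bar>u (\<gamma> a) - u (\<gamma> b)\<bar> \<le> segment_integral g1 \<gamma> a b \<Longrightarrow>
      ennreal \<bar>v (\<gamma> a) - v (\<gamma> b)\<bar> \<le> segment_integral g2 \<gamma> a b \<Longrightarrow>
      ennreal \<bar>w (\<gamma> a) - w (\<gamma> b)\<bar> \<le> segment_integral g \<gamma> a b"
  shows "wug S w g"
  unfolding wug_def
  by (rule conjI[OF assms(3)], rule aec_mono[OF aec_conj[OF wug_aec[OF assms(1)] wug_aec[OF assms(2)]]])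
    (blast intro: assms(4))

lemma segment_increment_majorant:
  assumes c: "(l, \<gamma>) \<in> curves S" and g: "g \<in> borel_measurable borel"
    and incr: "controls u g l \<gamma>"
    and fin: "segment_integral g \<gamma> 0 l < \<infinity>" and ab: "0 \<le> a" "a \<le> b" "b \<le> l"
  shows "increment_majorant (\<lambda>t. u (\<gamma> t)) (\<lambda>t. g (\<gamma> t)) a b"
proof
  show "(\<lambda>t. g (\<gamma> t) * indicator {a..b} t) \<in> borel_measurable borel"
    using c g ab(1,3) by (rule curve_measurable)
  show "(\<integral>\<^sup>+ t. g (\<gamma> t) * indicator {a..b} t \<partial>lborel) < \<infinity>"
    using segment_integral_mono_interval[OF ab(1,3), of g \<gamma>] fin
    by (simp add: segment_integral_def)
  show "ennreal \<bar>u (\<gamma> s) - u (\<gamma> t)\<bar> \<le> (\<integral>\<^sup>+ r. g (\<gamma> r) * indicator {s..t} r \<partial>lborel)"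
    if "a \<le> s" "s \<le> t" "t \<le> b" for s t
    using incr[rule_format, of s t] that ab by (simp add: segment_integral_def)
qed (rule ab)

lemma wug_min:
  assumes 1: "wug S u g1" "finite_on S g1"
    and 2: "wug S u g2" "finite_on S g2"
  shows "wug S u (\<lambda>x. min (g1 x) (g2 x))"
  unfolding wug_def
proof
  note [measurable] = wug_borel[OF 1(1)] wug_borel[OF 2(1)]
  show "(\<lambda>x. min (g1 x) (g2 x)) \<in> borel_measurable borel" by measurable
  have "aec S (\<lambda>l \<gamma>. (controls u g1 l \<gamma> \<and> segment_integral g1 \<gamma> 0 l < \<infinity>) \<and>
      (controls u g2 l \<gamma> \<and> segment_integral g2 \<gamma> 0 l < \<infinity>))"
    by (intro aec_conj wug_aec 1 2)
  then show "aec S (\<lambda>l \<gamma>. \<forall>a b. 0 \<le> a \<longrightarrow> a \<le> b \<longrightarrow> b \<le> l \<longrightarrow>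
       ennreal \<bar>u (\<gamma> a) - u (\<gamma> b)\<bar> \<le> segment_integral (\<lambda>x. min (g1 x) (g2 x)) \<gamma> a b)"
  proof (rule aec_mono)
    fix l \<gamma>
    assume c: "(l, \<gamma>) \<in> curves S" and *: "(controls u g1 l \<gamma> \<and> segment_integral g1 \<gamma> 0 l < \<infinity>) \<and>
      (controls u g2 l \<gamma> \<and> segment_integral g2 \<gamma> 0 l < \<infinity>)"
    show "\<forall>a b. 0 \<le> a \<longrightarrow> a \<le> b \<longrightarrow> b \<le> l \<longrightarrow>
       ennreal \<bar>u (\<gamma> a) - u (\<gamma> b)\<bar> \<le> segment_integral (\<lambda>x. min (g1 x) (g2 x)) \<gamma> a b"
    proof (intro allI impI)
      fix a b assume ab: "0 \<le> a" "a \<le> b" "b \<le> l"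
      have "increment_majorant (\<lambda>t. u (\<gamma> t)) (\<lambda>t. g1 (\<gamma> t)) a b"
        "increment_majorant (\<lambda>t. u (\<gamma> t)) (\<lambda>t. g2 (\<gamma> t)) a b"
        using segment_increment_majorant[OF c wug_borel[OF 1(1)] _ _ ab, of u]
          segment_increment_majorant[OF c wug_borel[OF 2(1)] _ _ ab, of u] * by blast+
      then show "ennreal \<bar>u (\<gamma> a) - u (\<gamma> b)\<bar> \<le> segment_integral (\<lambda>x. min (g1 x) (g2 x)) \<gamma> a b"
        unfolding segment_integral_def by (rule increment_le_min)
    qed
  qed
qed

lemma wug_INF:
  fixes g :: "nat \<Rightarrow> 'a \<Rightarrow> ennreal"
  assumes wug: "\<And>n. wug S u (g n)" and fin: "\<And>n. finite_on S (g n)"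
  shows "wug S u (\<lambda>x. INF n. g n x)"
proof -
  \<comment> \<open>Running minima remain gradients by \<open>wug_min\<close> and form a decreasing
    sequence, so that monotone convergence for infima applies on curves where the first integral is
    finite.\<close>
  define G where "G = rec_nat (g 0) (\<lambda>n h x. min (h x) (g (Suc n) x))"
  have G_simps: "G 0 = g 0" "G (Suc n) = (\<lambda>x. min (G n x) (g (Suc n) x))" for n
    by (simp_all add: G_def)
  have G: "wug S u (G n) \<and> finite_on S (G n)" for n
  proof (induction n)
    case 0
    then show ?case using wug fin by (simp add: G_simps)
  next
    case (Suc n)
    have "aec S (\<lambda>l \<gamma>. segment_integral (G (Suc n)) \<gamma> 0 l < \<infinity>)"
      by (rule aec_mono[OF fin[of "Suc n"]], erule order.strict_trans1[rotated])
        (auto simp: G_simps intro!: segment_integral_mono)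
    then show ?case using Suc wug fin by (auto simp: G_simps intro!: wug_min)
  qed
  have dec: "G (Suc n) x \<le> G n x" for n x by (simp add: G_simps)
  have dec': "decseq (\<lambda>n. G n x)" for x by (intro decseq_SucI dec)
  have INF_eq: "(INF n. G n x) = (INF n. g n x)" for x
  proof (rule antisym)
    have "G n x \<le> g n x" for n by (cases n) (auto simp: G_simps)
    then show "(INF n. G n x) \<le> (INF n. g n x)" by (intro INF_mono) blast
    have "(INF n. g n x) \<le> G n x" for n
      by (induction n) (auto simp: G_simps intro: INF_lower)
    then show "(INF n. g n x) \<le> (INF n. G n x)" by (intro INF_greatest)
  qed
  note Gm [measurable] = wug_borel[OF conjunct1[OF G]]
  have "aec S (\<lambda>l \<gamma>. \<forall>n. controls u (G n) l \<gamma> \<and> segment_integral (G n) \<gamma> 0 l < \<infinity>)"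
    by (intro aec_all_nat aec_conj wug_aec conjunct1[OF G] conjunct2[OF G])
  then have "aec S (\<lambda>l \<gamma>. controls u (\<lambda>x. INF n. G n x) l \<gamma>)"
  proof (rule aec_mono, intro allI impI)
    fix l \<gamma> a b
    assume c: "(l, \<gamma>) \<in> curves S" and ab: "0 \<le> a" "a \<le> b" "b \<le> l"
      and *: "\<forall>n. controls u (G n) l \<gamma> \<and> segment_integral (G n) \<gamma> 0 l < \<infinity>"
    have "segment_integral (\<lambda>x. INF n. G n x) \<gamma> a b
        = (\<integral>\<^sup>+ t. (INF n. G n (\<gamma> t) * indicator {a..b} t) \<partial>lborel)"
      unfolding segment_integral_def by (intro nn_integral_cong) (auto split: split_indicator)
    also have "\<dots> = (INF n. \<integral>\<^sup>+ t. G n (\<gamma> t) * indicator {a..b} t \<partial>lborel)"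
    proof (rule nn_integral_monotone_convergence_INF_decseq)
      show "decseq (\<lambda>n t. G n (\<gamma> t) * indicator {a..b} t)"
        by (intro decseq_SucI le_funI mult_right_mono dec) auto
      show "(\<lambda>t. G n (\<gamma> t) * indicator {a..b} t) \<in> borel_measurable lborel" for n
        using curve_measurable[OF c Gm ab(1,3)] by simp
      show "(\<integral>\<^sup>+ t. G 0 (\<gamma> t) * indicator {a..b} t \<partial>lborel) < \<infinity>"
        using segment_integral_mono_interval[OF ab(1,3), of "G 0" \<gamma>] * unfolding segment_integral_def
        by (meson order.strict_trans1)
    qed
    finally show "ennreal \<bar>u (\<gamma> a) - u (\<gamma> b)\<bar> \<le> segment_integral (\<lambda>x. INF n. G n x) \<gamma> a b"
      using * ab by (auto intro!: INF_greatest simp flip: segment_integral_def)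
  qed
  then show ?thesis
    unfolding wug_def INF_eq[symmetric] by simp
qed


section \<open>Locally integrable densities\<close>

text \<open>Separability comes from the measure: the balls of radius e/2 are disjoint and of
  positive measure, and those with centres in a fixed ball lie in a larger ball of finite measure,
  so only countably many centres fit.\<close>

lemma countable_separated:
  fixes A :: "'a set" and e :: real
  assumes e: "0 < e" and sep: "\<And>x y. x \<in> A \<Longrightarrow> y \<in> A \<Longrightarrow> x \<noteq> y \<Longrightarrow> e \<le> dist x y"
  shows "countable A"
proof -
  fix x0 :: 'a
  have ball: "0 < emeasure M (ball x r)" "emeasure M (ball x r) < \<infinity>" if "0 < r" for x r
    using mms that by (auto simp: metric_measure_space_def)
  have "countable (A \<inter> ball x0 (Suc n))" for n :: nat
  proof -
    let ?A = "A \<inter> ball x0 (Suc n)" and ?m = "\<lambda>x. measure M (ball x (e / 2))"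
    have "?m summable_on ?A"
    proof (rule nonneg_bdd_above_summable_on)
      show "bdd_above (sum ?m ` {F. F \<subseteq> ?A \<and> finite F})"
      proof (rule bdd_aboveI2)
        fix F assume F: "F \<in> {F. F \<subseteq> ?A \<and> finite F}"
        have disj: "disjoint_family_on (\<lambda>x. ball x (e / 2)) F"
          unfolding disjoint_family_on_def
        proof (intro ballI impI)
          fix x y assume "x \<in> F" "y \<in> F" "x \<noteq> y"
          then have "e \<le> dist x y" using F sep by blast
          then show "ball x (e / 2) \<inter> ball y (e / 2) = {}"
            using dist_triangle_half_r[of _ x e y] by (force simp: dist_commute)
        qed
        have "sum ?m F = measure M (\<Union>x\<in>F. ball x (e / 2))"
          using F disj ball(2)[of "e / 2"] e
          by (intro measure_finite_Union[symmetric]) (auto intro!: borel_sets_M[OF borel_open] simp: less_top[symmetric])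
        also have "\<dots> \<le> measure M (ball x0 (Suc n + e))"
        proof (rule measure_mono_fmeasurable)
          show "(\<Union>x\<in>F. ball x (e / 2)) \<subseteq> ball x0 (Suc n + e)"
          proof safe
            fix x y assume "x \<in> F" "y \<in> ball x (e / 2)"
            then have "dist x0 x < Suc n" "dist x y < e / 2" using F by auto
            then show "y \<in> ball x0 (Suc n + e)" using dist_triangle[of x0 y x] e by simp
          qed
          show "(\<Union>x\<in>F. ball x (e / 2)) \<in> sets M" by (intro borel_sets_M borel_open open_UN ballI open_ball)
          show "ball x0 (Suc n + e) \<in> fmeasurable M"
            using ball(2)[of "Suc n + e" x0] e by (intro fmeasurableI borel_sets_M) (auto simp: add_nonneg_pos)
        qed
        finally show "sum ?m F \<le> measure M (ball x0 (Suc n + e))" .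
      qed
    qed simp
    then have "countable {x \<in> ?A. ?m x \<noteq> 0}" by (rule summable_countable_real)
    moreover have "?m x \<noteq> 0" for x
      using ball[of "e / 2" x] e by (auto simp: measure_def enn2real_eq_0_iff)
    then have "{x \<in> ?A. ?m x \<noteq> 0} = ?A" by blast
    ultimately show ?thesis by (simp only:)
  qed
  then have "countable (\<Union>n::nat. A \<inter> ball x0 (Suc n))" by blast
  moreover have "A \<subseteq> (\<Union>n::nat. A \<inter> ball x0 (Suc n))"
  proof
    fix x assume "x \<in> A"
    obtain n :: nat where "dist x0 x < n" using reals_Archimedean2 by blast
    then have "dist x0 x < real (Suc n)" by simp
    then show "x \<in> (\<Union>n::nat. A \<inter> ball x0 (Suc n))" using \<open>x \<in> A\<close> by (auto intro: exI[of _ n])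
  qed
  ultimately show ?thesis by (rule countable_subset[rotated])
qed

text \<open>A maximal e-separated set is an e-net, since a point at distance at least e from it
  could be added.\<close>

lemma countable_net:
  assumes "0 < e"
  obtains A :: "'a set" where "countable A" "\<And>x. \<exists>y\<in>A. dist y x < e"
proof -
  let ?P = "{A::'a set. \<forall>x\<in>A. \<forall>y\<in>A. x \<noteq> y \<longrightarrow> e \<le> dist x y}"
  have "\<exists>A\<in>?P. \<forall>X\<in>?P. A \<subseteq> X \<longrightarrow> X = A"
  proof (rule subset_Zorn')
    fix C assume C: "subset.chain ?P C"
    show "\<Union>C \<in> ?P"
    proof (intro CollectI ballI impI)
      fix x y assume "x \<in> \<Union>C" "y \<in> \<Union>C" "x \<noteq> y"
      then obtain X Y where XY: "X \<in> C" "Y \<in> C" "x \<in> X" "y \<in> Y" by blast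
      then have "X \<subseteq> Y \<or> Y \<subseteq> X" "X \<in> ?P" "Y \<in> ?P"
        using C unfolding subset_chain_def by blast+
      then show "e \<le> dist x y" using XY \<open>x \<noteq> y\<close> by blast
    qed
  qed
  then obtain A where A: "A \<in> ?P" and max: "\<forall>X\<in>?P. A \<subseteq> X \<longrightarrow> X = A" by (rule bexE)
  show ?thesis
  proof (rule that)
    show "countable A" using A assms by (intro countable_separated[of e]) auto
    fix x show "\<exists>y\<in>A. dist y x < e"
    proof (rule ccontr)
      assume "\<not> (\<exists>y\<in>A. dist y x < e)"
      then have far: "\<forall>y\<in>A. e \<le> dist y x" by auto
      then have "insert x A \<in> ?P" using A by (auto simp: dist_commute)
      from bspec[OF max this] have "insert x A = A" using subset_insertI by (rule mp)
      then have "x \<in> A" by blast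
      then show False using far assms by auto
    qed
  qed
qed

lemma countable_dense:
  obtains D :: "'a set" where "countable D" "\<And>x e. 0 < e \<Longrightarrow> \<exists>y\<in>D. dist y x < e"
proof -
  have "\<forall>n::nat. \<exists>A::'a set. countable A \<and> (\<forall>x. \<exists>y\<in>A. dist y x < 1 / Suc n)"
  proof
    fix n :: nat
    have "0 < 1 / real (Suc n)" by simp
    from countable_net[OF this] show "\<exists>A::'a set. countable A \<and> (\<forall>x. \<exists>y\<in>A. dist y x < 1 / Suc n)"
      by metis
  qed
  then obtain A :: "nat \<Rightarrow> 'a set" where A: "\<And>n. countable (A n)" "\<And>n x. \<exists>y\<in>A n. dist y x < 1 / Suc n"
    by metis
  show ?thesis
  proof (rule that[of "\<Union>n. A n"])
    show "countable (\<Union>n. A n)" using A(1) by blast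
    fix x and e :: real assume "0 < e"
    then obtain n where "1 / Suc n < e" using nat_approx_posE by blast
    then show "\<exists>y\<in>\<Union>n. A n. dist y x < e" using A(2)[of n x] by (meson UN_I UNIV_I order.strict_trans)
  qed
qed

text \<open>Zero modulus asks for a density with finite p-integral over the whole space. Countably
  many balls with finite p-integral of \<open>g\<close> cover \<open>S\<close>, and a curve, being
  compact, lies in finitely many of them.\<close>

lemma aec_finite_loc:
  assumes S: "S \<in> sets M" and g: "g \<in> borel_measurable borel"
    and loc: "\<And>x. x \<in> S \<Longrightarrow> \<exists>r>0. (\<integral>\<^sup>+ y. epow (g y) p * indicator (ball x r \<inter> S) y \<partial>M) < \<infinity>"
  shows "finite_on S g"
proof -
  obtain D :: "'a set" where D: "countable D" "\<And>x e. 0 < e \<Longrightarrow> \<exists>y\<in>D. dist y x < e"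
    using countable_dense by blast
  define I where "I = {(d, q). d \<in> D \<and> q \<in> \<rat> \<and>
    (\<integral>\<^sup>+ y. epow (g y) p * indicator (ball d q \<inter> S) y \<partial>M) < \<infinity>}"
  have "I \<subseteq> D \<times> \<rat>" by (auto simp: I_def)
  then have I: "countable I" by (rule countable_subset) (intro countable_SIGMA D(1) countable_rat)
  have gM [measurable]: "g \<in> borel_measurable M" using g by (rule borel_measurable_M)
  have "\<forall>i\<in>I. \<exists>\<rho>. \<rho> \<in> borel_measurable borel \<and> Lp_int \<rho> < \<infinity> \<and>
    (\<forall>y\<in>ball (fst i) (snd i) \<inter> S. g y \<le> \<rho> y)"
  proof (rule ballI)
    fix i assume i: "i \<in> I"
    let ?B = "ball (fst i) (snd i) \<inter> S"
    have [measurable]: "?B \<in> sets M" by (intro sets.Int S borel_sets_M[OF borel_open] open_ball)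
    have "(\<lambda>y. g y * indicator ?B y) \<in> borel_measurable M" by measurable
    then obtain \<rho> where \<rho>: "\<rho> \<in> borel_measurable borel" "\<And>y. g y * indicator ?B y \<le> \<rho> y"
      "AE y in M. \<rho> y = g y * indicator ?B y" by (rule borel_majorant) (rule that)
    have "Lp_int \<rho> = (\<integral>\<^sup>+ y. epow (g y) p * indicator ?B y \<partial>M)"
      by (rule nn_integral_cong_AE, use \<rho>(3) in eventually_elim) (auto split: split_indicator)
    also have "\<dots> < \<infinity>" using i by (auto simp: I_def)
    finally have fin: "Lp_int \<rho> < \<infinity>" .
    have "g y \<le> \<rho> y" if "y \<in> ?B" for y using \<rho>(2)[of y] that by simp
    then show "\<exists>\<rho>. \<rho> \<in> borel_measurable borel \<and> Lp_int \<rho> < \<infinity> \<and> (\<forall>y\<in>?B. g y \<le> \<rho> y)"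
      using \<rho>(1) fin by blast
  qed
  from bchoice[OF this] obtain \<rho> where \<rho>': "\<forall>i\<in>I. \<rho> i \<in> borel_measurable borel \<and> Lp_int (\<rho> i) < \<infinity> \<and>
    (\<forall>y\<in>ball (fst i) (snd i) \<inter> S. g y \<le> \<rho> i y)" by (rule exE)
  have \<rho>: "\<rho> i \<in> borel_measurable borel" "Lp_int (\<rho> i) < \<infinity>"
    "y \<in> ball (fst i) (snd i) \<Longrightarrow> y \<in> S \<Longrightarrow> g y \<le> \<rho> i y" if "i \<in> I" for i y
    using bspec[OF \<rho>' that] by blast+
  have cover: "\<exists>i\<in>I. x \<in> ball (fst i) (snd i)" if x: "x \<in> S" for x
  proof -
    obtain r where r: "0 < r" "(\<integral>\<^sup>+ y. epow (g y) p * indicator (ball x r \<inter> S) y \<partial>M) < \<infinity>"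
      using loc[OF x] by blast
    \<comment> \<open>With d closer to x than r/4 and r/4 < q < r/2, the ball of radius q around d
      contains x and lies in the ball of radius r around x.\<close>
    obtain d where d: "d \<in> D" "dist d x < r / 4" using D(2)[of "r / 4" x] r by auto
    obtain q where q: "q \<in> \<rat>" "r / 4 < q" "q < r / 2" using Rats_dense_in_real[of "r / 4" "r / 2"] r by auto
    have "ball d q \<subseteq> ball x r"
    proof
      fix y assume "y \<in> ball d q"
      then show "y \<in> ball x r" using d q dist_triangle[of x y d] by (simp add: dist_commute)
    qed
    then have "(\<integral>\<^sup>+ y. epow (g y) p * indicator (ball d q \<inter> S) y \<partial>M)
        \<le> (\<integral>\<^sup>+ y. epow (g y) p * indicator (ball x r \<inter> S) y \<partial>M)"
      by (intro nn_integral_mono mult_left_mono) (auto split: split_indicator)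
    then have "(d, q) \<in> I" using d q r by (auto simp: I_def)
    then show ?thesis using d q by (intro bexI[of _ "(d, q)"]) auto
  qed
  have "aec S (\<lambda>l \<gamma>. \<forall>i\<in>I. segment_integral (\<rho> i) \<gamma> 0 l < \<infinity>)"
    using I by (rule aec_all_countable) (intro aec_finite \<rho>)
  then show ?thesis
  proof (rule aec_mono)
    fix l \<gamma> assume c: "(l, \<gamma>) \<in> curves S" and fin: "\<forall>i\<in>I. segment_integral (\<rho> i) \<gamma> 0 l < \<infinity>"
    have "compact (\<gamma> ` {0..l})" using c by (auto simp: curves_iff intro: compact_continuous_image)
    moreover have S': "\<gamma> ` {0..l} \<subseteq> S" using c by (auto simp: curves_iff)
    moreover have "\<gamma> ` {0..l} \<subseteq> (\<Union>i\<in>I. ball (fst i) (snd i))" using S' cover by blast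
    ultimately obtain J where J: "J \<subseteq> I" "finite J" "\<gamma> ` {0..l} \<subseteq> (\<Union>i\<in>J. ball (fst i) (snd i))"
      using compactE_image[of "\<gamma> ` {0..l}" I "\<lambda>i. ball (fst i) (snd i)"] open_ball by metis
    have "segment_integral g \<gamma> 0 l \<le> (\<integral>\<^sup>+ t. (\<Sum>i\<in>J. \<rho> i (\<gamma> t) * indicator {0..l} t) \<partial>lborel)"
      unfolding segment_integral_def
    proof (rule nn_integral_mono)
      fix t
      show "g (\<gamma> t) * indicator {0..l} t \<le> (\<Sum>i\<in>J. \<rho> i (\<gamma> t) * indicator {0..l} t)"
      proof (cases "t \<in> {0..l}")
        case True
        then obtain i where i: "i \<in> J" "\<gamma> t \<in> ball (fst i) (snd i)" using J(3) by blast
        then have "g (\<gamma> t) \<le> \<rho> i (\<gamma> t)" using True S' J by (intro \<rho>(3)) auto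
        also have "\<dots> \<le> (\<Sum>i\<in>J. \<rho> i (\<gamma> t))" using i J by (intro member_le_sum) auto
        finally show ?thesis using True by simp
      qed simp
    qed
    also have "\<dots> = (\<Sum>i\<in>J. segment_integral (\<rho> i) \<gamma> 0 l)"
      unfolding segment_integral_def
      using J(1) \<rho>(1) by (intro nn_integral_sum) (auto intro!: curve_measurable[OF c])
    also have "\<dots> < \<infinity>" using J fin by (auto simp: less_top[symmetric])
    finally show "segment_integral g \<gamma> 0 l < \<infinity>" .
  qed
qed

end


section \<open>Minimal weak upper gradients\<close>

lemma endpoint_gap_finite:
  assumes "endpoint_gap u (l, \<gamma>) < \<infinity>"
  shows "\<bar>u (\<gamma> 0)\<bar> \<noteq> \<infinity>" "\<bar>u (\<gamma> l)\<bar> \<noteq> \<infinity>"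
  using assms by (cases "u (\<gamma> 0)"; cases "u (\<gamma> l)"; simp add: endpoint_gap_def)+

lemma endpoint_gap_real:
  assumes "\<bar>u (\<gamma> 0)\<bar> \<noteq> \<infinity>" "\<bar>u (\<gamma> l)\<bar> \<noteq> \<infinity>"
  shows "endpoint_gap u (l, \<gamma>) = ennreal \<bar>real_of_ereal (u (\<gamma> 0)) - real_of_ereal (u (\<gamma> l))\<bar>"
  using assms by (cases "u (\<gamma> 0)"; cases "u (\<gamma> l)") (simp_all add: endpoint_gap_def)

lemma e2ennreal_abs_ge: "ennreal \<bar>real_of_ereal y\<bar> \<le> e2ennreal \<bar>y\<bar>"
  by (cases y) simp_all

text \<open>Minimal gradients are found by minimising an integral that has to be finite for every
  density and has to detect every strict decrease; hence a bounded, strictly increasing transform.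
  The value 2 lies above pi/2 and so above all values of \<open>arctan\<close>.\<close>

definition bounded_strict :: "ennreal \<Rightarrow> ennreal" where
  "bounded_strict a = (if a = \<infinity> then 2 else ennreal (arctan (enn2real a)))"

lemma bounded_strict_le_2: "bounded_strict a \<le> 2"
proof -
  have "arctan x \<le> 2" for x using arctan_ubound[of x] pi_less_4 by simp
  then have "ennreal (arctan x) \<le> ennreal 2" for x by (rule ennreal_leI)
  then show ?thesis by (simp add: bounded_strict_def)
qed

lemma bounded_strict_less: "a < b \<Longrightarrow> bounded_strict a < bounded_strict b"
proof (cases "b = \<infinity>")
  case True
  assume "a < b"
  then obtain r where r: "0 \<le> r" "a = ennreal r" by (cases a) auto
  have "arctan r < 2" using arctan_ubound[of r] pi_less_4 by simp
  then have "ennreal (arctan r) < ennreal 2" by (rule ennreal_lessI[rotated]) simp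
  then show ?thesis using True r by (simp add: bounded_strict_def)
next
  case False
  assume "a < b"
  then obtain r s where "0 \<le> r" "0 \<le> s" "a = ennreal r" "b = ennreal s" "r < s"
    using False by (cases a; cases b) (auto simp: ennreal_less_iff)
  then show ?thesis by (simp add: bounded_strict_def ennreal_less_iff arctan_less_iff)
qed

lemma bounded_strict_le_iff: "bounded_strict a \<le> bounded_strict b \<longleftrightarrow> a \<le> b"
  using bounded_strict_less[of a b] bounded_strict_less[of b a] by (metis leD le_less_linear nle_le order_less_imp_le)

lemma bounded_strict_measurable [measurable]: "bounded_strict \<in> borel_measurable borel"
  unfolding bounded_strict_def[abs_def] by measurable

context sobolev_setting
begin

definition finite_along :: "'a set \<Rightarrow> ('a \<Rightarrow> ereal) \<Rightarrow> bool" where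
  "finite_along S u \<longleftrightarrow> aec S (\<lambda>l \<gamma>. \<forall>t\<in>{0..l}. \<bar>u (\<gamma> t)\<bar> \<noteq> \<infinity>)"

lemma restrict_borel_majorant:
  fixes g :: "'a \<Rightarrow> ennreal"
  assumes "S \<in> sets M" "g \<in> borel_measurable (restrict_space M S)"
  obtains g' where "g' \<in> borel_measurable borel" "\<And>x. x \<in> S \<Longrightarrow> g x \<le> g' x"
    "AE x in M. g' x = g x * indicator S x"
proof -
  have "(\<lambda>x. g x * indicator S x) \<in> borel_measurable M"
    using assms by (simp add: borel_measurable_restrict_space_iff_ennreal)
  then obtain g' where g': "g' \<in> borel_measurable borel" "\<And>x. g x * indicator S x \<le> g' x"
    "AE x in M. g' x = g x * indicator S x" by (rule borel_majorant) (rule that)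
  show ?thesis
  proof (rule that[OF g'(1) _ g'(3)])
    show "g x \<le> g' x" if "x \<in> S" for x using g'(2)[of x] that by simp
  qed
qed

lemma borel_restrict_M: "g \<in> borel_measurable borel \<Longrightarrow> g \<in> borel_measurable (restrict_space M S)"
  by (intro measurable_restrict_space1 borel_measurable_M)

lemma Lp_loc_iff:
  assumes "S \<in> sets M"
  shows "Lp_loc p (restrict_space M S) g \<longleftrightarrow> g \<in> borel_measurable (restrict_space M S) \<and>
    (\<forall>x\<in>S. \<exists>r>0. (\<integral>\<^sup>+ y. epow (g y) p * indicator (ball x r \<inter> S) y \<partial>M) < \<infinity>)"
proof -
  have sp: "space (restrict_space M S) = S" by (simp add: space_restrict_space)
  have "(\<integral>\<^sup>+ y. epow (g y) p * indicator (ball x r \<inter> S) y \<partial>restrict_space M S)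
      = (\<integral>\<^sup>+ y. epow (g y) p * indicator (ball x r \<inter> S) y \<partial>M)" for x r
    unfolding nn_integral_restrict_M[OF assms]
    by (intro nn_integral_cong) (simp split: split_indicator)
  then show ?thesis by (simp add: Lp_loc_def sp)
qed

lemma AE_restrict_M: "S \<in> sets M \<Longrightarrow> (AE x in restrict_space M S. P x) \<longleftrightarrow> (AE x in M. x \<in> S \<longrightarrow> P x)"
  by (rule AE_restrict_space_iff) simp

lemma Lp_loc_AE_cong:
  assumes S: "S \<in> sets M" and g: "Lp_loc p (restrict_space M S) g"
    and g': "g' \<in> borel_measurable (restrict_space M S)" and le: "AE x in M. x \<in> S \<longrightarrow> g' x \<le> g x"
  shows "Lp_loc p (restrict_space M S) g'"
  unfolding Lp_loc_iff[OF S]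
proof (intro conjI g' ballI)
  fix x assume "x \<in> S"
  then obtain r where r: "0 < r" "(\<integral>\<^sup>+ y. epow (g y) p * indicator (ball x r \<inter> S) y \<partial>M) < \<infinity>"
    using g unfolding Lp_loc_iff[OF S] by auto
  have "(\<integral>\<^sup>+ y. epow (g' y) p * indicator (ball x r \<inter> S) y \<partial>M)
      \<le> (\<integral>\<^sup>+ y. epow (g y) p * indicator (ball x r \<inter> S) y \<partial>M)"
    by (rule nn_integral_mono_AE, use le in eventually_elim)
      (auto simp: epow_mono p_pos split: split_indicator)
  then show "\<exists>r>0. (\<integral>\<^sup>+ y. epow (g' y) p * indicator (ball x r \<inter> S) y \<partial>M) < \<infinity>"
    using r by (intro exI[of _ r]) (auto elim: order.strict_trans1)
qed

lemma aec_of_weak: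
  assumes "S \<in> sets M" "weak_upper_gradient p (restrict_space M S) u g"
  shows "aec S (\<lambda>l \<gamma>. endpoint_gap u (l, \<gamma>) \<le> segment_integral g \<gamma> 0 l)"
proof -
  have "aec S (\<lambda>l \<gamma>. measurable_along g (l, \<gamma>) \<and> endpoint_gap u (l, \<gamma>) \<le> curve_integral g (l, \<gamma>))"
    using assms by (simp add: weak_upper_gradient_def ae_curve_iff_aec)
  then show ?thesis by (rule aec_mono) (simp add: curve_integral_eq)
qed

lemma aec_finite_Lp_loc:
  assumes S: "S \<in> sets M" and g: "Lp_loc p (restrict_space M S) g" and g': "g' \<in> borel_measurable borel"
    and le: "AE x in M. x \<in> S \<longrightarrow> g' x \<le> g x"
  shows "finite_on S g'"
proof -
  have "Lp_loc p (restrict_space M S) g'"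
    by (rule Lp_loc_AE_cong[OF S g borel_restrict_M[OF g'] le])
  then show ?thesis
    unfolding Lp_loc_iff[OF S] by (intro aec_finite_loc S g') simp
qed

text \<open>Two infinite end values count as an infinite gap, so a finite gap forces both end values
  to be finite; and every point of a curve is an end point of some subcurve.\<close>

lemma finite_along_of_gap:
  assumes g: "g \<in> borel_measurable borel" and fin: "finite_on S g"
    and gap: "aec S (\<lambda>l \<gamma>. endpoint_gap u (l, \<gamma>) \<le> segment_integral g \<gamma> 0 l)"
  shows "finite_along S u"
  unfolding finite_along_def
proof -
  have "aec S (\<lambda>l \<gamma>. endpoint_gap u (l, \<gamma>) < \<infinity>)"
    by (rule aec_mono[OF aec_conj[OF fin gap]]) (auto elim: order.strict_trans1)
  from aec_subcurves[OF this, of S]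
  show "aec S (\<lambda>l \<gamma>. \<forall>t\<in>{0..l}. \<bar>u (\<gamma> t)\<bar> \<noteq> \<infinity>)"
  proof (rule aec_mono, intro ballI)
    fix l \<gamma> t
    assume c: "(l, \<gamma>) \<in> curves S" and t: "t \<in> {0..l}"
      and sub: "\<forall>a b. 0 \<le> a \<longrightarrow> a < b \<longrightarrow> b \<le> l \<longrightarrow> \<gamma> ` {a..b} \<subseteq> S \<longrightarrow>
        endpoint_gap u (b - a, \<lambda>t. \<gamma> (a + t)) < \<infinity>"
    have l: "0 < l" and S: "\<gamma> ` {0..l} \<subseteq> S" using c by (auto simp: curves_iff)
    show "\<bar>u (\<gamma> t)\<bar> \<noteq> \<infinity>"
    \<comment> \<open>No subcurve of positive length starts at l, so there the point serves as the
      right end.\<close>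
    proof (cases "t = l")
      case True
      have "endpoint_gap u (l - 0, \<lambda>t. \<gamma> (0 + t)) < \<infinity>"
        using sub[rule_format, of 0 l] l S by simp
      from endpoint_gap_finite(2)[OF this] show ?thesis using True by simp
    next
      case False
      then have "t < l" using t by simp
      then have "endpoint_gap u (l - t, \<lambda>r. \<gamma> (t + r)) < \<infinity>"
        using sub[rule_format, of t l] t S by (auto simp: image_subset_iff)
      from endpoint_gap_finite(1)[OF this] show ?thesis by simp
    qed
  qed
qed

lemma wug_of_gap:
  assumes g: "g \<in> borel_measurable borel" and fin: "finite_along S u"
    and gap: "aec S (\<lambda>l \<gamma>. endpoint_gap u (l, \<gamma>) \<le> segment_integral g \<gamma> 0 l)"
  shows "wug S (\<lambda>x. real_of_ereal (u x)) g"
proof (rule wugI_endpoints[OF g], rule aec_mono[OF aec_conj[OF fin[unfolded finite_along_def] gap]], elim conjE)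
  fix l \<gamma>
  assume c: "(l, \<gamma>) \<in> curves S" and fin: "\<forall>t\<in>{0..l}. \<bar>u (\<gamma> t)\<bar> \<noteq> \<infinity>"
    and gap: "endpoint_gap u (l, \<gamma>) \<le> segment_integral g \<gamma> 0 l"
  have "0 < l" using c by (simp add: curves_iff)
  then have "\<bar>u (\<gamma> 0)\<bar> \<noteq> \<infinity>" "\<bar>u (\<gamma> l)\<bar> \<noteq> \<infinity>" using fin by auto
  then show "ennreal \<bar>real_of_ereal (u (\<gamma> 0)) - real_of_ereal (u (\<gamma> l))\<bar> \<le> segment_integral g \<gamma> 0 l"
    using gap by (simp add: endpoint_gap_real)
qed

text \<open>A Borel majorant can only increase line integrals in \<open>S\<close>, so the inequality
  survives, and on \<open>S\<close> it differs from \<open>g\<close> only on a null set.\<close>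

lemma weak_to_borel:
  assumes S: "S \<in> sets M" and w: "weak_upper_gradient p (restrict_space M S) u g"
  obtains g' where "g' \<in> borel_measurable borel" "AE x in M. g' x = g x * indicator S x"
    "aec S (\<lambda>l \<gamma>. endpoint_gap u (l, \<gamma>) \<le> segment_integral g' \<gamma> 0 l)"
proof -
  have "g \<in> borel_measurable (restrict_space M S)" using w by (simp add: weak_upper_gradient_def)
  then obtain g' where g': "g' \<in> borel_measurable borel"
    "\<And>x. x \<in> S \<Longrightarrow> g x \<le> g' x" "AE x in M. g' x = g x * indicator S x"
    by (rule restrict_borel_majorant[OF S]) (rule that)
  have "aec S (\<lambda>l \<gamma>. endpoint_gap u (l, \<gamma>) \<le> segment_integral g' \<gamma> 0 l)"
  proof (rule aec_mono[OF aec_of_weak[OF S w]])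
    fix l \<gamma>
    assume c: "(l, \<gamma>) \<in> curves S" and le: "endpoint_gap u (l, \<gamma>) \<le> segment_integral g \<gamma> 0 l"
    have "segment_integral g \<gamma> 0 l \<le> segment_integral g' \<gamma> 0 l"
      using c by (intro segment_integral_mono g'(2)) (auto simp: curves_iff image_subset_iff)
    then show "endpoint_gap u (l, \<gamma>) \<le> segment_integral g' \<gamma> 0 l" by (rule order_trans[OF le])
  qed
  then show ?thesis using that g' by blast
qed

lemma weak_of_wug:
  assumes S: "S \<in> sets M" and w: "wug S (\<lambda>x. real_of_ereal (u x)) g" and fin: "finite_along S u"
  shows "weak_upper_gradient p (restrict_space M S) u g"
  unfolding weak_upper_gradient_def ae_curve_iff_aec[OF S]
proof
  note g = wug_borel[OF w]
  show "g \<in> borel_measurable (restrict_space M S)" by (rule borel_restrict_M[OF g])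
  show "aec S (\<lambda>l \<gamma>. measurable_along g (l, \<gamma>) \<and> endpoint_gap u (l, \<gamma>) \<le> curve_integral g (l, \<gamma>))"
  proof (rule aec_mono[OF aec_conj[OF fin[unfolded finite_along_def] wug_aec[OF w]]], elim conjE)
    fix l \<gamma>
    assume c: "(l, \<gamma>) \<in> curves S" and fin: "\<forall>t\<in>{0..l}. \<bar>u (\<gamma> t)\<bar> \<noteq> \<infinity>"
      and le: "controls (\<lambda>x. real_of_ereal (u x)) g l \<gamma>"
    have l: "0 < l" using c by (simp add: curves_iff)
    have "(\<lambda>t. g (\<gamma> t) * indicator {0..l} t) \<in> borel_measurable lebesgue"
      using curve_measurable[OF c g, of 0 l] by (intro measurable_completion) simp
    then have "measurable_along g (l, \<gamma>)"
      by (simp add: measurable_along_def borel_measurable_restrict_space_iff_ennreal)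
    moreover have "\<bar>u (\<gamma> 0)\<bar> \<noteq> \<infinity>" "\<bar>u (\<gamma> l)\<bar> \<noteq> \<infinity>" using fin l by auto
    ultimately show "measurable_along g (l, \<gamma>) \<and> endpoint_gap u (l, \<gamma>) \<le> curve_integral g (l, \<gamma>)"
      using le[rule_format, of 0 l] l by (simp add: endpoint_gap_real curve_integral_eq)
  qed
qed

text \<open>Gradients are stable under countable infima, so the infimum of a minimising sequence
  attains the least value of \<open>\<Phi>\<close>. Its minimum with a competitor cannot have a
  smaller value, and strict monotonicity of the integrand turns this into an inequality almost
  everywhere. Finiteness along almost every curve stands in for integrability, which includes the
  locally integrable case.\<close>

lemma exists_minimal_wug:
  assumes S: "S \<in> sets M" and g0: "wug S u g0" "finite_on S g0"
  obtains g where "wug S u g" "\<And>x. g x \<le> g0 x"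
    "\<And>g'. wug S u g' \<Longrightarrow> finite_on S g' \<Longrightarrow> AE x in M. x \<in> S \<longrightarrow> g x \<le> g' x"
proof -
  interpret sigma_finite_measure M by (rule sigma_finite_M)
  \<comment> \<open>The weight keeps \<open>\<Phi>\<close> finite even if the space has infinite
    measure.\<close>
  obtain h where h [measurable]: "h \<in> borel_measurable M" and h_int: "integral\<^sup>N M h \<noteq> \<infinity>"
    and h_pos: "\<And>x. 0 < h x" "\<And>x. h x < \<infinity>"
    using Ex_finite_integrable_function by auto
  define \<Phi> where "\<Phi> g = (\<integral>\<^sup>+ x. h x * bounded_strict (g x) * indicator S x \<partial>M)" for g :: "'a \<Rightarrow> ennreal"
  define \<G> where "\<G> = {g. wug S u g \<and> finite_on S g}"
  have \<Phi>_fin: "\<Phi> g < \<infinity>" for g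
  proof -
    have "\<Phi> g \<le> (\<integral>\<^sup>+ x. h x * 2 \<partial>M)"
      unfolding \<Phi>_def
    proof (rule nn_integral_mono)
      fix x
      have "h x * bounded_strict (g x) * indicator S x \<le> h x * bounded_strict (g x)"
        by (simp split: split_indicator)
      also have "\<dots> \<le> h x * 2" by (intro mult_left_mono bounded_strict_le_2) simp
      finally show "h x * bounded_strict (g x) * indicator S x \<le> h x * 2" .
    qed
    also have "\<dots> = integral\<^sup>N M h * 2" by (rule nn_integral_multc) measurable
    also have "\<dots> < \<infinity>" using h_int by (simp add: ennreal_mult_less_top less_top)
    finally show ?thesis .
  qed
  have g0': "g0 \<in> \<G>" using g0 by (simp add: \<G>_def)
  define I where "I = (INF g\<in>\<G>. \<Phi> g)"
  have I_le: "I \<le> \<Phi> g" if "g \<in> \<G>" for g unfolding I_def by (rule INF_lower[OF that])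
  have I_fin: "I \<noteq> \<infinity>" using I_le[OF g0'] \<Phi>_fin[of g0] by (auto simp: top_unique)
  have "\<forall>n::nat. \<exists>g. g \<in> \<G> \<and> \<Phi> g < I + ennreal (1 / Suc n)"
    using INF_approx_ennreal[OF _ I_def I_fin] by (metis of_nat_0_less_iff zero_less_Suc zero_less_divide_1_iff)
  then obtain G where G: "\<And>n. G n \<in> \<G>" "\<And>n. \<Phi> (G n) < I + ennreal (1 / Suc n)"
    by metis
  \<comment> \<open>Putting \<open>g0\<close> first makes the infimum lie below \<open>g0\<close>
    everywhere, which later gives its local integrability.\<close>
  define F where "F n = (case n of 0 \<Rightarrow> g0 | Suc n \<Rightarrow> G n)" for n
  have F: "F n \<in> \<G>" for n using g0' G(1) by (cases n) (auto simp: F_def)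
  define g where "g x = (INF n. F n x)" for x
  have g_le: "g x \<le> F n x" for n x unfolding g_def by (rule INF_lower) simp
  have g_wug: "wug S u g"
    unfolding g_def[abs_def] by (rule wug_INF) (use F in \<open>simp_all add: \<G>_def\<close>)
  have g_fin: "finite_on S g"
    using g0(2)
  proof (rule aec_mono)
    fix l \<gamma>
    have "segment_integral g \<gamma> 0 l \<le> segment_integral g0 \<gamma> 0 l"
      using g_le[of _ 0] by (intro segment_integral_mono) (simp add: F_def)
    then show "segment_integral g0 \<gamma> 0 l < \<infinity> \<Longrightarrow> segment_integral g \<gamma> 0 l < \<infinity>" by (rule order.strict_trans1)
  qed
  have mono: "\<Phi> g1 \<le> \<Phi> g2" if "\<And>x. g1 x \<le> g2 x" for g1 g2
    unfolding \<Phi>_def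
    by (intro nn_integral_mono mult_right_mono mult_left_mono) (simp_all add: bounded_strict_le_iff that)
  have "\<Phi> g \<le> I"
  proof (rule ennreal_le_epsilon)
    fix e :: real assume "0 < e"
    then obtain n where n: "1 / Suc n < e" using nat_approx_posE by blast
    have "\<Phi> g \<le> \<Phi> (G n)" using g_le[of _ "Suc n"] by (intro mono) (simp add: F_def)
    also have "\<dots> \<le> I + ennreal (1 / Suc n)" using G(2)[of n] by (rule less_imp_le)
    also have "\<dots> \<le> I + ennreal e" using n by (intro add_left_mono ennreal_leI) simp
    finally show "\<Phi> g \<le> I + ennreal e" .
  qed
  show ?thesis
  proof (rule that[OF g_wug])
    show "g x \<le> g0 x" for x using g_le[of x 0] by (simp add: F_def)
    fix g' assume g': "wug S u g'" "finite_on S g'"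
    let ?m = "\<lambda>x. min (g x) (g' x)"
    note [measurable] = wug_borel_M[OF g_wug] wug_borel_M[OF g'(1)] S bounded_strict_measurable
    have "wug S u ?m" by (rule wug_min[OF g_wug g_fin g'])
    moreover have "finite_on S ?m"
      using g_fin
    proof (rule aec_mono)
      fix l \<gamma>
      have "segment_integral ?m \<gamma> 0 l \<le> segment_integral g \<gamma> 0 l"
        by (intro segment_integral_mono) simp
      then show "segment_integral g \<gamma> 0 l < \<infinity> \<Longrightarrow> segment_integral ?m \<gamma> 0 l < \<infinity>" by (rule order.strict_trans1)
    qed
    ultimately have "I \<le> \<Phi> ?m" by (intro I_le) (simp add: \<G>_def)
    with \<open>\<Phi> g \<le> I\<close> have not_less: "\<not> \<Phi> ?m < \<Phi> g" by simp
    have "AE x in M. h x * bounded_strict (g x) * indicator S x \<le> h x * bounded_strict (?m x) * indicator S x"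
    proof (rule ccontr)
      assume "\<not> ?thesis"
      then have "\<Phi> ?m < \<Phi> g"
        unfolding \<Phi>_def
      proof (rule nn_integral_less[rotated 4])
        show "(\<integral>\<^sup>+ x. h x * bounded_strict (?m x) * indicator S x \<partial>M) \<noteq> \<infinity>"
          using \<Phi>_fin[of ?m] by (simp add: \<Phi>_def)
        show "AE x in M. h x * bounded_strict (?m x) * indicator S x \<le> h x * bounded_strict (g x) * indicator S x"
          by (intro AE_I2 mult_right_mono mult_left_mono) (simp_all add: bounded_strict_le_iff)
      qed measurable
      then show False using not_less by simp
    qed
    then show "AE x in M. x \<in> S \<longrightarrow> g x \<le> g' x"
    proof eventually_elim
      case (elim x)
      show ?case
      proof
        assume "x \<in> S"
        then have "h x * bounded_strict (g x) \<le> h x * bounded_strict (?m x)" using elim by simp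
        then have "bounded_strict (g x) \<le> bounded_strict (?m x)"
          using h_pos[of x] by (simp add: ennreal_mult_le_mult_iff)
        then show "g x \<le> g' x" by (simp add: bounded_strict_le_iff)
      qed
    qed
  qed
qed

text \<open>This gives the choice in \<open>min_grad\<close> its meaning: as soon as one locally
  integrable weak upper gradient exists, there is a minimal one to choose.\<close>

lemma min_grad_minimal:
  assumes S: "S \<in> sets M" and w: "weak_upper_gradient p (restrict_space M S) u g0"
    and loc: "Lp_loc p (restrict_space M S) g0"
  shows "is_minimal_weak_upper_gradient p (restrict_space M S) u (min_grad p (restrict_space M S) u)"
    and "finite_along S u"
proof -
  let ?v = "\<lambda>x. real_of_ereal (u x)"
  have fin_aec: "finite_on S h"
    if "Lp_loc p (restrict_space M S) g" "h \<in> borel_measurable borel" "AE x in M. h x = g x * indicator S x"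
    for g h
    by (rule aec_finite_Lp_loc[OF S that(1,2)]) (use that(3) in \<open>auto elim!: eventually_mono\<close>)
  obtain h0 where h0: "h0 \<in> borel_measurable borel" "AE x in M. h0 x = g0 x * indicator S x"
    "aec S (\<lambda>l \<gamma>. endpoint_gap u (l, \<gamma>) \<le> segment_integral h0 \<gamma> 0 l)"
    using weak_to_borel[OF S w] .
  note h0_fin = fin_aec[OF loc h0(1,2)]
  show fin: "finite_along S u" by (rule finite_along_of_gap[OF h0(1) h0_fin h0(3)])
  have "wug S ?v h0" by (rule wug_of_gap[OF h0(1) fin h0(3)])
  from exists_minimal_wug[OF S this h0_fin] obtain g where g: "wug S ?v g" "\<And>x. g x \<le> h0 x"
    and min: "\<And>g'. wug S ?v g' \<Longrightarrow> finite_on S g' \<Longrightarrow>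
      AE x in M. x \<in> S \<longrightarrow> g x \<le> g' x" by blast
  have "is_minimal_weak_upper_gradient p (restrict_space M S) u g"
    unfolding is_minimal_weak_upper_gradient_def
  proof (intro conjI allI impI)
    show "weak_upper_gradient p (restrict_space M S) u g" by (rule weak_of_wug[OF S g(1) fin])
    show "Lp_loc p (restrict_space M S) g"
    proof (rule Lp_loc_AE_cong[OF S loc borel_restrict_M[OF wug_borel[OF g(1)]]])
      show "AE x in M. x \<in> S \<longrightarrow> g x \<le> g0 x"
        using h0(2)
      proof eventually_elim
        case (elim x)
        then show ?case using g(2)[of x] by auto
      qed
    qed
    fix g' assume g': "weak_upper_gradient p (restrict_space M S) u g' \<and> Lp_loc p (restrict_space M S) g'"
    then obtain h where h: "h \<in> borel_measurable borel" "AE x in M. h x = g' x * indicator S x"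
      "aec S (\<lambda>l \<gamma>. endpoint_gap u (l, \<gamma>) \<le> segment_integral h \<gamma> 0 l)"
      using weak_to_borel[OF S] by blast
    have "AE x in M. x \<in> S \<longrightarrow> g x \<le> h x"
      by (rule min[OF wug_of_gap[OF h(1) fin h(3)]]) (use fin_aec h g' in blast)
    then have "AE x in M. x \<in> S \<longrightarrow> g x \<le> g' x"
      using h(2) by eventually_elim auto
    then show "AE x in restrict_space M S. g x \<le> g' x" by (simp add: AE_restrict_M[OF S])
  qed
  then show "is_minimal_weak_upper_gradient p (restrict_space M S) u (min_grad p (restrict_space M S) u)"
    unfolding min_grad_def by (rule someI[where P="is_minimal_weak_upper_gradient p (restrict_space M S) u"])
qed

lemma Lp_imp_Lp_loc:
  assumes S: "S \<in> sets M" and "g \<in> borel_measurable (restrict_space M S)"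
    and "(\<integral>\<^sup>+ x. epow (g x) p * indicator S x \<partial>M) < \<infinity>"
  shows "Lp_loc p (restrict_space M S) g"
  unfolding Lp_loc_iff[OF S]
proof (intro conjI ballI assms(2) exI)
  fix x
  have "(\<integral>\<^sup>+ y. epow (g y) p * indicator (ball x 1 \<inter> S) y \<partial>M) \<le> (\<integral>\<^sup>+ x. epow (g x) p * indicator S x \<partial>M)"
    by (intro nn_integral_mono mult_left_mono) (auto split: split_indicator)
  then show "(\<integral>\<^sup>+ y. epow (g y) p * indicator (ball x 1 \<inter> S) y \<partial>M) < \<infinity>"
    using assms(3) by (rule order.strict_trans1)
qed simp

lemma energy_le:
  assumes S: "S \<in> sets M" and w: "wug S (\<lambda>x. real_of_ereal (u x)) g" and fin: "finite_along S u"
  shows "energy p (restrict_space M S) u \<le> (\<integral>\<^sup>+ x. epow (g x) p * indicator S x \<partial>M)"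
proof (cases "(\<integral>\<^sup>+ x. epow (g x) p * indicator S x \<partial>M) < \<infinity>")
  case True
  have weak: "weak_upper_gradient p (restrict_space M S) u g" by (rule weak_of_wug[OF S w fin])
  have loc: "Lp_loc p (restrict_space M S) g"
    by (rule Lp_imp_Lp_loc[OF S borel_restrict_M[OF wug_borel[OF w]] True])
  have "AE x in restrict_space M S. min_grad p (restrict_space M S) u x \<le> g x"
    using min_grad_minimal(1)[OF S weak loc] weak loc
    unfolding is_minimal_weak_upper_gradient_def by blast
  then have "energy p (restrict_space M S) u \<le> (\<integral>\<^sup>+ x. epow (g x) p \<partial>restrict_space M S)"
    unfolding energy_def by (intro nn_integral_mono_AE) (auto elim!: eventually_mono intro: epow_mono p_pos)
  then show ?thesis by (simp add: nn_integral_restrict_M[OF S])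
qed (simp add: less_top[symmetric])

text \<open>A Borel version of the minimal gradient that vanishes off \<open>S\<close> up to a null
  set, so that the energy on \<open>S\<close> becomes an integral over the whole space.\<close>

lemma energy_attained:
  assumes S: "S \<in> sets M" and w: "weak_upper_gradient p (restrict_space M S) u g0"
    and loc: "Lp_loc p (restrict_space M S) g0"
  obtains g where "wug S (\<lambda>x. real_of_ereal (u x)) g"
    "Lp_int g = energy p (restrict_space M S) u" "AE x in M. x \<notin> S \<longrightarrow> g x = 0"
proof -
  let ?m = "min_grad p (restrict_space M S) u"
  have m: "weak_upper_gradient p (restrict_space M S) u ?m"
    using min_grad_minimal(1)[OF S w loc] by (simp add: is_minimal_weak_upper_gradient_def)
  obtain g where g: "g \<in> borel_measurable borel" "AE x in M. g x = ?m x * indicator S x"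
    "aec S (\<lambda>l \<gamma>. endpoint_gap u (l, \<gamma>) \<le> segment_integral g \<gamma> 0 l)"
    using weak_to_borel[OF S m] .
  have "Lp_int g = (\<integral>\<^sup>+ x. epow (?m x) p * indicator S x \<partial>M)"
    by (rule nn_integral_cong_AE, use g(2) in eventually_elim) (simp split: split_indicator)
  also have "\<dots> = energy p (restrict_space M S) u" by (simp add: energy_def nn_integral_restrict_M[OF S])
  finally have e: "Lp_int g = energy p (restrict_space M S) u" .
  show ?thesis
  proof (rule that[OF wug_of_gap[OF g(1) min_grad_minimal(2)[OF S w loc] g(3)] e])
    show "AE x in M. x \<notin> S \<longrightarrow> g x = 0" using g(2) by eventually_elim simp
  qed
qed


section \<open>Sobolev functions and capacity\<close>

lemma UNIV_sets_M: "UNIV \<in> sets M"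
  using sets.top[of M] by simp

lemma restrict_UNIV: "restrict_space M UNIV = M"
  by (rule measure_eqI) (simp_all add: emeasure_restrict_space UNIV_sets_M)

lemma Lp_add:
  assumes "g \<in> borel_measurable M" "h \<in> borel_measurable M"
  shows "Lp_int (\<lambda>x. g x + h x)
    \<le> ennreal (2 powr p) * (Lp_int g + Lp_int h)"
proof -
  note [measurable] = assms
  have "Lp_int (\<lambda>x. g x + h x) \<le> (\<integral>\<^sup>+ x. ennreal (2 powr p) * (epow (g x) p + epow (h x) p) \<partial>M)"
    by (intro nn_integral_mono epow_add_le p_pos)
  also have "\<dots> = ennreal (2 powr p) * (\<integral>\<^sup>+ x. epow (g x) p + epow (h x) p \<partial>M)"
    by (rule nn_integral_cmult) measurable
  also have "(\<integral>\<^sup>+ x. epow (g x) p + epow (h x) p \<partial>M) = Lp_int g + Lp_int h"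
    by (rule nn_integral_add) measurable
  finally show ?thesis .
qed

lemma Lp_add_finite:
  assumes "g \<in> borel_measurable M" "h \<in> borel_measurable M"
    and "Lp_int g < \<infinity>" "Lp_int h < \<infinity>"
  shows "Lp_int (\<lambda>x. g x + h x) < \<infinity>"
  by (rule order.strict_trans1[OF Lp_add[OF assms(1,2)]])
    (use assms(3,4) in \<open>simp add: ennreal_mult_less_top\<close>)

text \<open>\<open>N1p\<close> and \<open>Dp\<close> ask for genuine upper gradients. Adding a
  density that is infinite along the exceptional curves repairs the inequality there; the sum need
  not be close to \<open>g\<close>, only p-integrable.\<close>

lemma upper_gradient_of_wug:
  assumes S: "S \<in> sets M" and w: "wug S (\<lambda>x. real_of_ereal (u x)) g" and fin: "finite_along S u"
    and Lp: "Lp_int g < \<infinity>"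
  obtains g' where "upper_gradient (restrict_space M S) u g'" "Lp_fun p (restrict_space M S) g'"
proof -
  have sp: "space (restrict_space M S) = S" by (simp add: space_restrict_space)
  have "aec S (\<lambda>l \<gamma>. endpoint_gap u (l, \<gamma>) \<le> segment_integral g \<gamma> 0 l)"
  proof (rule aec_mono[OF aec_of_weak[OF S weak_of_wug[OF S w fin]]])
  qed
  then obtain \<rho> where \<rho>: "\<rho> \<in> borel_measurable borel" "Lp_int \<rho> < \<infinity>"
    and inf: "\<And>l \<gamma>. (l, \<gamma>) \<in> curves S \<Longrightarrow> \<not> endpoint_gap u (l, \<gamma>) \<le> segment_integral g \<gamma> 0 l \<Longrightarrow>
      curve_integral \<rho> (l, \<gamma>) = \<infinity>"
    unfolding aec_def zero_modulus_iff by blast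
  let ?g = "\<lambda>x. g x + \<rho> x"
  note gb = wug_borel[OF w]
  have m: "?g \<in> borel_measurable borel" using gb \<rho>(1) by measurable
  show ?thesis
  proof
    show "upper_gradient (restrict_space M S) u ?g"
      unfolding upper_gradient_def sp
    proof (intro conjI ballI)
      show "?g \<in> borel_measurable (restrict_space borel S)" by (rule measurable_restrict_space1[OF m])
      fix c assume c: "c \<in> curves S"
      obtain l \<gamma> where c_eq: "c = (l, \<gamma>)" by force
      have "segment_integral g \<gamma> 0 l \<le> curve_integral ?g c" "curve_integral \<rho> (l, \<gamma>) \<le> curve_integral ?g c"
        unfolding c_eq curve_integral_eq by (intro segment_integral_mono; simp)+
      then show "endpoint_gap u c \<le> curve_integral ?g c"
        using inf[of l \<gamma>] c unfolding c_eq by (cases "endpoint_gap u (l, \<gamma>) \<le> segment_integral g \<gamma> 0 l")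
          (auto simp: top_unique)
    qed
    have "Lp_int ?g < \<infinity>"
      by (intro Lp_add_finite borel_measurable_M gb \<rho> Lp)
    moreover have "(\<integral>\<^sup>+ x. epow (?g x) p * indicator S x \<partial>M) \<le> Lp_int ?g"
      by (intro nn_integral_mono) (simp split: split_indicator)
    ultimately show "Lp_fun p (restrict_space M S) ?g"
      unfolding Lp_fun_def nn_integral_restrict_M[OF S]
      using borel_restrict_M[OF m] by (auto elim: order.strict_trans1)
  qed
qed

lemma weak_of_upper_gradient:
  assumes S: "S \<in> sets M" and ug: "upper_gradient (restrict_space M S) u g"
  shows "weak_upper_gradient p (restrict_space M S) u g"
  unfolding weak_upper_gradient_def ae_curve_iff_aec[OF S]
proof
  have sp: "space (restrict_space M S) = S" by (simp add: space_restrict_space)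
  have g: "g \<in> borel_measurable (restrict_space borel S)"
    and le: "\<And>c. c \<in> curves S \<Longrightarrow> endpoint_gap u c \<le> curve_integral g c"
    using ug unfolding upper_gradient_def sp by blast+
  show "g \<in> borel_measurable (restrict_space M S)"
    using measurable_compose[OF id_restrict_measurable g] by simp
  have "measurable_along g (l, \<gamma>)" if c: "(l, \<gamma>) \<in> curves S" for l \<gamma>
  proof -
    have cont: "continuous_on {0..l} \<gamma>" and sub: "\<gamma> ` {0..l} \<subseteq> S" using c by (auto simp: curves_iff)
    have "\<gamma> \<in> measurable (restrict_space borel {0..l}) borel"
      by (rule borel_measurable_continuous_on_restrict[OF cont])
    then have "\<gamma> \<in> measurable (restrict_space borel {0..l}) (restrict_space borel S)"
      using sub by (intro measurable_restrict_space2) (auto simp: space_restrict_space)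
    from measurable_compose[OF this g]
    have "(\<lambda>t. g (\<gamma> t) * indicator {0..l} t) \<in> borel_measurable borel"
      by (subst (asm) borel_measurable_restrict_space_iff_ennreal) auto
    then have "(\<lambda>t. g (\<gamma> t) * indicator {0..l} t) \<in> borel_measurable lebesgue"
      by (intro measurable_completion) simp
    then show ?thesis
      by (simp add: measurable_along_def borel_measurable_restrict_space_iff_ennreal)
  qed
  then have "{(l, \<gamma>). (l, \<gamma>) \<in> curves S \<and> \<not> (measurable_along g (l, \<gamma>) \<and> endpoint_gap u (l, \<gamma>) \<le> curve_integral g (l, \<gamma>))} = {}"
    using le by blast
  moreover have "zero_modulus p M {}"
    unfolding zero_modulus_iff by (intro bexI[of _ "\<lambda>_. 0"]) auto
  ultimately show "aec S (\<lambda>l \<gamma>. measurable_along g (l, \<gamma>) \<and> endpoint_gap u (l, \<gamma>) \<le> curve_integral g (l, \<gamma>))"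
    unfolding aec_def by (simp only:)
qed

section \<open>Membership in \<open>N1p\<close> and sets of capacity zero\<close>

lemma N1p_norm_finite_iff:
  "N1p_norm p M u < \<infinity> \<longleftrightarrow> Lp_int (\<lambda>x. e2ennreal \<bar>u x\<bar>) < \<infinity> \<and> energy p M u < \<infinity>"
  unfolding N1p_norm_def epow_less_top_iff by simp

lemma N1pD:
  assumes "u \<in> N1p p M"
  shows "u \<in> borel_measurable M" "finite_along UNIV u"
    "Lp_int (\<lambda>x. e2ennreal \<bar>u x\<bar>) < \<infinity>" "energy p M u < \<infinity>"
    "\<exists>g. wug UNIV (\<lambda>x. real_of_ereal (u x)) g \<and> Lp_int g = energy p M u"
proof -
  show "u \<in> borel_measurable M" using assms by (simp add: N1p_def)
  show "Lp_int (\<lambda>x. e2ennreal \<bar>u x\<bar>) < \<infinity>" "energy p M u < \<infinity>"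
    using assms unfolding N1p_def N1p_norm_finite_iff by blast+
  obtain g where g: "upper_gradient M u g" "Lp_loc p M g" using assms by (auto simp: N1p_def)
  have w: "weak_upper_gradient p (restrict_space M UNIV) u g"
    using g(1) by (intro weak_of_upper_gradient UNIV_sets_M) (simp add: restrict_UNIV)
  have loc: "Lp_loc p (restrict_space M UNIV) g" using g(2) by (simp add: restrict_UNIV)
  show "finite_along UNIV u" by (rule min_grad_minimal(2)[OF UNIV_sets_M w loc])
  show "\<exists>g. wug UNIV (\<lambda>x. real_of_ereal (u x)) g \<and> Lp_int g = energy p M u"
    using energy_attained[OF UNIV_sets_M w loc] unfolding restrict_UNIV by metis
qed

lemma energy_le_M:
  assumes "wug UNIV (\<lambda>x. real_of_ereal (u x)) g" "finite_along UNIV u"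
  shows "energy p M u \<le> Lp_int g"
  using energy_le[OF UNIV_sets_M assms] by (simp add: restrict_UNIV)

lemma N1pI:
  assumes "u \<in> borel_measurable M" "finite_along UNIV u"
    and w: "wug UNIV (\<lambda>x. real_of_ereal (u x)) g" and "Lp_int g < \<infinity>"
    and "Lp_int (\<lambda>x. e2ennreal \<bar>u x\<bar>) < \<infinity>"
  shows "u \<in> N1p p M"
proof -
  obtain g' where g': "upper_gradient (restrict_space M UNIV) u g'" "Lp_fun p (restrict_space M UNIV) g'"
    using upper_gradient_of_wug[OF UNIV_sets_M w assms(2) assms(4)] .
  have "Lp_loc p (restrict_space M UNIV) g'"
    using g'(2) by (intro Lp_imp_Lp_loc UNIV_sets_M) (simp_all add: Lp_fun_def restrict_UNIV)
  then have "\<exists>g. upper_gradient M u g \<and> Lp_loc p M g"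
    using g'(1) unfolding restrict_UNIV by blast
  moreover have "energy p M u < \<infinity>"
    using energy_le_M[OF w assms(2)] assms(4) by (rule order.strict_trans1)
  ultimately show ?thesis
    using assms unfolding N1p_def N1p_norm_finite_iff by blast
qed

lemma aec_trivial: "(\<And>l \<gamma>. (l, \<gamma>) \<in> curves S \<Longrightarrow> P l \<gamma>) \<Longrightarrow> aec S P"
  using aec_all_countable[of "{}" S "\<lambda>_ _ _. False"] by (auto elim: aec_mono)

lemma finite_along_real [simp]: "finite_along S (\<lambda>x. ereal (u x))"
  unfolding finite_along_def by (rule aec_trivial) simp

text \<open>The indicator of \<open>A\<close> competes with norm 0: it vanishes almost everywhere,
  and since almost every curve misses \<open>A\<close>, the density 0 is a gradient.\<close>

lemma capacity_zero_of_exceptional: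
  assumes "exceptional A"
  shows "capacity p M A = 0"
proof -
  let ?u = "\<lambda>x. ereal (indicator A x)"
  have A: "A \<in> null_sets M" using assms by (simp add: exceptional_def)
  have AE: "AE x in M. ?u x = 0"
    using AE_not_in[OF A] by eventually_elim (simp add: zero_ereal_def)
  have Lp: "Lp_int (\<lambda>x. e2ennreal \<bar>?u x\<bar>) = (\<integral>\<^sup>+ x. 0 \<partial>M)"
    by (rule nn_integral_cong_AE, use AE in eventually_elim) simp
  have "wug UNIV (\<lambda>x. 0) (\<lambda>x. 0)"
    by (rule wugI_endpoints) (simp_all add: aec_trivial)
  then have w: "wug UNIV (\<lambda>x. real_of_ereal (?u x)) (\<lambda>x. 0)"
    by (rule wug_cong) (rule aec_mono[OF exceptional_aec[OF assms]], simp)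
  have N: "?u \<in> N1p p M"
    by (rule N1pI[OF _ finite_along_real w]) (use A Lp in auto)
  have "energy p M ?u \<le> 0" using energy_le_M[OF w finite_along_real] by simp
  then have "epow (N1p_norm p M ?u) p = 0"
    unfolding N1p_norm_powr[OF p_pos] using Lp by simp
  moreover have "capacity p M A \<le> epow (N1p_norm p M ?u) p"
    unfolding capacity_def by (rule INF_lower) (use N in \<open>auto simp: one_ereal_def\<close>)
  ultimately show ?thesis by simp
qed

text \<open>Functions \<open>u n\<close> equal to 1 on \<open>A\<close> with rapidly decreasing
  norms are dominated, together with their gradients, by \<open>1 / 2 ^ n\<close> times one
  p-integrable density \<open>\<rho>\<close> that is infinite on \<open>A\<close>; so
  \<open>A\<close> is null. On a curve that meets \<open>A\<close> and has a finite integral of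
  \<open>\<rho>\<close>, \<open>u n\<close> would be uniformly close to 1 and yet have a small
  integral.\<close>

lemma exceptional_of_capacity_zero:
  assumes "capacity p M A = 0"
  shows "exceptional A"
proof -
  \<comment> \<open>Compensates the factor \<open>2 powr p\<close> of \<open>Lp_add\<close> and the
    scaling by \<open>2 ^ n\<close>, leaving \<open>(1/2) ^ n\<close>.\<close>
  define \<epsilon> where "\<epsilon> n = (1/2) ^ n / (2 powr p * (2 ^ n) powr p)" for n :: nat
  have \<epsilon>: "0 < \<epsilon> n" for n by (simp add: \<epsilon>_def)
  have "\<forall>n. \<exists>u g. u \<in> N1p p M \<and> (\<forall>x\<in>A. u x = 1) \<and> wug UNIV (\<lambda>x. real_of_ereal (u x)) g \<and>
      Lp_int (\<lambda>x. e2ennreal \<bar>u x\<bar>) + Lp_int g < ennreal (\<epsilon> n)"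
  proof
    fix n
    have "(INF u \<in> {u \<in> N1p p M. \<forall>x\<in>A. u x = 1}. epow (N1p_norm p M u) p) < ennreal (\<epsilon> n)"
      using assms \<epsilon>[of n] by (simp add: capacity_def)
    then obtain u where u: "u \<in> N1p p M" "\<forall>x\<in>A. u x = 1" "epow (N1p_norm p M u) p < ennreal (\<epsilon> n)"
      unfolding INF_less_iff by blast
    moreover obtain g where "wug UNIV (\<lambda>x. real_of_ereal (u x)) g" "Lp_int g = energy p M u"
      using N1pD(5)[OF u(1)] by blast
    ultimately show "\<exists>u g. u \<in> N1p p M \<and> (\<forall>x\<in>A. u x = 1) \<and> wug UNIV (\<lambda>x. real_of_ereal (u x)) g \<and>
      Lp_int (\<lambda>x. e2ennreal \<bar>u x\<bar>) + Lp_int g < ennreal (\<epsilon> n)"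
      unfolding N1p_norm_powr[OF p_pos] by metis
  qed
  then obtain u g where u: "\<And>n. u n \<in> N1p p M" "\<And>n x. x \<in> A \<Longrightarrow> u n x = 1"
    and g: "\<And>n. wug UNIV (\<lambda>x. real_of_ereal (u n x)) (g n)"
    and small: "\<And>n. Lp_int (\<lambda>x. e2ennreal \<bar>u n x\<bar>) + Lp_int (g n) < ennreal (\<epsilon> n)"
    by metis
  \<comment> \<open>\<open>u n\<close> is only \<open>M\<close>-measurable; line integrals call for
    a Borel majorant of its absolute value.\<close>
  have "\<forall>n. \<exists>w. w \<in> borel_measurable borel \<and> (\<forall>x. e2ennreal \<bar>u n x\<bar> \<le> w x) \<and> (AE x in M. w x = e2ennreal \<bar>u n x\<bar>)"
  proof
    fix n
    have "(\<lambda>x. e2ennreal \<bar>u n x\<bar>) \<in> borel_measurable M" using N1pD(1)[OF u(1)[of n]] by measurable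
    then show "\<exists>w. w \<in> borel_measurable borel \<and> (\<forall>x. e2ennreal \<bar>u n x\<bar> \<le> w x) \<and> (AE x in M. w x = e2ennreal \<bar>u n x\<bar>)"
      by (rule borel_majorant) blast
  qed
  then obtain w where w: "\<And>n. w n \<in> borel_measurable borel" "\<And>n x. e2ennreal \<bar>u n x\<bar> \<le> w n x"
    "\<And>n. AE x in M. w n x = e2ennreal \<bar>u n x\<bar>" by metis
  define r where "r n x = ennreal (2 ^ n) * (w n x + g n x)" for n x
  define \<rho> where "\<rho> x = (SUP n. r n x)" for x
  note [measurable] = wug_borel[OF g] w(1) wug_borel_M[OF g] borel_measurable_M[OF w(1)]
  have \<rho>_borel [measurable]: "\<rho> \<in> borel_measurable borel" unfolding \<rho>_def r_def by measurable
  have \<rho>_Lp: "Lp_int \<rho> < \<infinity>"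
    unfolding \<rho>_def
  proof (rule SUP_Lp)
    show "r n \<in> borel_measurable M" for n unfolding r_def by measurable
    show "summable (\<lambda>n. (1/2::real) ^ n)" by (rule summable_geometric) simp
    fix n
    have "Lp_int (r n) = (\<integral>\<^sup>+ x. ennreal ((2 ^ n) powr p) * epow (w n x + g n x) p \<partial>M)"
      using p_pos by (simp add: r_def epow_mult epow_ennreal)
    also have "\<dots> = ennreal ((2 ^ n) powr p) * Lp_int (\<lambda>x. w n x + g n x)"
      by (rule nn_integral_cmult) measurable
    also have "\<dots> \<le> ennreal ((2 ^ n) powr p) * (ennreal (2 powr p) * (Lp_int (w n) + Lp_int (g n)))"
      by (intro mult_left_mono Lp_add) measurable
    also have "Lp_int (w n) = Lp_int (\<lambda>x. e2ennreal \<bar>u n x\<bar>)"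
      by (rule nn_integral_cong_AE, use w(3)[of n] in eventually_elim) simp
    also have "ennreal ((2 ^ n) powr p) * (ennreal (2 powr p) * (Lp_int (\<lambda>x. e2ennreal \<bar>u n x\<bar>) + Lp_int (g n)))
        \<le> ennreal ((2 ^ n) powr p) * (ennreal (2 powr p) * ennreal (\<epsilon> n))"
      by (intro mult_left_mono less_imp_le[OF small]) simp_all
    also have "\<dots> = ennreal ((2 ^ n) powr p * (2 powr p * \<epsilon> n))"
      using \<epsilon>[of n] by (simp add: ennreal_mult)
    also have "(2 ^ n) powr p * (2 powr p * \<epsilon> n) = (1/2) ^ n" by (simp add: \<epsilon>_def)
    finally show "Lp_int (r n) \<le> ennreal ((1/2) ^ n)" .
  qed simp
  have r_le: "r n x \<le> \<rho> x" for n x unfolding \<rho>_def by (rule SUP_upper) simp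
  have \<rho>_inf: "\<rho> x = \<infinity>" if x: "x \<in> A" for x
  proof -
    have "ennreal (2 ^ n) \<le> \<rho> x" for n
    proof -
      have "1 \<le> w n x" using w(2)[of n x] u(2)[OF x, of n] by (simp add: one_ereal_def)
      then have "ennreal (2 ^ n) * 1 \<le> r n x"
        unfolding r_def by (intro mult_left_mono) (auto intro: add_increasing2)
      then show ?thesis using r_le[of n x] by simp
    qed
    then show ?thesis
    proof (cases "\<rho> x")
      case (real c)
      obtain n where "c < 2 ^ n" using real_arch_pow[of 2 c] by auto
      with \<open>ennreal (2 ^ n) \<le> \<rho> x\<close> real show ?thesis by (simp add: ennreal_le_iff2)
    qed simp
  qed
  show ?thesis
    unfolding exceptional_def
  proof
    have "AE x in M. epow (\<rho> x) p \<noteq> \<infinity>"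
      using \<rho>_Lp borel_measurable_M[OF \<rho>_borel] by (intro nn_integral_noteq_infinite) auto
    then have "AE x in M. x \<notin> A"
    proof eventually_elim
      case (elim x)
      then show ?case using \<rho>_inf[of x] by auto
    qed
    then show "A \<in> null_sets M" by (simp add: AE_M_iff)
    have "aec UNIV (\<lambda>l \<gamma>. segment_integral \<rho> \<gamma> 0 l < \<infinity> \<and>
      (\<forall>n. controls (\<lambda>x. real_of_ereal (u n x)) (g n) l \<gamma>))"
      by (intro aec_conj aec_all_nat aec_finite \<rho>_borel \<rho>_Lp wug_aec[OF g])
    then show "aec UNIV (\<lambda>l \<gamma>. \<forall>t\<in>{0..l}. \<gamma> t \<notin> A)"
    proof (rule aec_mono, intro ballI notI, elim conjE)
      fix l \<gamma> s
      assume c: "(l, \<gamma>) \<in> curves UNIV" and fin: "segment_integral \<rho> \<gamma> 0 l < \<infinity>"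
        and s: "s \<in> {0..l}" "\<gamma> s \<in> A"
        and incr: "\<forall>n. controls (\<lambda>x. real_of_ereal (u n x)) (g n) l \<gamma>"
      have l: "0 < l" using c by (simp add: curves_iff)
      define C where "C = enn2real (segment_integral \<rho> \<gamma> 0 l)"
      have C: "segment_integral \<rho> \<gamma> 0 l = ennreal C" "0 \<le> C" using fin by (auto simp: C_def)
      have bound: "segment_integral (\<lambda>x. w n x + g n x) \<gamma> 0 l \<le> ennreal (C / 2 ^ n)" for n
      proof -
        have "segment_integral (\<lambda>x. w n x + g n x) \<gamma> 0 l
            \<le> (\<integral>\<^sup>+ t. ennreal (1 / 2 ^ n) * (\<rho> (\<gamma> t) * indicator {0..l} t) \<partial>lborel)"
          unfolding segment_integral_def
        proof (rule nn_integral_mono)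
          fix t
          have "w n (\<gamma> t) + g n (\<gamma> t) = ennreal (1 / 2 ^ n) * r n (\<gamma> t)"
            unfolding r_def by (simp add: mult.assoc[symmetric] ennreal_mult[symmetric])
          also have "\<dots> \<le> ennreal (1 / 2 ^ n) * \<rho> (\<gamma> t)" by (intro mult_left_mono r_le) simp
          finally show "(w n (\<gamma> t) + g n (\<gamma> t)) * indicator {0..l} t
              \<le> ennreal (1 / 2 ^ n) * (\<rho> (\<gamma> t) * indicator {0..l} t)"
            by (simp split: split_indicator)
        qed
        also have "\<dots> = ennreal (1 / 2 ^ n) * segment_integral \<rho> \<gamma> 0 l"
          unfolding segment_integral_def
          using curve_measurable[OF c \<rho>_borel, of 0 l] by (intro nn_integral_cmult) simp
        also have "\<dots> = ennreal (C / 2 ^ n)" using C by (simp add: ennreal_mult[symmetric])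
        finally show ?thesis .
      qed
      \<comment> \<open>The value 1 at s and the small oscillation bound the majorant from below at
        every point of the curve; this bound is integrated over the curve.\<close>
      have main: "l \<le> C / 2 ^ n * (1 + l)" for n
      proof -
        have one: "1 \<le> w n (\<gamma> t) + ennreal (C / 2 ^ n)" if t: "t \<in> {0..l}" for t
        proof -
          let ?v = "\<lambda>x. real_of_ereal (u n x)"
          have gap: "ennreal \<bar>?v (\<gamma> s) - ?v (\<gamma> t)\<bar> \<le> ennreal (C / 2 ^ n)"
          proof -
            have "ennreal \<bar>?v (\<gamma> s) - ?v (\<gamma> t)\<bar> \<le> segment_integral (g n) \<gamma> (min s t) (max s t)"
              using incr[rule_format, of "min s t" "max s t" n] s t
              by (cases "s \<le> t") (simp_all add: min_def max_def abs_minus_commute)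
            also have "\<dots> \<le> segment_integral (g n) \<gamma> 0 l"
              using s t by (intro segment_integral_mono_interval) auto
            also have "\<dots> \<le> segment_integral (\<lambda>x. w n x + g n x) \<gamma> 0 l"
              by (intro segment_integral_mono) simp
            also have "\<dots> \<le> ennreal (C / 2 ^ n)" by (rule bound)
            finally show ?thesis .
          qed
          have "?v (\<gamma> s) = 1" using u(2)[OF s(2)] by (simp add: one_ereal_def)
          then have "1 \<le> \<bar>?v (\<gamma> t)\<bar> + \<bar>?v (\<gamma> s) - ?v (\<gamma> t)\<bar>" by linarith
          then have "ennreal 1 \<le> ennreal (\<bar>?v (\<gamma> t)\<bar> + \<bar>?v (\<gamma> s) - ?v (\<gamma> t)\<bar>)" by (rule ennreal_leI)
          also have "\<dots> = ennreal \<bar>?v (\<gamma> t)\<bar> + ennreal \<bar>?v (\<gamma> s) - ?v (\<gamma> t)\<bar>"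
            by (rule ennreal_plus) (rule abs_ge_zero)+
          also have "\<dots> \<le> w n (\<gamma> t) + ennreal (C / 2 ^ n)"
            by (intro add_mono gap order_trans[OF e2ennreal_abs_ge w(2)])
          finally show ?thesis by simp
        qed
        have "ennreal l = (\<integral>\<^sup>+ t. indicator {0..l} t \<partial>lborel)" using l by simp
        also have "\<dots> \<le> (\<integral>\<^sup>+ t. w n (\<gamma> t) * indicator {0..l} t + ennreal (C / 2 ^ n) * indicator {0..l} t \<partial>lborel)"
          by (rule nn_integral_mono) (use one in \<open>auto split: split_indicator\<close>)
        also have "\<dots> = segment_integral (w n) \<gamma> 0 l + (\<integral>\<^sup>+ t. ennreal (C / 2 ^ n) * indicator {0..l} t \<partial>lborel)"
          unfolding segment_integral_def
          using curve_measurable[OF c w(1), of 0 l n] by (intro nn_integral_add) simp_all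
        also have "(\<integral>\<^sup>+ t. ennreal (C / 2 ^ n) * indicator {0..l} t \<partial>lborel) = ennreal (C / 2 ^ n * l)"
        proof -
          have "(\<integral>\<^sup>+ t. ennreal (C / 2 ^ n) * indicator {0..l} t \<partial>lborel) = ennreal (C / 2 ^ n) * emeasure lborel {0..l}"
            by (rule nn_integral_cmult_indicator) simp
          also have "emeasure lborel {0..l} = ennreal l" using l by simp
          also have "ennreal (C / 2 ^ n) * ennreal l = ennreal (C / 2 ^ n * l)"
            by (rule ennreal_mult[symmetric]) (use C l in simp_all)
          finally show ?thesis .
        qed
        also have "segment_integral (w n) \<gamma> 0 l \<le> ennreal (C / 2 ^ n)"
          by (rule order_trans[OF segment_integral_mono bound]) simp
        finally have "ennreal l \<le> ennreal (C / 2 ^ n) + ennreal (C / 2 ^ n * l)" by (simp add: add_right_mono)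
        also have "\<dots> = ennreal (C / 2 ^ n + C / 2 ^ n * l)"
          by (rule ennreal_plus[symmetric]) (use C l in simp_all)
        finally have "l \<le> C / 2 ^ n + C / 2 ^ n * l"
          by (rule ennreal_le_iff[THEN iffD1, rotated]) (use C l in simp)
        then show ?thesis by (simp only: distrib_left mult_1_right)
      qed
      obtain n where n: "C * (1 + l) / l < 2 ^ n" using real_arch_pow[of 2 "C * (1 + l) / l"] by auto
      have "l * 2 ^ n \<le> C * (1 + l)" using main[of n] by (simp add: field_simps)
      moreover have "C * (1 + l) < l * 2 ^ n" using n l by (simp add: field_simps)
      ultimately show False by simp
    qed
  qed
qed

lemma capacity_zero_iff: "capacity p M A = 0 \<longleftrightarrow> exceptional A"
  using capacity_zero_of_exceptional exceptional_of_capacity_zero by blast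

lemma quasi_everywhere_iff: "quasi_everywhere p M E P \<longleftrightarrow> exceptional {x \<in> E. \<not> P x}"
  by (simp add: quasi_everywhere_def capacity_zero_iff)

lemma N1p_infinite_exceptional:
  assumes "u \<in> N1p p M"
  shows "exceptional {x. \<bar>u x\<bar> = \<infinity>}"
  unfolding exceptional_def
proof
  note [measurable] = N1pD(1)[OF assms]
  have "AE x in M. epow (e2ennreal \<bar>u x\<bar>) p \<noteq> \<infinity>"
    using N1pD(3)[OF assms] by (intro nn_integral_noteq_infinite) auto
  then have "AE x in M. \<bar>u x\<bar> \<noteq> \<infinity>" by eventually_elim auto
  then show "{x. \<bar>u x\<bar> = \<infinity>} \<in> null_sets M" by (simp add: AE_M_iff)
  show "aec UNIV (\<lambda>l \<gamma>. \<forall>t\<in>{0..l}. \<gamma> t \<notin> {x. \<bar>u x\<bar> = \<infinity>})"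
    using N1pD(2)[OF assms] by (simp add: finite_along_def)
qed


section \<open>Extension and limits of weak upper gradients\<close>

text \<open>Along almost every curve \<open>H\<close> is continuous, and where it is positive the
  curve runs inside \<open>E\<close>; thus \<open>increment_le_off_zeros\<close> applies, and
  \<open>g\<close> is used only where \<open>H\<close> is positive. There are two uses. With
  \<open>S\<close> the whole space, a function controlled only in \<open>E\<close> is extended by
  zero. With \<open>H\<close> the absolute value of \<open>k\<close>, the gradient may be set to 0
  where \<open>k\<close> vanishes.\<close>

lemma wug_extend:
  assumes H: "wug S H gH" "finite_on S gH"
    and k: "\<And>x. x \<in> S \<Longrightarrow> \<bar>k x\<bar> \<le> H x" and supp: "\<And>x. x \<in> S \<Longrightarrow> 0 < H x \<Longrightarrow> x \<in> E"
    and g: "wug E k g" and g': "g' \<in> borel_measurable borel" "\<And>x. x \<in> S \<Longrightarrow> 0 < H x \<Longrightarrow> g x \<le> g' x"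
  shows "wug S k g'"
  unfolding wug_def
proof (rule conjI[OF g'(1)],
    rule aec_mono[OF aec_conj[OF aec_conj[OF wug_aec[OF H(1)] H(2)] aec_subcurves[OF wug_aec[OF g], of S]]],
    elim conjE, intro allI impI)
  fix l \<gamma> a b
  assume c: "(l, \<gamma>) \<in> curves S" and ab: "0 \<le> a" "a \<le> b" "b \<le> l"
    and HH: "controls H gH l \<gamma>"
    and fin: "segment_integral gH \<gamma> 0 l < \<infinity>"
    and sub: "\<forall>a b. 0 \<le> a \<longrightarrow> a < b \<longrightarrow> b \<le> l \<longrightarrow> \<gamma> ` {a..b} \<subseteq> E \<longrightarrow>
      (\<forall>aa ba. 0 \<le> aa \<longrightarrow> aa \<le> ba \<longrightarrow> ba \<le> b - a \<longrightarrow>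
        ennreal \<bar>k (\<gamma> (a + aa)) - k (\<gamma> (a + ba))\<bar> \<le> segment_integral g (\<lambda>t. \<gamma> (a + t)) aa ba)"
  have S: "\<gamma> t \<in> S" if "0 \<le> t" "t \<le> l" for t using c that by (auto simp: curves_iff image_subset_iff)
  have cont: "continuous_on {a..b} (\<lambda>t. H (\<gamma> t))"
    by (rule increment_majorant.continuous[OF segment_increment_majorant[OF c wug_borel[OF H(1)] HH fin ab]])
  show "ennreal \<bar>k (\<gamma> a) - k (\<gamma> b)\<bar> \<le> segment_integral g' \<gamma> a b"
    unfolding segment_integral_def
  proof (rule increment_le_off_zeros[OF ab(2) curve_measurable[OF c g'(1) ab(1,3)] cont])
    show "\<bar>k (\<gamma> t)\<bar> \<le> H (\<gamma> t)" if "a \<le> t" "t \<le> b" for t using that ab by (intro k S) auto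
    fix s t assume st: "a \<le> s" "s \<le> t" "t \<le> b" and pos: "\<And>r. s \<le> r \<Longrightarrow> r \<le> t \<Longrightarrow> 0 < H (\<gamma> r)"
    show "ennreal \<bar>k (\<gamma> s) - k (\<gamma> t)\<bar> \<le> (\<integral>\<^sup>+ r. g' (\<gamma> r) * indicator {s..t} r \<partial>lborel)"
    proof (cases "s = t")
      case False
      then have "s < t" using st by simp
      \<comment> \<open>Positivity of \<open>H\<close> on the whole piece keeps it in
        \<open>E\<close>, so that it is a curve to which the gradient in \<open>E\<close>
        applies.\<close>
      moreover have "\<gamma> ` {s..t} \<subseteq> E" using pos st ab by (auto intro!: supp S)
      ultimately have "ennreal \<bar>k (\<gamma> s) - k (\<gamma> t)\<bar> \<le> segment_integral g (\<lambda>r. \<gamma> (s + r)) 0 (t - s)"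
        using sub[rule_format, of s t 0 "t - s"] st ab by simp
      also have "\<dots> = segment_integral g \<gamma> s t"
        using segment_integral_shift[OF c wug_borel[OF g], of s s t t] st ab by simp
      also have "\<dots> \<le> segment_integral g' \<gamma> s t"
        using st ab pos by (intro segment_integral_mono g'(2) S) auto
      finally show ?thesis by (simp add: segment_integral_def)
    qed simp
  qed
qed

section \<open>Passing to the limit along curves\<close>

lemma limsup_real_bounded:
  fixes a :: "nat \<Rightarrow> real"
  assumes "bounded (range a)"
  shows "ereal (real_of_ereal (limsup (\<lambda>j. ereal (a j)))) = limsup (\<lambda>j. ereal (a j))"
proof -
  obtain B where B: "\<And>j. \<bar>a j\<bar> \<le> B" using assms by (auto simp: bounded_iff)
  have "limsup (\<lambda>j. ereal (a j)) \<le> limsup (\<lambda>j. ereal B)"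
    by (intro Limsup_mono always_eventually) (use B in \<open>auto simp: abs_le_iff\<close>)
  moreover have "limsup (\<lambda>j. ereal (- B)) \<le> limsup (\<lambda>j. ereal (a j))"
    by (intro Limsup_mono always_eventually) (use B in \<open>auto simp: abs_le_iff minus_le_iff\<close>)
  ultimately have "ereal (- B) \<le> limsup (\<lambda>j. ereal (a j))" "limsup (\<lambda>j. ereal (a j)) \<le> ereal B"
    by (simp_all add: Limsup_const)
  then show ?thesis by (cases "limsup (\<lambda>j. ereal (a j))") auto
qed

lemma limsup_real_diff_le:
  fixes a b :: "nat \<Rightarrow> real"
  assumes "bounded (range a)" "bounded (range b)" and le: "\<And>j. \<bar>a j - b j\<bar> \<le> A + e j * B" and e: "e \<longlonglongrightarrow> 0"
  shows "\<bar>real_of_ereal (limsup (\<lambda>j. ereal (a j))) - real_of_ereal (limsup (\<lambda>j. ereal (b j)))\<bar> \<le> A"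
proof -
  let ?L = "\<lambda>a. real_of_ereal (limsup (\<lambda>j. ereal (a j)))"
  have one_sided: "?L a \<le> A + ?L b"
    if ab: "bounded (range a)" "bounded (range b)" and le: "\<And>j. a j \<le> A + e j * B + b j" for a b :: "nat \<Rightarrow> real"
  proof -
    have "(\<lambda>j. A + e j * B) \<longlonglongrightarrow> A + 0 * B" by (intro tendsto_intros e)
    then have lim: "(\<lambda>j. ereal (A + e j * B)) \<longlonglongrightarrow> ereal A" by simp
    have "limsup (\<lambda>j. ereal (a j)) \<le> limsup (\<lambda>j. ereal (A + e j * B) + ereal (b j))"
      by (intro Limsup_mono always_eventually allI) (simp add: le)
    also have "\<dots> = ereal A + limsup (\<lambda>j. ereal (b j))"
      by (rule ereal_limsup_lim_add[OF lim]) simp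
    finally have "ereal (?L a) \<le> ereal A + ereal (?L b)"
      using ab by (simp only: limsup_real_bounded)
    then show ?thesis by simp
  qed
  have "a j \<le> A + e j * B + b j" "b j \<le> A + e j * B + a j" for j using le[of j] by linarith+
  then have "?L a \<le> A + ?L b" "?L b \<le> A + ?L a" using assms(1,2) by (auto intro: one_sided)
  then show ?thesis by linarith
qed

text \<open>The pointwise bound on \<open>G j\<close> integrates along each curve on which
  \<open>g\<close> and \<open>\<rho>\<close> have finite integrals, and the error term tends to 0.
  Boundedness of the sequence at one point of the curve spreads to all others through the
  increments, so the limsup is real along the whole curve.\<close>

lemma wug_limsup:
  fixes u :: "nat \<Rightarrow> 'a \<Rightarrow> real"
  assumes w: "\<And>j. wug S (u j) (G j)" and g: "g \<in> borel_measurable borel" and \<rho>: "\<rho> \<in> borel_measurable borel"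
    and le: "\<And>j x. x \<in> S \<Longrightarrow> G j x \<le> g x + ennreal (e j) * \<rho> x" and e: "e \<longlonglongrightarrow> 0" "\<And>j. 0 \<le> e j"
    and g_fin: "finite_on S g"
    and \<rho>_fin: "finite_on S \<rho>"
    and bdd: "aec S (\<lambda>l \<gamma>. \<exists>t\<in>{0..l}. bounded (range (\<lambda>j. u j (\<gamma> t))))"
  shows "aec S (\<lambda>l \<gamma>. \<forall>t\<in>{0..l}. bounded (range (\<lambda>j. u j (\<gamma> t))))"
    and "wug S (\<lambda>x. real_of_ereal (limsup (\<lambda>j. ereal (u j x)))) g"
proof -
  have main: "(\<forall>t\<in>{0..l}. bounded (range (\<lambda>j. u j (\<gamma> t)))) \<and>
      (\<forall>a b. 0 \<le> a \<longrightarrow> a \<le> b \<longrightarrow> b \<le> l \<longrightarrow>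
        ennreal \<bar>real_of_ereal (limsup (\<lambda>j. ereal (u j (\<gamma> a)))) - real_of_ereal (limsup (\<lambda>j. ereal (u j (\<gamma> b))))\<bar>
        \<le> segment_integral g \<gamma> a b)"
    if c: "(l, \<gamma>) \<in> curves S" and gf: "segment_integral g \<gamma> 0 l < \<infinity>"
      and \<rho>f: "segment_integral \<rho> \<gamma> 0 l < \<infinity>" and ex: "\<exists>t\<in>{0..l}. bounded (range (\<lambda>j. u j (\<gamma> t)))"
      and incr: "\<forall>j. controls (u j) (G j) l \<gamma>" for l \<gamma>
  proof -
    let ?A = "\<lambda>a b. enn2real (segment_integral g \<gamma> a b)" and ?B = "\<lambda>a b. enn2real (segment_integral \<rho> \<gamma> a b)"
    have fin: "segment_integral g \<gamma> a b = ennreal (?A a b)" "segment_integral \<rho> \<gamma> a b = ennreal (?B a b)"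
      if "0 \<le> a" "b \<le> l" for a b
      using order.strict_trans1[OF segment_integral_mono_interval[OF that, of g \<gamma>] gf]
        order.strict_trans1[OF segment_integral_mono_interval[OF that, of \<rho> \<gamma>] \<rho>f] by simp_all
    have diff: "\<bar>u j (\<gamma> a) - u j (\<gamma> b)\<bar> \<le> ?A a b + e j * ?B a b" if ab: "0 \<le> a" "a \<le> b" "b \<le> l" for j a b
    proof -
      have S: "\<gamma> t \<in> S" if "a \<le> t" "t \<le> b" for t using c that ab by (auto simp: curves_iff image_subset_iff)
      have "ennreal \<bar>u j (\<gamma> a) - u j (\<gamma> b)\<bar> \<le> segment_integral (G j) \<gamma> a b"
        using incr ab by blast
      also have "\<dots> \<le> (\<integral>\<^sup>+ t. g (\<gamma> t) * indicator {a..b} t + ennreal (e j) * (\<rho> (\<gamma> t) * indicator {a..b} t) \<partial>lborel)"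
        unfolding segment_integral_def
        by (rule nn_integral_mono) (use le S in \<open>simp split: split_indicator\<close>)
      also have "\<dots> = segment_integral g \<gamma> a b + ennreal (e j) * segment_integral \<rho> \<gamma> a b"
        unfolding segment_integral_def
        using curve_measurable[OF c g ab(1,3)] curve_measurable[OF c \<rho> ab(1,3)]
        by (simp add: nn_integral_add nn_integral_cmult)
      also have "\<dots> = ennreal (?A a b + e j * ?B a b)"
      proof -
        define A B where "A = ?A a b" and "B = ?B a b"
        have AB: "segment_integral g \<gamma> a b = ennreal A" "segment_integral \<rho> \<gamma> a b = ennreal B" "0 \<le> A" "0 \<le> B"
          unfolding A_def B_def by (rule fin[OF ab(1,3)] enn2real_nonneg)+
        have "ennreal A + ennreal (e j) * ennreal B = ennreal (A + e j * B)"
          using AB(3,4) e(2)[of j] by (simp add: ennreal_mult)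
        then show ?thesis using AB by simp
      qed
      finally show ?thesis using e(2)[of j] by (subst (asm) ennreal_le_iff) auto
    qed
    have bounded: "bounded (range (\<lambda>j. u j (\<gamma> s)))" if s: "s \<in> {0..l}" for s
    proof -
      obtain t where t: "t \<in> {0..l}" "bounded (range (\<lambda>j. u j (\<gamma> t)))" using ex by blast
      obtain K where K: "\<And>j. \<bar>u j (\<gamma> t)\<bar> \<le> K" using t(2) by (auto simp: bounded_iff)
      have "Bseq e" using e(1) by (intro convergent_imp_Bseq) (auto simp: convergent_def)
      then obtain L where L: "\<And>j. \<bar>e j\<bar> \<le> L" by (auto simp: Bseq_def)
      let ?a = "min s t" and ?b = "max s t"
      have "\<bar>u j (\<gamma> s)\<bar> \<le> K + ?A ?a ?b + L * ?B ?a ?b" for j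
      proof -
        have "\<bar>u j (\<gamma> s) - u j (\<gamma> t)\<bar> \<le> ?A ?a ?b + e j * ?B ?a ?b"
          using diff[of ?a ?b j] s t by (cases "s \<le> t") (simp_all add: min_def max_def abs_minus_commute)
        moreover have "e j * ?B ?a ?b \<le> L * ?B ?a ?b"
          using L[of j] by (intro mult_right_mono) auto
        ultimately show ?thesis using K[of j] by linarith
      qed
      then show ?thesis by (auto simp: bounded_iff)
    qed
    have "ennreal \<bar>real_of_ereal (limsup (\<lambda>j. ereal (u j (\<gamma> a)))) - real_of_ereal (limsup (\<lambda>j. ereal (u j (\<gamma> b))))\<bar>
        \<le> segment_integral g \<gamma> a b" if ab: "0 \<le> a" "a \<le> b" "b \<le> l" for a b
      by (rule order_trans[OF _ eq_refl[OF fin(1)[OF ab(1,3), symmetric]]], rule ennreal_leI, rule limsup_real_diff_le[OF _ _ diff[OF ab] e(1)]; rule bounded; use ab in simp)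
    then show ?thesis using bounded by blast
  qed
  have all: "aec S (\<lambda>l \<gamma>. (segment_integral g \<gamma> 0 l < \<infinity> \<and> segment_integral \<rho> \<gamma> 0 l < \<infinity>) \<and>
      (\<exists>t\<in>{0..l}. bounded (range (\<lambda>j. u j (\<gamma> t)))) \<and>
      (\<forall>j. controls (u j) (G j) l \<gamma>))"
    by (intro aec_conj aec_all_nat g_fin \<rho>_fin bdd wug_aec w)
  show "aec S (\<lambda>l \<gamma>. \<forall>t\<in>{0..l}. bounded (range (\<lambda>j. u j (\<gamma> t))))"
    by (rule aec_mono[OF all], elim conjE) (rule conjunct1[OF main])
  show "wug S (\<lambda>x. real_of_ereal (limsup (\<lambda>j. ereal (u j x)))) g"
    unfolding wug_def
    by (rule conjI[OF g], rule aec_mono[OF all], elim conjE) (rule conjunct2[OF main])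
qed

end


section \<open>Uniform convexity\<close>

text \<open>The mean value theorem is applied to the two halves and the derivative is strictly
  increasing. The intermediate points are interior, so x = 0 causes no trouble.\<close>

lemma powr_midpoint_less:
  fixes x y p :: real
  assumes p: "1 < p" and xy: "0 \<le> x" "x < y"
  shows "((x + y) / 2) powr p < (x powr p + y powr p) / 2"
proof -
  let ?m = "(x + y) / 2"
  have mv: "\<exists>z. a < z \<and> z < b \<and> b powr p - a powr p = p * z powr (p - 1) * (b - a)" if ab: "0 \<le> a" "a < b" for a b
  proof -
    have "continuous_on {a..b} (\<lambda>z. z powr p)"
      using ab p by (intro continuous_on_powr' continuous_intros) auto
    moreover have "((\<lambda>z. z powr p) has_derivative (\<lambda>h. h * (p * z powr (p - 1)))) (at z)" if "a < z" "z < b" for z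
    proof -
      have "((\<lambda>z. z powr p) has_real_derivative (p * z powr (p - 1))) (at z)"
        using that ab by (intro has_real_derivative_powr) auto
      then show ?thesis by (simp add: has_field_derivative_def mult.commute[of _ "p * z powr (p - 1)"])
    qed
    ultimately obtain z where "a < z" "z < b" "b powr p - a powr p = (b - a) * (p * z powr (p - 1))"
      using mvt[OF ab(2), of "\<lambda>z. z powr p" "\<lambda>z h. h * (p * z powr (p - 1))"] by blast
    then show ?thesis by (intro exI[of _ z]) (simp add: algebra_simps)
  qed
  obtain z where z: "x < z" "z < ?m" "?m powr p - x powr p = p * z powr (p - 1) * (?m - x)"
    using mv[of x ?m] xy by auto
  obtain w where w: "?m < w" "w < y" "y powr p - ?m powr p = p * w powr (p - 1) * (y - ?m)"
    using mv[of ?m y] xy by auto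
  have "z powr (p - 1) < w powr (p - 1)"
    using z w xy p by (intro powr_less_mono2) auto
  then have "p * z powr (p - 1) * (?m - x) < p * w powr (p - 1) * (?m - x)"
    using p xy by simp
  then have "?m powr p - x powr p < p * w powr (p - 1) * (?m - x)" by (simp only: z(3))
  moreover have "?m - x = y - ?m" by (simp add: field_simps)
  ultimately have "?m powr p - x powr p < y powr p - ?m powr p" by (simp only: w(3))
  moreover have "A < (B + C) / 2" if "A - B < C - A" for A B C :: real using that by simp
  ultimately show ?thesis by blast
qed

lemma abs_powr_midpoint_less:
  fixes a b p :: real
  assumes p: "1 < p" and "a \<noteq> b"
  shows "\<bar>(a + b) / 2\<bar> powr p < (\<bar>a\<bar> powr p + \<bar>b\<bar> powr p) / 2"
proof -
  have le: "\<bar>(a + b) / 2\<bar> powr p \<le> ((\<bar>a\<bar> + \<bar>b\<bar>) / 2) powr p"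
    using p by (intro powr_mono2) auto
  consider "\<bar>a\<bar> < \<bar>b\<bar>" | "\<bar>b\<bar> < \<bar>a\<bar>" | "\<bar>a\<bar> = \<bar>b\<bar>" by linarith
  then show ?thesis
  proof cases
    case 1
    then show ?thesis using le powr_midpoint_less[OF p, of "\<bar>a\<bar>" "\<bar>b\<bar>"] by simp
  next
    case 2
    then show ?thesis using le powr_midpoint_less[OF p, of "\<bar>b\<bar>" "\<bar>a\<bar>"] by (simp add: add.commute)
  next
    case 3
    then have "a = - b" "b \<noteq> 0" using \<open>a \<noteq> b\<close> by auto
    then show ?thesis by simp
  qed
qed

text \<open>By homogeneity the larger absolute value may be taken to be 1. Then the pairs with
  \<open>\<epsilon> \<le> \<bar>a - b\<bar> powr p\<close> form a compact set on which the convexity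
  defect \<open>\<phi>\<close> is positive, hence bounded below; for all other pairs the term with
  \<open>\<epsilon>\<close> suffices. A pointwise inequality integrates directly and treats all p >
  1 alike.\<close>

lemma abs_powr_uniformly_convex:
  fixes p \<epsilon> :: real
  assumes p: "1 < p" and \<epsilon>: "0 < \<epsilon>"
  obtains C where "0 < C" "\<And>a b. \<bar>a - b\<bar> powr p + C * \<bar>(a + b) / 2\<bar> powr p
    \<le> (\<epsilon> + C / 2) * (\<bar>a\<bar> powr p + \<bar>b\<bar> powr p)"
proof -
  define \<phi> where "\<phi> z = (\<bar>fst z\<bar> powr p + \<bar>snd z\<bar> powr p) / 2 - \<bar>(fst z + snd z) / 2\<bar> powr p" for z :: "real \<times> real"
  define T where "T = {z :: real \<times> real. max \<bar>fst z\<bar> \<bar>snd z\<bar> = 1 \<and> \<epsilon> \<le> \<bar>fst z - snd z\<bar> powr p}"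
  have cont: "continuous_on UNIV (\<lambda>z. \<bar>F z\<bar> powr p)" if "continuous_on UNIV F" for F :: "real \<times> real \<Rightarrow> real"
    using that p by (intro continuous_on_powr' continuous_intros) auto
  have \<phi>_cont: "continuous_on UNIV \<phi>"
    unfolding \<phi>_def by (intro continuous_intros cont) auto
  have \<phi>_nonneg: "0 \<le> \<phi> z" for z
    using abs_powr_midpoint_less[OF p, of "fst z" "snd z"] by (cases "fst z = snd z") (auto simp: \<phi>_def)
  have "closed T"
    unfolding T_def
    by (intro closed_Collect_conj closed_Collect_eq closed_Collect_le continuous_intros cont)
  moreover have "bounded T"
  proof (rule boundedI)
    fix z assume "z \<in> T"
    then have "\<bar>fst z\<bar> \<le> 1" "\<bar>snd z\<bar> \<le> 1" by (auto simp: T_def)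
    then show "norm z \<le> 2" using norm_Pair_le[of "fst z" "snd z"] by simp
  qed
  ultimately have "compact T" by (simp add: compact_eq_bounded_closed)
  have "\<exists>m>0. \<forall>z\<in>T. m \<le> \<phi> z"
  proof (cases "T = {}")
    case False
    then obtain z where z: "z \<in> T" "\<And>y. y \<in> T \<Longrightarrow> \<phi> z \<le> \<phi> y"
      using continuous_attains_inf[OF \<open>compact T\<close> False continuous_on_subset[OF \<phi>_cont]] by auto
    have "fst z \<noteq> snd z" using z(1) \<epsilon> p by (auto simp: T_def)
    then have "0 < \<phi> z" using abs_powr_midpoint_less[OF p, of "fst z" "snd z"] by (simp add: \<phi>_def)
    then show ?thesis using z(2) by blast
  qed (auto intro: exI[of _ 1])
  then obtain m where m: "0 < m" "\<And>z. z \<in> T \<Longrightarrow> m \<le> \<phi> z" by blast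
  \<comment> \<open>When the larger absolute value is 1, \<open>\<bar>a - b\<bar>\<close> is at most
    2, so \<open>C * m\<close> bounds its p-th power.\<close>
  define C where "C = 2 powr p / m"
  have C: "0 < C" using m by (simp add: C_def)
  have unit: "\<bar>a - b\<bar> powr p + C * \<bar>(a + b) / 2\<bar> powr p \<le> (\<epsilon> + C / 2) * (\<bar>a\<bar> powr p + \<bar>b\<bar> powr p)"
    if ab: "max \<bar>a\<bar> \<bar>b\<bar> = 1" for a b
  proof -
    let ?s = "\<bar>a\<bar> powr p + \<bar>b\<bar> powr p"
    have s: "1 \<le> ?s" using ab by (auto simp: max_def split: if_splits)
    have "\<bar>a - b\<bar> powr p \<le> \<epsilon> * ?s + C * \<phi> (a, b)"
    proof (cases "\<epsilon> \<le> \<bar>a - b\<bar> powr p")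
      case True
      then have "m \<le> \<phi> (a, b)" using ab by (intro m) (simp add: T_def)
      have "\<bar>a - b\<bar> powr p \<le> 2 powr p" using ab p by (intro powr_mono2) (auto simp: max_def split: if_splits)
      also have "\<dots> = C * m" using m by (simp add: C_def)
      also have "\<dots> \<le> C * \<phi> (a, b)" using \<open>m \<le> \<phi> (a, b)\<close> C by simp
      also have "\<dots> \<le> \<epsilon> * ?s + C * \<phi> (a, b)" using \<epsilon> s by simp
      finally show ?thesis .
    next
      case False
      have "\<bar>a - b\<bar> powr p \<le> \<epsilon> * 1" using False by simp
      also have "\<dots> \<le> \<epsilon> * ?s" using \<epsilon> s by (intro mult_left_mono) auto
      also have "\<dots> \<le> \<epsilon> * ?s + C * \<phi> (a, b)" using C \<phi>_nonneg[of "(a, b)"] by simp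
      finally show ?thesis .
    qed
    then show ?thesis by (simp add: \<phi>_def algebra_simps add_divide_distrib)
  qed
  show ?thesis
  proof (rule that[OF C])
    fix a b :: real
    let ?s = "max \<bar>a\<bar> \<bar>b\<bar>"
    show "\<bar>a - b\<bar> powr p + C * \<bar>(a + b) / 2\<bar> powr p \<le> (\<epsilon> + C / 2) * (\<bar>a\<bar> powr p + \<bar>b\<bar> powr p)"
    proof (cases "?s = 0")
      case True
      then have "a = 0" "b = 0" by (auto simp: max_def split: if_splits)
      then show ?thesis by simp
    next
      case False
      define s where "s = ?s"
      have s: "0 < s" using False by (auto simp: s_def max_def split: if_splits)
      have "max \<bar>a / s\<bar> \<bar>b / s\<bar> = 1"
        using s by (auto simp: s_def abs_divide max_def split: if_splits)
      from unit[OF this] have ineq: "s powr p * (\<bar>a / s - b / s\<bar> powr p + C * \<bar>(a / s + b / s) / 2\<bar> powr p)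
          \<le> s powr p * ((\<epsilon> + C / 2) * (\<bar>a / s\<bar> powr p + \<bar>b / s\<bar> powr p))"
        by (intro mult_left_mono) auto
      have scale: "s powr p * \<bar>x / s\<bar> powr p = \<bar>x\<bar> powr p" for x
        using s by (simp add: powr_mult[symmetric] abs_divide)
      have "s powr p * (\<bar>a / s - b / s\<bar> powr p + C * \<bar>(a / s + b / s) / 2\<bar> powr p)
          = s powr p * \<bar>(a - b) / s\<bar> powr p + C * (s powr p * \<bar>((a + b) / 2) / s\<bar> powr p)"
        by (simp add: algebra_simps add_divide_distrib diff_divide_distrib)
      also have "\<dots> = \<bar>a - b\<bar> powr p + C * \<bar>(a + b) / 2\<bar> powr p" unfolding scale ..
      finally have lhs: "s powr p * (\<bar>a / s - b / s\<bar> powr p + C * \<bar>(a / s + b / s) / 2\<bar> powr p)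
          = \<bar>a - b\<bar> powr p + C * \<bar>(a + b) / 2\<bar> powr p" .
      have "s powr p * ((\<epsilon> + C / 2) * (\<bar>a / s\<bar> powr p + \<bar>b / s\<bar> powr p))
          = (\<epsilon> + C / 2) * (s powr p * \<bar>a / s\<bar> powr p + s powr p * \<bar>b / s\<bar> powr p)"
        by (simp add: algebra_simps)
      also have "\<dots> = (\<epsilon> + C / 2) * (\<bar>a\<bar> powr p + \<bar>b\<bar> powr p)" unfolding scale ..
      finally show ?thesis using ineq unfolding lhs by (simp only:)
    qed
  qed
qed

section \<open>Rapidly converging sequences\<close>

lemma geometric_limit:
  fixes a :: "nat \<Rightarrow> real"
  assumes le: "\<And>j. \<bar>a (Suc j) - a j\<bar> \<le> (1/2) ^ j * R"
  obtains L where "a \<longlonglongrightarrow> L" "\<And>j. \<bar>a j - L\<bar> \<le> 2 * (1/2) ^ j * R"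
proof -
  \<comment> \<open>The factor \<open>1 - (1/2) ^ k\<close> is what lets the induction
    close.\<close>
  have part: "\<bar>a (j + k) - a j\<bar> \<le> 2 * (1/2) ^ j * R * (1 - (1/2) ^ k)" for j k
  proof (induction k)
    case (Suc k)
    have "\<bar>a (j + Suc k) - a j\<bar> \<le> \<bar>a (Suc (j + k)) - a (j + k)\<bar> + \<bar>a (j + k) - a j\<bar>" by simp
    also have "\<dots> \<le> (1/2) ^ (j + k) * R + 2 * (1/2) ^ j * R * (1 - (1/2) ^ k)"
      by (intro add_mono le Suc)
    also have "\<dots> = 2 * (1/2) ^ j * R * (1 - (1/2) ^ Suc k)" by (simp add: algebra_simps power_add)
    finally show ?case .
  qed simp
  have R: "0 \<le> R" using order_trans[OF abs_ge_zero le[of 0]] by simp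
  have bound: "\<bar>a (j + k) - a j\<bar> \<le> 2 * (1/2) ^ j * R" for j k
  proof -
    have "2 * (1/2) ^ j * R * (1 - (1/2) ^ k) \<le> 2 * (1/2) ^ j * R"
      using R by (intro mult_right_le_one_le) (auto simp: power_le_one)
    then show ?thesis using part[of j k] by linarith
  qed
  have lim0: "(\<lambda>j. 2 * (1/2) ^ j * R) \<longlonglongrightarrow> 2 * 0 * R"
    by (intro tendsto_intros LIMSEQ_power_zero) simp
  have "Cauchy a"
  proof (rule metric_CauchyI)
    fix e :: real assume e: "0 < e"
    obtain N where N: "2 * (1/2) ^ N * R < e / 2"
      using order_tendstoD(2)[OF lim0, of "e / 2"] e by (auto simp: eventually_sequentially)
    show "\<exists>M. \<forall>m\<ge>M. \<forall>n\<ge>M. dist (a m) (a n) < e"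
    proof (intro exI allI impI)
      fix m n assume "N \<le> m" "N \<le> n"
      then have "\<bar>a m - a N\<bar> < e / 2" "\<bar>a n - a N\<bar> < e / 2"
        using bound[of N "m - N"] bound[of N "n - N"] N by auto
      then show "dist (a m) (a n) < e" unfolding dist_real_def by linarith
    qed
  qed
  then obtain L where L: "a \<longlonglongrightarrow> L" using Cauchy_convergent convergent_def by blast
  show ?thesis
  proof (rule that[OF L])
    fix j
    have "(\<lambda>k. \<bar>a (k + j) - a j\<bar>) \<longlonglongrightarrow> \<bar>L - a j\<bar>"
      by (intro tendsto_intros LIMSEQ_ignore_initial_segment L)
    moreover have "\<bar>a (k + j) - a j\<bar> \<le> 2 * (1/2) ^ j * R" for k using bound[of j k] by (simp add: add.commute)
    ultimately have "\<bar>L - a j\<bar> \<le> 2 * (1/2) ^ j * R" by (intro LIMSEQ_le_const2) blast+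
    then show "\<bar>a j - L\<bar> \<le> 2 * (1/2) ^ j * R" by (simp add: abs_minus_commute)
  qed
qed

context sobolev_setting
begin

definition pint :: "('a \<Rightarrow> real) \<Rightarrow> ennreal" where
  "pint a = (\<integral>\<^sup>+ x. ennreal (\<bar>a x\<bar> powr p) \<partial>M)"

lemma pint_epow: "pint a = Lp_int (\<lambda>x. ennreal \<bar>a x\<bar>)"
  by (simp add: pint_def epow_ennreal)

lemma pint_uniformly_convex:
  assumes "0 < \<epsilon>"
  obtains C where "0 < C" "\<And>a b. a \<in> borel_measurable M \<Longrightarrow> b \<in> borel_measurable M \<Longrightarrow>
    pint (\<lambda>x. a x - b x) + ennreal C * pint (\<lambda>x. (a x + b x) / 2) \<le> ennreal (\<epsilon> + C / 2) * (pint a + pint b)"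
proof -
  obtain C where C: "0 < C" and le: "\<And>a b. \<bar>a - b\<bar> powr p + C * \<bar>(a + b) / 2\<bar> powr p
    \<le> (\<epsilon> + C / 2) * (\<bar>a\<bar> powr p + \<bar>b\<bar> powr p)"
    using abs_powr_uniformly_convex[OF p_gt_1 assms] by blast
  show ?thesis
  proof (rule that[OF C])
    fix a b :: "'a \<Rightarrow> real"
    assume [measurable]: "a \<in> borel_measurable M" "b \<in> borel_measurable M"
    have "pint (\<lambda>x. a x - b x) + ennreal C * pint (\<lambda>x. (a x + b x) / 2)
        = (\<integral>\<^sup>+ x. ennreal (\<bar>a x - b x\<bar> powr p) + ennreal C * ennreal (\<bar>(a x + b x) / 2\<bar> powr p) \<partial>M)"
      unfolding pint_def by (subst nn_integral_add) (simp_all add: nn_integral_cmult)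
    also have "\<dots> \<le> (\<integral>\<^sup>+ x. ennreal (\<epsilon> + C / 2) * (ennreal (\<bar>a x\<bar> powr p) + ennreal (\<bar>b x\<bar> powr p)) \<partial>M)"
    proof (rule nn_integral_mono)
      fix x
      have "ennreal (\<bar>a x - b x\<bar> powr p) + ennreal C * ennreal (\<bar>(a x + b x) / 2\<bar> powr p)
          = ennreal (\<bar>a x - b x\<bar> powr p + C * \<bar>(a x + b x) / 2\<bar> powr p)"
        using C by (simp add: ennreal_mult)
      also have "\<dots> \<le> ennreal ((\<epsilon> + C / 2) * (\<bar>a x\<bar> powr p + \<bar>b x\<bar> powr p))"
        by (intro ennreal_leI le)
      also have "\<dots> = ennreal (\<epsilon> + C / 2) * (ennreal (\<bar>a x\<bar> powr p) + ennreal (\<bar>b x\<bar> powr p))"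
        using C assms by (simp add: ennreal_mult)
      finally show "ennreal (\<bar>a x - b x\<bar> powr p) + ennreal C * ennreal (\<bar>(a x + b x) / 2\<bar> powr p)
        \<le> ennreal (\<epsilon> + C / 2) * (ennreal (\<bar>a x\<bar> powr p) + ennreal (\<bar>b x\<bar> powr p))" .
    qed
    also have "\<dots> = ennreal (\<epsilon> + C / 2) * (pint a + pint b)"
      unfolding pint_def by (simp add: nn_integral_cmult nn_integral_add)
    finally show "pint (\<lambda>x. a x - b x) + ennreal C * pint (\<lambda>x. (a x + b x) / 2)
      \<le> ennreal (\<epsilon> + C / 2) * (pint a + pint b)" .
  qed
qed

text \<open>The quantitative use of uniform convexity: two nearly minimal p-integrals whose midpoint
  is not much better force closeness. Inserting the bounds leaves
  \<open>2 * \<epsilon> * (\<alpha> + \<delta>) + 2 * C * \<delta>\<close>, and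
  \<open>\<epsilon>\<close> and then \<open>\<delta>\<close> are chosen so that each summand is at
  most \<open>\<eta> / 2\<close>.\<close>

lemma pint_Cauchy:
  assumes a: "\<And>n. a n \<in> borel_measurable M" and "0 \<le> \<alpha>" and "0 < \<eta>"
  obtains \<delta> where "0 < \<delta>" "\<And>n m. pint (a n) \<le> ennreal (\<alpha> + \<delta>) \<Longrightarrow> pint (a m) \<le> ennreal (\<alpha> + \<delta>) \<Longrightarrow>
    ennreal (\<alpha> - \<delta>) \<le> pint (\<lambda>x. (a n x + a m x) / 2) \<Longrightarrow> pint (\<lambda>x. a n x - a m x) \<le> ennreal \<eta>"
proof -
  define \<epsilon> where "\<epsilon> = \<eta> / (4 * (\<alpha> + 1))"
  have \<epsilon>: "0 < \<epsilon>" "2 * \<epsilon> * (\<alpha> + 1) = \<eta> / 2"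
    using assms by (auto simp: \<epsilon>_def field_simps)
  obtain C where C: "0 < C" and uc: "\<And>a b. a \<in> borel_measurable M \<Longrightarrow> b \<in> borel_measurable M \<Longrightarrow>
    pint (\<lambda>x. a x - b x) + ennreal C * pint (\<lambda>x. (a x + b x) / 2) \<le> ennreal (\<epsilon> + C / 2) * (pint a + pint b)"
    using pint_uniformly_convex[OF \<epsilon>(1)] by blast
  define \<delta> where "\<delta> = min 1 (\<eta> / (4 * C))"
  have \<delta>: "0 < \<delta>" "\<delta> \<le> 1" "2 * C * \<delta> \<le> \<eta> / 2"
  proof -
    show "0 < \<delta>" "\<delta> \<le> 1" using assms C by (auto simp: \<delta>_def)
    have "2 * C * \<delta> \<le> 2 * C * (\<eta> / (4 * C))" using C by (intro mult_left_mono) (auto simp: \<delta>_def)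
    then show "2 * C * \<delta> \<le> \<eta> / 2" using C by simp
  qed
  show ?thesis
  proof (rule that[OF \<delta>(1)])
    fix n m
    assume n: "pint (a n) \<le> ennreal (\<alpha> + \<delta>)" and m: "pint (a m) \<le> ennreal (\<alpha> + \<delta>)"
      and mid: "ennreal (\<alpha> - \<delta>) \<le> pint (\<lambda>x. (a n x + a m x) / 2)"
    let ?d = "pint (\<lambda>x. a n x - a m x)"
    have "?d + ennreal C * ennreal (\<alpha> - \<delta>) \<le> ?d + ennreal C * pint (\<lambda>x. (a n x + a m x) / 2)"
      using mid by (intro add_left_mono mult_left_mono) auto
    also have "\<dots> \<le> ennreal (\<epsilon> + C / 2) * (pint (a n) + pint (a m))" by (intro uc a)
    also have "\<dots> \<le> ennreal (\<epsilon> + C / 2) * (ennreal (\<alpha> + \<delta>) + ennreal (\<alpha> + \<delta>))"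
      by (intro mult_left_mono add_mono n m) simp
    also have "\<dots> = ennreal ((\<epsilon> + C / 2) * (2 * (\<alpha> + \<delta>)))"
      using assms \<delta> \<epsilon> C by (simp add: ennreal_mult ennreal_plus[symmetric] del: ennreal_plus)
    finally have le: "?d + ennreal C * ennreal (\<alpha> - \<delta>) \<le> ennreal ((\<epsilon> + C / 2) * (2 * (\<alpha> + \<delta>)))" .
    then have "?d \<noteq> top" by (auto simp: top_unique)
    then obtain d where d: "?d = ennreal d" "0 \<le> d" by (cases ?d) auto
    \<comment> \<open>\<open>ennreal\<close> cuts the lower bound off at 0 when
      \<open>\<delta>\<close> exceeds \<open>\<alpha>\<close>, hence the maximum.\<close>
    have "ennreal d + ennreal (C * max 0 (\<alpha> - \<delta>)) \<le> ennreal ((\<epsilon> + C / 2) * (2 * (\<alpha> + \<delta>)))"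
    proof -
      have "ennreal C * ennreal (\<alpha> - \<delta>) = ennreal (C * max 0 (\<alpha> - \<delta>))"
        using C by (cases "\<delta> \<le> \<alpha>") (simp_all add: ennreal_mult ennreal_neg)
      then show ?thesis using le unfolding d(1) by (simp only:)
    qed
    then have "d + C * max 0 (\<alpha> - \<delta>) \<le> (\<epsilon> + C / 2) * (2 * (\<alpha> + \<delta>))"
    proof -
      have "ennreal (d + C * max 0 (\<alpha> - \<delta>)) = ennreal d + ennreal (C * max 0 (\<alpha> - \<delta>))"
        by (rule ennreal_plus) (use d C in simp_all)
      also have "\<dots> \<le> ennreal ((\<epsilon> + C / 2) * (2 * (\<alpha> + \<delta>)))" by fact
      finally show ?thesis
        by (rule ennreal_le_iff[THEN iffD1, rotated]) (use C assms \<delta>(1) \<epsilon>(1) in simp)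
    qed
    moreover have "C * (\<alpha> - \<delta>) \<le> C * max 0 (\<alpha> - \<delta>)" using C by (intro mult_left_mono) auto
    ultimately have "d \<le> 2 * \<epsilon> * (\<alpha> + \<delta>) + 2 * C * \<delta>" by (simp add: algebra_simps)
    also have "2 * \<epsilon> * (\<alpha> + \<delta>) \<le> 2 * \<epsilon> * (\<alpha> + 1)" using \<epsilon> \<delta> by simp
    finally have "d \<le> \<eta>" using \<epsilon>(2) \<delta>(3) by linarith
    then show "?d \<le> ennreal \<eta>" unfolding d(1) by (rule ennreal_leI)
  qed
qed

text \<open>The differences scaled by \<open>2 ^ j\<close> still have summable p-integrals, so a
  Borel majorant of their supremum is p-integrable; the resulting bound holds at every point, as
  line integrals require.\<close>

lemma fast_Cauchy_dominated:
  fixes a :: "nat \<Rightarrow> 'a \<Rightarrow> real"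
  assumes a: "\<And>n. a n \<in> borel_measurable M"
    and fast: "\<And>j. pint (\<lambda>x. a (Suc j) x - a j x) \<le> ennreal ((1/2) ^ j / (2 ^ j) powr p)"
  obtains \<rho> where "\<rho> \<in> borel_measurable borel" "Lp_int \<rho> < \<infinity>"
    "\<And>j x. ennreal \<bar>a (Suc j) x - a j x\<bar> \<le> ennreal ((1/2) ^ j) * \<rho> x"
proof -
  note [measurable] = a
  define r where "r j x = ennreal (2 ^ j * \<bar>a (Suc j) x - a j x\<bar>)" for j x
  have fin: "Lp_int (\<lambda>x. SUP j. r j x) < \<infinity>"
  proof (rule SUP_Lp)
    show "r j \<in> borel_measurable M" for j unfolding r_def by measurable
    show "summable (\<lambda>j. (1/2::real) ^ j)" by (rule summable_geometric) simp
    fix j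
    have "Lp_int (r j) = (\<integral>\<^sup>+ x. ennreal ((2 ^ j) powr p) * ennreal (\<bar>a (Suc j) x - a j x\<bar> powr p) \<partial>M)"
    proof (rule nn_integral_cong)
      fix x
      show "epow (r j x) p = ennreal ((2 ^ j) powr p) * ennreal (\<bar>a (Suc j) x - a j x\<bar> powr p)"
        unfolding r_def by (subst epow_ennreal) (simp_all add: powr_mult ennreal_mult)
    qed
    also have "\<dots> = ennreal ((2 ^ j) powr p) * pint (\<lambda>x. a (Suc j) x - a j x)"
      unfolding pint_def by (rule nn_integral_cmult) measurable
    also have "\<dots> \<le> ennreal ((2 ^ j) powr p) * ennreal ((1/2) ^ j / (2 ^ j) powr p)"
      by (intro mult_left_mono fast) simp
    also have "\<dots> = ennreal ((1/2) ^ j)" by (simp add: ennreal_mult[symmetric])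
    finally show "Lp_int (r j) \<le> ennreal ((1/2) ^ j)" .
  qed simp
  have "(\<lambda>x. SUP j. r j x) \<in> borel_measurable M" unfolding r_def by measurable
  then obtain \<rho> where \<rho>: "\<rho> \<in> borel_measurable borel" "\<And>x. (SUP j. r j x) \<le> \<rho> x" "AE x in M. \<rho> x = (SUP j. r j x)"
    by (rule borel_majorant) (rule that)
  show ?thesis
  proof (rule that[OF \<rho>(1)])
    have "Lp_int \<rho> = Lp_int (\<lambda>x. SUP j. r j x)"
      by (rule nn_integral_cong_AE, use \<rho>(3) in eventually_elim) simp
    then show "Lp_int \<rho> < \<infinity>" using fin by simp
    fix j x
    have "r j x \<le> \<rho> x" by (rule order_trans[OF SUP_upper \<rho>(2)]) simp
    then have "ennreal ((1/2) ^ j) * r j x \<le> ennreal ((1/2) ^ j) * \<rho> x" by (intro mult_left_mono) auto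
    moreover have "ennreal ((1/2) ^ j) * r j x = ennreal \<bar>a (Suc j) x - a j x\<bar>"
      unfolding r_def by (simp add: ennreal_mult[symmetric] mult.assoc[symmetric] power_mult_distrib[symmetric])
    ultimately show "ennreal \<bar>a (Suc j) x - a j x\<bar> \<le> ennreal ((1/2) ^ j) * \<rho> x" by simp
  qed
qed

lemma dominated_limit:
  fixes a :: "nat \<Rightarrow> real"
  assumes "\<And>j. ennreal \<bar>a (Suc j) - a j\<bar> \<le> ennreal ((1/2) ^ j) * R" "R < \<infinity>"
  obtains L where "a \<longlonglongrightarrow> L" "\<And>j. \<bar>a j - L\<bar> \<le> 2 * (1/2) ^ j * enn2real R"
proof -
  have "\<bar>a (Suc j) - a j\<bar> \<le> (1/2) ^ j * enn2real R" for j
  proof -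
    obtain r where r: "R = ennreal r" "0 \<le> r" using assms(2) by (cases R) auto
    have "ennreal \<bar>a (Suc j) - a j\<bar> \<le> ennreal ((1/2) ^ j * r)"
      using assms(1)[of j] r by (simp add: ennreal_mult)
    then show ?thesis using r by (subst (asm) ennreal_le_iff) auto
  qed
  from geometric_limit[OF this] show ?thesis using that by blast
qed


section \<open>The obstacle class in terms of real functions\<close>

lemma wug_add_le:
  assumes u: "wug S u g" and v: "wug S v h" and le: "\<And>x y. \<bar>w x - w y\<bar> \<le> \<bar>u x - u y\<bar> + \<bar>v x - v y\<bar>"
  shows "wug S w (\<lambda>x. g x + h x)"
proof (rule wug_combine[OF u v])
  note [measurable] = wug_borel[OF u] wug_borel[OF v]
  show "(\<lambda>x. g x + h x) \<in> borel_measurable borel" by measurable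
  fix l \<gamma> a b
  assume c: "(l, \<gamma>) \<in> curves S" "0 \<le> a" "a \<le> b" "b \<le> l"
    and *: "ennreal \<bar>u (\<gamma> a) - u (\<gamma> b)\<bar> \<le> segment_integral g \<gamma> a b"
      "ennreal \<bar>v (\<gamma> a) - v (\<gamma> b)\<bar> \<le> segment_integral h \<gamma> a b"
  have "ennreal \<bar>w (\<gamma> a) - w (\<gamma> b)\<bar> \<le> ennreal (\<bar>u (\<gamma> a) - u (\<gamma> b)\<bar> + \<bar>v (\<gamma> a) - v (\<gamma> b)\<bar>)"
    by (rule ennreal_leI[OF le])
  also have "\<dots> = ennreal \<bar>u (\<gamma> a) - u (\<gamma> b)\<bar> + ennreal \<bar>v (\<gamma> a) - v (\<gamma> b)\<bar>"
    by (rule ennreal_plus) (rule abs_ge_zero)+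
  also have "\<dots> \<le> segment_integral g \<gamma> a b + segment_integral h \<gamma> a b" by (intro add_mono *)
  finally show "ennreal \<bar>w (\<gamma> a) - w (\<gamma> b)\<bar> \<le> segment_integral (\<lambda>x. g x + h x) \<gamma> a b"
    using segment_integral_add[OF c(1) wug_borel[OF u] wug_borel[OF v] c(2,4)] by simp
qed

lemma wug_finite:
  assumes "wug S u g" "Lp_int g < \<infinity>"
  shows "finite_on T g"
  by (rule aec_finite[OF wug_borel[OF assms(1)] assms(2)])

text \<open>A density with finite p-integral is finite almost everywhere; real values are needed
  because the convexity estimate subtracts gradients.\<close>

lemma wug_real_density:
  assumes w: "wug S u g" and fin: "Lp_int g < \<infinity>"
  obtains \<gamma> where "\<gamma> \<in> borel_measurable borel" "\<And>x. 0 \<le> \<gamma> x" "wug S u (\<lambda>x. ennreal (\<gamma> x))"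
    "pint \<gamma> = Lp_int g" "AE x in M. ennreal (\<gamma> x) = g x"
proof -
  note [measurable] = wug_borel[OF w] wug_borel_M[OF w]
  have "AE x in M. epow (g x) p \<noteq> \<infinity>" using fin by (intro nn_integral_noteq_infinite) auto
  then have AE: "AE x in M. ennreal (enn2real (g x)) = g x"
    by eventually_elim (metis ennreal_enn2real epow_top(2) infinity_ennreal_def less_top)
  show ?thesis
  proof (rule that[of "\<lambda>x. enn2real (g x)"])
    show "wug S u (\<lambda>x. ennreal (enn2real (g x)))"
      by (rule wug_AE_mono[OF w]) (use AE in \<open>auto elim!: eventually_mono\<close>)
    show "pint (\<lambda>x. enn2real (g x)) = Lp_int g"
      unfolding pint_epow by (rule nn_integral_cong_AE, use AE in eventually_elim) simp
    show "AE x in M. ennreal (enn2real (g x)) = g x" by (rule AE)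
  qed simp_all
qed

text \<open>A change on an exceptional set goes unnoticed by almost every curve, so both functions
  have the same weak upper gradients. The predicates from which \<open>min_grad\<close> chooses then
  coincide, and it picks literally the same function.\<close>

lemma energy_cong:
  assumes S: "S \<in> sets M" and exc: "exceptional {x \<in> S. u x \<noteq> v x}"
  shows "energy p (restrict_space M S) u = energy p (restrict_space M S) v"
proof -
  have one: "weak_upper_gradient p (restrict_space M S) v g"
    if w: "weak_upper_gradient p (restrict_space M S) u g" and exc: "exceptional {x \<in> S. u x \<noteq> v x}" for u v g
  proof -
    have "aec S (\<lambda>l \<gamma>. measurable_along g (l, \<gamma>) \<and> endpoint_gap u (l, \<gamma>) \<le> curve_integral g (l, \<gamma>))"
      using w by (simp add: weak_upper_gradient_def ae_curve_iff_aec[OF S])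
    from aec_conj[OF this exceptional_aec[OF exc, of S]]
    have "aec S (\<lambda>l \<gamma>. measurable_along g (l, \<gamma>) \<and> endpoint_gap v (l, \<gamma>) \<le> curve_integral g (l, \<gamma>))"
    proof (rule aec_mono, elim conjE)
      fix l \<gamma>
      assume c: "(l, \<gamma>) \<in> curves S" and *: "measurable_along g (l, \<gamma>)" "endpoint_gap u (l, \<gamma>) \<le> curve_integral g (l, \<gamma>)"
        and eq: "\<forall>t\<in>{0..l}. \<gamma> t \<notin> {x \<in> S. u x \<noteq> v x}"
      have "u (\<gamma> t) = v (\<gamma> t)" if "t \<in> {0..l}" for t
        using eq that c by (auto simp: curves_iff image_subset_iff)
      moreover have "0 < l" using c by (simp add: curves_iff)
      ultimately have "u (\<gamma> 0) = v (\<gamma> 0)" "u (\<gamma> l) = v (\<gamma> l)" by simp_all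
      then have "endpoint_gap v (l, \<gamma>) = endpoint_gap u (l, \<gamma>)" by (simp add: endpoint_gap_def)
      with * show "measurable_along g (l, \<gamma>) \<and> endpoint_gap v (l, \<gamma>) \<le> curve_integral g (l, \<gamma>)" by simp
    qed
    then show ?thesis
      using w by (simp add: weak_upper_gradient_def ae_curve_iff_aec[OF S])
  qed
  have "{x \<in> S. v x \<noteq> u x} = {x \<in> S. u x \<noteq> v x}" by auto
  then have "weak_upper_gradient p (restrict_space M S) u = weak_upper_gradient p (restrict_space M S) v"
    using one[of u _ v] one[of v _ u] exc by (intro ext iffI) simp_all
  then show ?thesis
    by (simp add: energy_def min_grad_def is_minimal_weak_upper_gradient_def[abs_def])
qed

end

locale obstacle_setting = sobolev_setting M p
  for M :: "'a::metric_space measure" and p :: real +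
  fixes E :: "'a set" and f \<psi>\<^sub>1 \<psi>\<^sub>2 :: "'a \<Rightarrow> ereal"
  assumes E: "E \<in> sets M" and f_Dp: "f \<in> Dp p (restrict_space M E)"
begin

text \<open>\<open>real_of_ereal\<close> turns infinite values of \<open>f\<close> into 0; almost
  every curve in \<open>E\<close> avoids those points, so along curves nothing is lost.\<close>

definition F :: "'a \<Rightarrow> real" where "F x = (if x \<in> E then real_of_ereal (f x) else 0)"

definition shift :: "('a \<Rightarrow> real) \<Rightarrow> 'a \<Rightarrow> ereal" where "shift h x = f x + ereal (h x)"

definition shift_energy :: "('a \<Rightarrow> real) \<Rightarrow> ennreal" where
  "shift_energy h = energy p (restrict_space M E) (shift h)"

text \<open>
  Up to exceptional sets, the functions in the obstacle class are \<open>shift h\<close> for admissible \<open>h\<close>.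
  The function \<open>h\<close> has to vanish q.e. where \<open>f\<close> is infinite, since there the difference \<^const>\<open>fun_diff\<close> of
  \<open>shift h\<close> and \<open>f\<close> is \<open>0\<close>.
\<close>

definition admissible :: "('a \<Rightarrow> real) \<Rightarrow> bool" where
  "admissible h \<longleftrightarrow> h \<in> borel_measurable M \<and> pint h < \<infinity> \<and>
     (\<exists>g. wug UNIV h g \<and> Lp_int g < \<infinity>) \<and> (\<forall>x. x \<notin> E \<longrightarrow> h x = 0) \<and>
     exceptional {x \<in> E. \<bar>f x\<bar> = \<infinity> \<and> h x \<noteq> 0} \<and>
     exceptional {x \<in> E. \<not> (\<psi>\<^sub>1 x \<le> shift h x \<and> shift h x \<le> \<psi>\<^sub>2 x)}"

section \<open>The function \<open>f\<close> and its shifts along curves in \<open>E\<close>\<close>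

lemma f_measurable: "f \<in> borel_measurable (restrict_space M E)"
  using f_Dp by (simp add: Dp_def)

lemma F_measurable: "F \<in> borel_measurable M"
proof -
  have "(\<lambda>x. f x * indicator E x) \<in> borel_measurable M"
    using f_measurable E by (simp add: borel_measurable_restrict_space_iff_ereal)
  then have "(\<lambda>x. real_of_ereal (f x * indicator E x)) \<in> borel_measurable M" by measurable
  moreover have "(\<lambda>x. real_of_ereal (f x * indicator E x)) = F" by (auto simp: F_def split: split_indicator)
  ultimately show ?thesis by simp
qed

lemma f_gradient: "\<exists>g. wug E F g \<and> Lp_int g < \<infinity>"
  and f_finite: "finite_along E f"
proof -
  obtain g where g: "upper_gradient (restrict_space M E) f g" "Lp_fun p (restrict_space M E) g"
    using f_Dp by (auto simp: Dp_def)
  have w: "weak_upper_gradient p (restrict_space M E) f g" by (rule weak_of_upper_gradient[OF E g(1)])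
  have Lp: "g \<in> borel_measurable (restrict_space M E)" "(\<integral>\<^sup>+ x. epow (g x) p * indicator E x \<partial>M) < \<infinity>"
    using g(2) by (simp_all add: Lp_fun_def nn_integral_restrict_M[OF E])
  have loc: "Lp_loc p (restrict_space M E) g" by (rule Lp_imp_Lp_loc[OF E Lp])
  show fin: "finite_along E f" by (rule min_grad_minimal(2)[OF E w loc])
  obtain g' where g': "g' \<in> borel_measurable borel" "AE x in M. g' x = g x * indicator E x"
    "aec E (\<lambda>l \<gamma>. endpoint_gap f (l, \<gamma>) \<le> segment_integral g' \<gamma> 0 l)"
    using weak_to_borel[OF E w] .
  have "Lp_int g' = (\<integral>\<^sup>+ x. epow (g x) p * indicator E x \<partial>M)"
    by (rule nn_integral_cong_AE, use g'(2) in eventually_elim) (simp split: split_indicator)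
  then have Lp': "Lp_int g' < \<infinity>" using Lp(2) by simp
  have "wug E (\<lambda>x. real_of_ereal (f x)) g'" by (rule wug_of_gap[OF g'(1) fin g'(3)])
  then have "wug E F g'"
    by (rule wug_cong, intro aec_trivial) (auto simp: F_def curves_iff image_subset_iff)
  then show "\<exists>g. wug E F g \<and> Lp_int g < \<infinity>" using Lp' by blast
qed

lemma aec_f_finite: "aec E (\<lambda>l \<gamma>. \<forall>t\<in>{0..l}. \<bar>f (\<gamma> t)\<bar> \<noteq> \<infinity>)"
  using f_finite unfolding finite_along_def .

lemma shift_finite: "finite_along E (shift h)"
  unfolding finite_along_def
proof (rule aec_mono[OF aec_f_finite], intro ballI)
  fix l t :: real and \<gamma> :: "real \<Rightarrow> 'a"
  assume "\<forall>t\<in>{0..l}. \<bar>f (\<gamma> t)\<bar> \<noteq> \<infinity>" "t \<in> {0..l}"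
  then have "\<bar>f (\<gamma> t)\<bar> \<noteq> \<infinity>" by simp
  then show "\<bar>shift h (\<gamma> t)\<bar> \<noteq> \<infinity>" by (cases "f (\<gamma> t)") (simp_all add: shift_def)
qed

lemma aec_shift_real: "aec E (\<lambda>l \<gamma>. \<forall>t\<in>{0..l}. real_of_ereal (shift h (\<gamma> t)) = F (\<gamma> t) + h (\<gamma> t))"
proof (rule aec_mono[OF aec_f_finite], intro ballI)
  fix l \<gamma> t
  assume c: "(l, \<gamma>) \<in> curves E" and "\<forall>t\<in>{0..l}. \<bar>f (\<gamma> t)\<bar> \<noteq> \<infinity>" and t: "t \<in> {0..l}"
  then have "\<bar>f (\<gamma> t)\<bar> \<noteq> \<infinity>" by simp
  moreover have "\<gamma> t \<in> E" using c t by (auto simp: curves_iff image_subset_iff)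
  ultimately show "real_of_ereal (shift h (\<gamma> t)) = F (\<gamma> t) + h (\<gamma> t)"
    by (cases "f (\<gamma> t)") (simp_all add: shift_def F_def)
qed

lemma wug_shift_iff: "wug E (\<lambda>x. real_of_ereal (shift h x)) g \<longleftrightarrow> wug E (\<lambda>x. F x + h x) g"
proof
  assume "wug E (\<lambda>x. real_of_ereal (shift h x)) g"
  then show "wug E (\<lambda>x. F x + h x) g" by (rule wug_cong) (rule aec_shift_real)
next
  assume "wug E (\<lambda>x. F x + h x) g"
  then show "wug E (\<lambda>x. real_of_ereal (shift h x)) g"
    by (rule wug_cong) (rule aec_mono[OF aec_shift_real[of h]], simp)
qed

lemma shift_energy_le:
  assumes "wug E (\<lambda>x. F x + h x) g"
  shows "shift_energy h \<le> Lp_int g"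
proof -
  have "shift_energy h \<le> (\<integral>\<^sup>+ x. epow (g x) p * indicator E x \<partial>M)"
    unfolding shift_energy_def using assms by (intro energy_le[OF E _ shift_finite]) (simp add: wug_shift_iff)
  also have "\<dots> \<le> Lp_int g"
    by (intro nn_integral_mono) (simp split: split_indicator)
  finally show ?thesis .
qed

lemma wug_shift_add:
  assumes "wug UNIV h g" "wug E F gf"
  shows "wug E (\<lambda>x. F x + h x) (\<lambda>x. gf x + g x)"
proof -
  have "wug E h g"
    using assms(1) aec_subset[of UNIV _ E] unfolding wug_def by blast
  then show ?thesis by (rule wug_add_le[OF assms(2)]) simp
qed

text \<open>The energy is realised by a real Borel density, the form on which the convexity
  estimates act.\<close>

lemma admissible_gradient:
  assumes h: "admissible h"
  shows "shift_energy h < \<infinity>"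
    and "\<exists>\<gamma>. \<gamma> \<in> borel_measurable borel \<and> (\<forall>x. 0 \<le> \<gamma> x) \<and> wug E (\<lambda>x. F x + h x) (\<lambda>x. ennreal (\<gamma> x)) \<and>
      pint \<gamma> = shift_energy h"
proof -
  obtain g where g: "wug UNIV h g" "Lp_int g < \<infinity>"
    using h by (auto simp: admissible_def)
  obtain gf where gf: "wug E F gf" "Lp_int gf < \<infinity>" using f_gradient by metis
  let ?g = "\<lambda>x. gf x + g x"
  have w: "wug E (\<lambda>x. F x + h x) ?g" by (rule wug_shift_add[OF g(1) gf(1)])
  have Lp: "Lp_int ?g < \<infinity>"
    by (rule Lp_add_finite[OF wug_borel_M[OF gf(1)] wug_borel_M[OF g(1)] gf(2) g(2)])
  then show fin: "shift_energy h < \<infinity>"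
    by (rule order.strict_trans1[OF shift_energy_le[OF w]])
  have weak: "weak_upper_gradient p (restrict_space M E) (shift h) ?g"
    using w by (intro weak_of_wug[OF E _ shift_finite]) (simp add: wug_shift_iff)
  have "(\<integral>\<^sup>+ x. epow (?g x) p * indicator E x \<partial>M) \<le> Lp_int ?g"
    by (intro nn_integral_mono) (simp split: split_indicator)
  then have "(\<integral>\<^sup>+ x. epow (?g x) p * indicator E x \<partial>M) < \<infinity>" using Lp by (rule order.strict_trans1)
  then have loc: "Lp_loc p (restrict_space M E) ?g"
    by (intro Lp_imp_Lp_loc[OF E] borel_restrict_M wug_borel[OF w])
  obtain k where k: "wug E (\<lambda>x. real_of_ereal (shift h x)) k"
    "Lp_int k = energy p (restrict_space M E) (shift h)"
    using energy_attained[OF E weak loc] by metis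
  have kfin: "Lp_int k < \<infinity>" using k(2) fin by (simp add: shift_energy_def)
  have k': "wug E (\<lambda>x. F x + h x) k" using k(1) by (simp only: wug_shift_iff)
  obtain \<gamma> where "\<gamma> \<in> borel_measurable borel" "\<And>x. 0 \<le> \<gamma> x" "wug E (\<lambda>x. F x + h x) (\<lambda>x. ennreal (\<gamma> x))"
    "pint \<gamma> = Lp_int k"
    using wug_real_density[OF k' kfin] by metis
  then show "\<exists>\<gamma>. \<gamma> \<in> borel_measurable borel \<and> (\<forall>x. 0 \<le> \<gamma> x) \<and> wug E (\<lambda>x. F x + h x) (\<lambda>x. ennreal (\<gamma> x)) \<and>
      pint \<gamma> = shift_energy h"
    using k(2) by (auto simp: shift_energy_def)
qed

text \<open>In \<open>E\<close> the function \<open>k\<close> is the difference of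
  \<open>F + k\<close> and \<open>F\<close>, which gives the density \<open>g + gf\<close> there;
  the majorant \<open>H\<close>, zero off \<open>E\<close>, carries it to all curves of the
  space.\<close>

lemma wug_zero_extension:
  assumes H: "wug UNIV H gH" "Lp_int gH < \<infinity>" and le: "\<And>x. \<bar>k x\<bar> \<le> H x"
    and H0: "\<And>x. x \<notin> E \<Longrightarrow> H x = 0" and k: "wug E (\<lambda>x. F x + k x) g" and gf: "wug E F gf"
  shows "wug UNIV k (\<lambda>x. g x + gf x)"
proof (rule wug_extend[OF H(1) wug_finite[OF H]])
  show kE: "wug E k (\<lambda>x. g x + gf x)"
    by (rule wug_add_le[OF k gf]) simp
  show "(\<lambda>x. g x + gf x) \<in> borel_measurable borel" by (rule wug_borel[OF kE])
  show "x \<in> E" if "0 < H x" for x using H0[of x] that by fastforce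
qed (simp_all add: le)

lemma wug_abs: "wug S u g \<Longrightarrow> wug S (\<lambda>x. \<bar>u x\<bar>) g"
proof (rule wug_combine[of S u g u g])
  fix \<gamma> :: "real \<Rightarrow> 'a" and a b
  assume "ennreal \<bar>u (\<gamma> a) - u (\<gamma> b)\<bar> \<le> segment_integral g \<gamma> a b"
  then show "ennreal \<bar>\<bar>u (\<gamma> a)\<bar> - \<bar>u (\<gamma> b)\<bar>\<bar> \<le> segment_integral g \<gamma> a b"
    by (rule order_trans[rotated]) (rule ennreal_leI, linarith)
qed (simp_all add: wug_borel)

lemma admissible_zero_extension:
  assumes h: "admissible h" and g: "wug E (\<lambda>x. F x + h x) g" and gf: "wug E F gf"
  shows "wug UNIV h (\<lambda>x. g x + gf x)"
proof -
  obtain gh where gh: "wug UNIV h gh" "Lp_int gh < \<infinity>"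
    using h by (auto simp: admissible_def)
  show ?thesis
    by (rule wug_zero_extension[OF wug_abs[OF gh(1)] gh(2) _ _ g gf]) (use h in \<open>auto simp: admissible_def\<close>)
qed

lemma pint_add_finite:
  assumes "a \<in> borel_measurable M" "b \<in> borel_measurable M" "pint a < \<infinity>" "pint b < \<infinity>"
    and le: "\<And>x. \<bar>c x\<bar> \<le> \<bar>a x\<bar> + \<bar>b x\<bar>"
  shows "pint c < \<infinity>"
proof -
  have "pint c \<le> Lp_int (\<lambda>x. ennreal \<bar>a x\<bar> + ennreal \<bar>b x\<bar>)"
    unfolding pint_epow
  proof (intro nn_integral_mono epow_mono p_pos)
    fix x
    have "ennreal \<bar>c x\<bar> \<le> ennreal (\<bar>a x\<bar> + \<bar>b x\<bar>)" by (rule ennreal_leI[OF le])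
    then show "ennreal \<bar>c x\<bar> \<le> ennreal \<bar>a x\<bar> + ennreal \<bar>b x\<bar>" by simp
  qed
  also have "\<dots> < \<infinity>"
    by (rule Lp_add_finite) (use assms(1-4) in \<open>simp_all add: pint_epow\<close>)
  finally show ?thesis .
qed

text \<open>Midpoints and truncations both lie between two admissible functions. Integrability,
  vanishing off \<open>E\<close> and the obstacle conditions are then inherited by squeezing, and
  only a gradient of \<open>F + k\<close> in \<open>E\<close> has to be supplied.\<close>

lemma admissible_between:
  assumes 1: "admissible h1" and 2: "admissible h2" and k: "k \<in> borel_measurable M"
    and between: "\<And>x. min (h1 x) (h2 x) \<le> k x" "\<And>x. k x \<le> max (h1 x) (h2 x)"
    and g: "wug E (\<lambda>x. F x + k x) g" "Lp_int g < \<infinity>"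
  shows "admissible k"
  unfolding admissible_def
proof (intro conjI k)
  have le: "\<bar>k x\<bar> \<le> \<bar>h1 x\<bar> + \<bar>h2 x\<bar>" for x
    using between[of x] by linarith
  have k0: "k x = 0" if "h1 x = 0" "h2 x = 0" for x
    using between[of x] that by simp
  show "pint k < \<infinity>"
    by (rule pint_add_finite[of h1 h2]) (use 1 2 le in \<open>auto simp: admissible_def\<close>)
  show "\<forall>x. x \<notin> E \<longrightarrow> k x = 0" using 1 2 k0 by (simp add: admissible_def)
  obtain g1 where g1: "wug UNIV h1 g1" "Lp_int g1 < \<infinity>" using 1 by (auto simp: admissible_def)
  obtain g2 where g2: "wug UNIV h2 g2" "Lp_int g2 < \<infinity>" using 2 by (auto simp: admissible_def)
  obtain gf where gf: "wug E F gf" "Lp_int gf < \<infinity>" using f_gradient by metis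
  have H: "wug UNIV (\<lambda>x. \<bar>h1 x\<bar> + \<bar>h2 x\<bar>) (\<lambda>x. g1 x + g2 x)"
    by (rule wug_add_le[OF g1(1) g2(1)]) linarith
  have "wug UNIV k (\<lambda>x. g x + gf x)"
  proof (rule wug_zero_extension[OF H _ le _ g(1) gf(1)])
    show "Lp_int (\<lambda>x. g1 x + g2 x) < \<infinity>"
      by (rule Lp_add_finite[OF wug_borel_M[OF g1(1)] wug_borel_M[OF g2(1)] g1(2) g2(2)])
    show "\<bar>h1 x\<bar> + \<bar>h2 x\<bar> = 0" if "x \<notin> E" for x using 1 2 that by (simp add: admissible_def)
  qed
  moreover have "Lp_int (\<lambda>x. g x + gf x) < \<infinity>"
    by (rule Lp_add_finite[OF wug_borel_M[OF g(1)] wug_borel_M[OF gf(1)] g(2) gf(2)])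
  ultimately show "\<exists>g. wug UNIV k g \<and> Lp_int g < \<infinity>" by blast
  have "exceptional ({x \<in> E. \<bar>f x\<bar> = \<infinity> \<and> h1 x \<noteq> 0} \<union> {x \<in> E. \<bar>f x\<bar> = \<infinity> \<and> h2 x \<noteq> 0})"
    by (rule exceptional_Un) (use 1 2 in \<open>simp_all add: admissible_def\<close>)
  then show "exceptional {x \<in> E. \<bar>f x\<bar> = \<infinity> \<and> k x \<noteq> 0}"
    by (rule exceptional_subset) (use k0 in blast)
  have "exceptional ({x \<in> E. \<not> (\<psi>\<^sub>1 x \<le> shift h1 x \<and> shift h1 x \<le> \<psi>\<^sub>2 x)}
      \<union> {x \<in> E. \<not> (\<psi>\<^sub>1 x \<le> shift h2 x \<and> shift h2 x \<le> \<psi>\<^sub>2 x)})"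
    by (rule exceptional_Un) (use 1 2 in \<open>simp_all add: admissible_def\<close>)
  then show "exceptional {x \<in> E. \<not> (\<psi>\<^sub>1 x \<le> shift k x \<and> shift k x \<le> \<psi>\<^sub>2 x)}"
  proof (rule exceptional_subset, intro subsetI)
    fix x assume x: "x \<in> {x \<in> E. \<not> (\<psi>\<^sub>1 x \<le> shift k x \<and> shift k x \<le> \<psi>\<^sub>2 x)}"
    \<comment> \<open>Addition of \<open>f x\<close> is monotone on \<open>ereal\<close> even at
      infinite values, so the squeezing also covers points where \<open>f\<close> is
      infinite.\<close>
    have mono: "shift a x \<le> shift b x" if "a x \<le> b x" for a b
      unfolding shift_def using that by (intro add_left_mono) simp
    have "shift h1 x \<le> shift k x \<or> shift h2 x \<le> shift k x" "shift k x \<le> shift h1 x \<or> shift k x \<le> shift h2 x"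
      using between[of x] by (auto simp: min_def max_def split: if_splits intro: mono)
    then have "\<not> ((\<psi>\<^sub>1 x \<le> shift h1 x \<and> shift h1 x \<le> \<psi>\<^sub>2 x) \<and> (\<psi>\<^sub>1 x \<le> shift h2 x \<and> shift h2 x \<le> \<psi>\<^sub>2 x))"
      using x by (auto dest: order_trans)
    then show "x \<in> {x \<in> E. \<not> (\<psi>\<^sub>1 x \<le> shift h1 x \<and> shift h1 x \<le> \<psi>\<^sub>2 x)}
      \<union> {x \<in> E. \<not> (\<psi>\<^sub>1 x \<le> shift h2 x \<and> shift h2 x \<le> \<psi>\<^sub>2 x)}" using x by blast
  qed
qed

section \<open>Correspondence between the obstacle class and admissible functions\<close>

lemma shift_in_class:
  assumes h: "admissible h"
  shows "shift h \<in> obstacle_class p M \<psi>\<^sub>1 \<psi>\<^sub>2 f E"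
proof -
  have hM [measurable]: "h \<in> borel_measurable M" using h by (simp add: admissible_def)
  obtain g where g: "wug UNIV h g" "Lp_int g < \<infinity>"
    using h by (auto simp: admissible_def)
  obtain gf where gf: "wug E F gf" "Lp_int gf < \<infinity>" using f_gradient by metis
  have "wug E (\<lambda>x. real_of_ereal (shift h x)) (\<lambda>x. gf x + g x)"
    unfolding wug_shift_iff by (rule wug_shift_add[OF g(1) gf(1)])
  moreover have "Lp_int (\<lambda>x. gf x + g x) < \<infinity>"
    by (rule Lp_add_finite[OF wug_borel_M[OF gf(1)] wug_borel_M[OF g(1)] gf(2) g(2)])
  ultimately obtain g' where g': "upper_gradient (restrict_space M E) (shift h) g'" "Lp_fun p (restrict_space M E) g'"
    using upper_gradient_of_wug[OF E _ shift_finite] by metis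
  have "shift h \<in> borel_measurable (restrict_space M E)"
    unfolding shift_def[abs_def]
    using f_measurable measurable_restrict_space1[OF hM, of E] by measurable
  then have Dp: "shift h \<in> Dp p (restrict_space M E)" using g' by (auto simp: Dp_def)
  define A where "A = {x \<in> E. \<bar>f x\<bar> = \<infinity> \<and> h x \<noteq> 0}"
  have A: "exceptional A" using h by (simp add: admissible_def A_def)
  then have [measurable]: "A \<in> sets M" by (auto simp: exceptional_def)
  \<comment> \<open>Where \<open>f\<close> is infinite, \<open>fun_diff\<close> gives 0;
    \<open>h\<close> must be changed to match, but only on the exceptional set \<open>A\<close>,
    which costs no gradient.\<close>
  let ?h = "\<lambda>x. ereal (if x \<in> A then 0 else h x)"
  have N: "?h \<in> N1p p M"
  proof (rule N1pI[OF _ finite_along_real _ g(2)])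
    show "?h \<in> borel_measurable M" by measurable
    show "wug UNIV (\<lambda>x. real_of_ereal (?h x)) g"
      by (rule wug_cong[OF g(1)], rule aec_mono[OF exceptional_aec[OF A]]) simp
    have "Lp_int (\<lambda>x. e2ennreal \<bar>?h x\<bar>) = pint h"
      unfolding pint_epow by (rule nn_integral_cong_AE, use exceptional_AE[OF A] in eventually_elim) simp
    then show "Lp_int (\<lambda>x. e2ennreal \<bar>?h x\<bar>) < \<infinity>" using h by (simp add: admissible_def)
  qed
  have Z: "\<forall>x\<in>space M - E. ?h x = 0" using h by (simp add: admissible_def zero_ereal_def)
  have D: "fun_diff (shift h) f x = ?h x" if "x \<in> E" for x
    using that by (cases "f x") (auto simp: fun_diff_def shift_def A_def zero_ereal_def)
  have "fun_diff (shift h) f \<in> N1p0 p M E"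
    unfolding N1p0_def by (rule CollectI, rule bexI[OF _ N], rule conjI[OF Z], rule ballI, rule D)
  moreover have "quasi_everywhere p M E (\<lambda>x. \<psi>\<^sub>1 x \<le> shift h x \<and> shift h x \<le> \<psi>\<^sub>2 x)"
    using h by (simp add: quasi_everywhere_iff admissible_def)
  ultimately show ?thesis using Dp by (simp add: obstacle_class_def)
qed

lemma class_is_shift:
  assumes v: "v \<in> obstacle_class p M \<psi>\<^sub>1 \<psi>\<^sub>2 f E"
  obtains h where "admissible h" "exceptional {x \<in> E. v x \<noteq> shift h x}"
    "energy p (restrict_space M E) v = shift_energy h"
proof -
  obtain h0 where h0: "h0 \<in> N1p p M" "\<And>x. x \<notin> E \<Longrightarrow> h0 x = 0" "\<And>x. x \<in> E \<Longrightarrow> fun_diff v f x = h0 x"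
    using v by (auto simp: obstacle_class_def N1p0_def)
  define h where "h x = real_of_ereal (h0 x)" for x
  let ?B = "{x. \<bar>h0 x\<bar> = \<infinity>}"
  have B: "exceptional ?B" by (rule N1p_infinite_exceptional[OF h0(1)])
  note [measurable] = N1pD(1)[OF h0(1)]
  \<comment> \<open>Off \<open>?B\<close> the difference of \<open>v\<close> and \<open>f\<close> is
    finite. If \<open>f\<close> is infinite, this leaves only \<open>v x = f x\<close>, where
    \<open>fun_diff\<close> is 0 by convention.\<close>
  have eq: "v x = shift h x" "\<bar>f x\<bar> = \<infinity> \<Longrightarrow> h x = 0" if x: "x \<in> E" "x \<notin> ?B" for x
  proof -
    obtain r where r: "h0 x = ereal r" using x(2) by (cases "h0 x") auto
    then have d: "fun_diff v f x = ereal r" "h x = r" using h0(3)[OF x(1)] by (simp_all add: h_def)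
    show "v x = shift h x"
      using d by (cases "v x"; cases "f x") (auto simp: fun_diff_def shift_def zero_ereal_def split: if_splits)
    show "h x = 0" if "\<bar>f x\<bar> = \<infinity>"
      using d that by (cases "v x"; cases "f x") (auto simp: fun_diff_def zero_ereal_def split: if_splits)
  qed
  have exc: "exceptional {x \<in> E. v x \<noteq> shift h x}"
    by (rule exceptional_subset[OF B]) (use eq(1) in blast)
  have "admissible h"
    unfolding admissible_def
  proof (intro conjI)
    show "h \<in> borel_measurable M" unfolding h_def[abs_def] by measurable
    have "pint h \<le> Lp_int (\<lambda>x. e2ennreal \<bar>h0 x\<bar>)"
      unfolding pint_epow h_def by (intro nn_integral_mono epow_mono p_pos e2ennreal_abs_ge)
    then show "pint h < \<infinity>" using N1pD(3)[OF h0(1)] by (rule order.strict_trans1)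
    show "\<exists>g. wug UNIV h g \<and> Lp_int g < \<infinity>"
      using N1pD(4,5)[OF h0(1)] unfolding h_def[abs_def] by metis
    show "\<forall>x. x \<notin> E \<longrightarrow> h x = 0" using h0(2) by (simp add: h_def)
    show "exceptional {x \<in> E. \<bar>f x\<bar> = \<infinity> \<and> h x \<noteq> 0}"
    proof (rule exceptional_subset[OF B], rule subsetI, rule ccontr)
      fix x assume x: "x \<in> {x \<in> E. \<bar>f x\<bar> = \<infinity> \<and> h x \<noteq> 0}" and "x \<notin> ?B"
      then have "h x = 0" by (intro eq(2)) simp_all
      then show False using x by simp
    qed
    have "exceptional {x \<in> E. \<not> (\<psi>\<^sub>1 x \<le> v x \<and> v x \<le> \<psi>\<^sub>2 x)}"
      using v by (simp add: obstacle_class_def quasi_everywhere_iff)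
    from exceptional_Un[OF this exc]
    show "exceptional {x \<in> E. \<not> (\<psi>\<^sub>1 x \<le> shift h x \<and> shift h x \<le> \<psi>\<^sub>2 x)}"
      by (rule exceptional_subset) auto
  qed
  moreover have "energy p (restrict_space M E) v = shift_energy h"
    unfolding shift_energy_def by (rule energy_cong[OF E exc])
  ultimately show ?thesis using that exc by blast
qed

end


section \<open>Midpoints and limits of admissible functions\<close>

context sobolev_setting
begin

lemma wug_half:
  assumes w: "wug S u g"
  shows "wug S (\<lambda>x. u x / 2) (\<lambda>x. ennreal (1/2) * g x)"
proof (rule wug_combine[OF w w])
  note g = wug_borel[OF w]
  show "(\<lambda>x. ennreal (1/2) * g x) \<in> borel_measurable borel" using g by measurable
  fix l \<gamma> a b
  assume c: "(l, \<gamma>) \<in> curves S" "0 \<le> a" "a \<le> b" "b \<le> l"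
    and *: "ennreal \<bar>u (\<gamma> a) - u (\<gamma> b)\<bar> \<le> segment_integral g \<gamma> a b"
  have "\<bar>u (\<gamma> a) / 2 - u (\<gamma> b) / 2\<bar> = 1/2 * \<bar>u (\<gamma> a) - u (\<gamma> b)\<bar>"
    by (simp add: diff_divide_distrib[symmetric])
  then have "ennreal \<bar>u (\<gamma> a) / 2 - u (\<gamma> b) / 2\<bar> = ennreal (1/2) * ennreal \<bar>u (\<gamma> a) - u (\<gamma> b)\<bar>"
    by (simp only: ennreal_mult'[symmetric])
  also have "\<dots> \<le> ennreal (1/2) * segment_integral g \<gamma> a b" by (intro mult_left_mono *) simp
  also have "\<dots> = segment_integral (\<lambda>x. ennreal (1/2) * g x) \<gamma> a b"
    by (rule segment_integral_cmult[OF c(1) g c(2,4), symmetric])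
  finally show "ennreal \<bar>u (\<gamma> a) / 2 - u (\<gamma> b) / 2\<bar> \<le> segment_integral (\<lambda>x. ennreal (1/2) * g x) \<gamma> a b" .
qed

lemma pint_midpoint_le:
  assumes [measurable]: "a \<in> borel_measurable M" "b \<in> borel_measurable M"
  shows "pint (\<lambda>x. (a x + b x) / 2) \<le> ennreal (1/2) * (pint a + pint b)"
proof -
  have "pint (\<lambda>x. (a x + b x) / 2) \<le> (\<integral>\<^sup>+ x. ennreal (1/2) * (ennreal (\<bar>a x\<bar> powr p) + ennreal (\<bar>b x\<bar> powr p)) \<partial>M)"
    unfolding pint_def
  proof (rule nn_integral_mono)
    fix x
    have "\<bar>(a x + b x) / 2\<bar> powr p \<le> 1/2 * (\<bar>a x\<bar> powr p + \<bar>b x\<bar> powr p)"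
      using abs_powr_midpoint_less[OF p_gt_1, of "a x" "b x"] by (cases "a x = b x") auto
    then have "ennreal (\<bar>(a x + b x) / 2\<bar> powr p) \<le> ennreal (1/2 * (\<bar>a x\<bar> powr p + \<bar>b x\<bar> powr p))"
      by (rule ennreal_leI)
    also have "\<dots> = ennreal (1/2) * ennreal (\<bar>a x\<bar> powr p + \<bar>b x\<bar> powr p)"
      by (rule ennreal_mult) simp_all
    also have "ennreal (\<bar>a x\<bar> powr p + \<bar>b x\<bar> powr p) = ennreal (\<bar>a x\<bar> powr p) + ennreal (\<bar>b x\<bar> powr p)"
      by (rule ennreal_plus) simp_all
    finally show "ennreal (\<bar>(a x + b x) / 2\<bar> powr p)
      \<le> ennreal (1/2) * (ennreal (\<bar>a x\<bar> powr p) + ennreal (\<bar>b x\<bar> powr p))" .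
  qed
  also have "\<dots> = ennreal (1/2) * (pint a + pint b)"
    unfolding pint_def by (subst nn_integral_cmult) (simp_all add: nn_integral_add)
  finally show ?thesis .
qed

text \<open>Almost every curve has \<open>h\<close> constant along it and contains a point outside
  the null set where \<open>h\<close> is nonzero, so \<open>h\<close> vanishes on the whole
  curve.\<close>

lemma exceptional_of_zero_gradient:
  assumes w: "wug UNIV h (\<lambda>x. 0)" and AE: "AE x in M. h x = 0"
  shows "exceptional {x. h x \<noteq> 0}"
  unfolding exceptional_def
proof
  show N: "{x. h x \<noteq> 0} \<in> null_sets M" using AE by (simp add: AE_M_iff)
  show "aec UNIV (\<lambda>l \<gamma>. \<forall>t\<in>{0..l}. \<gamma> t \<notin> {x. h x \<noteq> 0})"
  proof (rule aec_mono[OF aec_conj[OF wug_aec[OF w] aec_null[OF N]]], elim conjE, intro ballI)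
    fix l \<gamma> s
    assume c: "(l, \<gamma>) \<in> curves UNIV" and s: "s \<in> {0..l}"
      and incr: "controls h (\<lambda>x. 0) l \<gamma>"
      and AE: "AE t in lborel. t \<in> {0..l} \<longrightarrow> \<gamma> t \<notin> {x. h x \<noteq> 0}"
    have "0 < l" using c by (simp add: curves_iff)
    then obtain t where t: "t \<in> {0..l}" "\<gamma> t \<notin> {x. h x \<noteq> 0}" by (rule AE_exists_in_interval[OF AE])
    have "ennreal \<bar>h (\<gamma> (min s t)) - h (\<gamma> (max s t))\<bar> \<le> segment_integral (\<lambda>x. 0) \<gamma> (min s t) (max s t)"
      using incr s t(1) by (simp add: min_def max_def)
    then have "h (\<gamma> (min s t)) = h (\<gamma> (max s t))" by (simp add: segment_integral_def)
    then have "h (\<gamma> s) = h (\<gamma> t)" by (cases "s \<le> t") (simp_all add: min_def max_def)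
    then show "\<gamma> s \<notin> {x. h x \<noteq> 0}" using t(2) by simp
  qed
qed

text \<open>Functions and gradients must be thinned out along the same indices. Summing all
  thresholds up to j makes \<open>r\<close> nondecreasing and places \<open>r j\<close> beyond each
  of them; adding j ensures \<open>j \<le> r j\<close>.\<close>

lemma fast_common_subsequence:
  assumes 1: "\<And>\<eta>. 0 < \<eta> \<Longrightarrow> \<exists>N. \<forall>n\<ge>N. \<forall>m\<ge>N. pint (\<lambda>x. a n x - a m x) \<le> ennreal \<eta>"
    and 2: "\<And>\<eta>. 0 < \<eta> \<Longrightarrow> \<exists>N. \<forall>n\<ge>N. \<forall>m\<ge>N. pint (\<lambda>x. b n x - b m x) \<le> ennreal \<eta>"
  obtains r :: "nat \<Rightarrow> nat" where "\<And>j. j \<le> r j"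
    "\<And>j. pint (\<lambda>x. a (r (Suc j)) x - a (r j) x) \<le> ennreal ((1/2) ^ j / (2 ^ j) powr p)"
    "\<And>j. pint (\<lambda>x. b (r (Suc j)) x - b (r j) x) \<le> ennreal ((1/2) ^ j / (2 ^ j) powr p)"
proof -
  define \<eta> where "\<eta> j = (1/2) ^ j / (2 ^ j) powr p" for j :: nat
  have \<eta>: "0 < \<eta> j" for j by (simp add: \<eta>_def)
  obtain N1 where N1: "\<And>j n m. N1 j \<le> n \<Longrightarrow> N1 j \<le> m \<Longrightarrow> pint (\<lambda>x. a n x - a m x) \<le> ennreal (\<eta> j)"
    using 1[OF \<eta>] by metis
  obtain N2 where N2: "\<And>j n m. N2 j \<le> n \<Longrightarrow> N2 j \<le> m \<Longrightarrow> pint (\<lambda>x. b n x - b m x) \<le> ennreal (\<eta> j)"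
    using 2[OF \<eta>] by metis
  define r where "r j = (\<Sum>i\<le>j. N1 i + N2 i) + j" for j
  have r: "N1 j \<le> r j" "N2 j \<le> r j" "r j \<le> r (Suc j)" "j \<le> r j" for j
  proof -
    have "N1 j + N2 j \<le> (\<Sum>i\<le>j. N1 i + N2 i)" by (rule member_le_sum) auto
    then show "N1 j \<le> r j" "N2 j \<le> r j" by (auto simp: r_def)
    show "r j \<le> r (Suc j)" "j \<le> r j" by (auto simp: r_def)
  qed
  show ?thesis
  proof (rule that[of r])
    fix j
    show "j \<le> r j" by (rule r)
    show "pint (\<lambda>x. a (r (Suc j)) x - a (r j) x) \<le> ennreal ((1/2) ^ j / (2 ^ j) powr p)"
      unfolding \<eta>_def[symmetric] by (rule N1) (use r(1,3)[of j] in auto)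
    show "pint (\<lambda>x. b (r (Suc j)) x - b (r j) x) \<le> ennreal ((1/2) ^ j / (2 ^ j) powr p)"
      unfolding \<eta>_def[symmetric] by (rule N2) (use r(2,3)[of j] in auto)
  qed
qed

end

context obstacle_setting
begin

text \<open>Stated with an arbitrary gradient in place of the energy, since the gradients obtained
  by extension from \<open>E\<close> need not be minimal on the whole space.\<close>

lemma Poincare_bound:
  assumes "supports_Poincare_N0 p M" "bounded E" "0 < capacity p M (space M - E)"
  obtains C :: real where "0 < C" "\<And>h g. h \<in> borel_measurable M \<Longrightarrow> pint h < \<infinity> \<Longrightarrow> wug UNIV h g \<Longrightarrow>
    Lp_int g < \<infinity> \<Longrightarrow> (\<And>x. x \<notin> E \<Longrightarrow> h x = 0) \<Longrightarrow>
    pint h \<le> ennreal C * Lp_int g"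
proof -
  obtain C :: real where C: "0 < C" and le: "\<And>u. u \<in> N1p0 p M E \<Longrightarrow>
      Lp_int (\<lambda>x. e2ennreal \<bar>zero_ext E u x\<bar>) \<le> ennreal C * energy p M (zero_ext E u)"
    using assms unfolding supports_Poincare_N0_def by (metis space_M subset_UNIV)
  show ?thesis
  proof (rule that[OF C])
    fix h g
    assume [measurable]: "h \<in> borel_measurable M" and h: "pint h < \<infinity>" and w: "wug UNIV h g"
      and g: "Lp_int g < \<infinity>" and h0: "\<And>x. x \<notin> E \<Longrightarrow> h x = 0"
    let ?h = "\<lambda>x. ereal (h x)"
    have w': "wug UNIV (\<lambda>x. real_of_ereal (?h x)) g" using w by simp
    have "?h \<in> N1p p M"
      by (rule N1pI[OF _ finite_along_real w' g]) (use h in \<open>simp_all add: pint_epow\<close>)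
    then have "?h \<in> N1p0 p M E"
      unfolding N1p0_def by (intro CollectI bexI[of _ ?h]) (simp_all add: h0 zero_ereal_def)
    from le[OF this] have "Lp_int (\<lambda>x. e2ennreal \<bar>zero_ext E ?h x\<bar>) \<le> ennreal C * energy p M (zero_ext E ?h)" .
    moreover have "zero_ext E ?h = ?h" using h0 by (auto simp: zero_ext_def zero_ereal_def)
    ultimately have "pint h \<le> ennreal C * energy p M ?h" by (simp add: pint_epow)
    also have "\<dots> \<le> ennreal C * Lp_int g"
      by (intro mult_left_mono energy_le_M[OF w' finite_along_real]) simp
    finally show "pint h \<le> ennreal C * Lp_int g" .
  qed
qed

lemma midpoint_gradient:
  assumes g1: "wug E (\<lambda>x. F x + h1 x) (\<lambda>x. ennreal (\<gamma>1 x))" "\<And>x. 0 \<le> \<gamma>1 x"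
    and g2: "wug E (\<lambda>x. F x + h2 x) (\<lambda>x. ennreal (\<gamma>2 x))" "\<And>x. 0 \<le> \<gamma>2 x"
  shows "wug E (\<lambda>x. F x + (h1 x + h2 x) / 2) (\<lambda>x. ennreal \<bar>(\<gamma>1 x + \<gamma>2 x) / 2\<bar>)"
proof -
  have half: "ennreal (1/2) * ennreal (\<gamma>1 x) + ennreal (1/2) * ennreal (\<gamma>2 x) = ennreal \<bar>(\<gamma>1 x + \<gamma>2 x) / 2\<bar>" for x
  proof -
    have "\<bar>(\<gamma>1 x + \<gamma>2 x) / 2\<bar> = 1/2 * \<gamma>1 x + 1/2 * \<gamma>2 x" using g1(2)[of x] g2(2)[of x] by simp
    then have "ennreal \<bar>(\<gamma>1 x + \<gamma>2 x) / 2\<bar> = ennreal (1/2 * \<gamma>1 x) + ennreal (1/2 * \<gamma>2 x)"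
      using g1(2)[of x] g2(2)[of x] by (simp only:) (rule ennreal_plus, simp_all)
    then show ?thesis by (simp only: ennreal_mult'[symmetric])
  qed
  have "wug E (\<lambda>x. F x + (h1 x + h2 x) / 2) (\<lambda>x. ennreal (1/2) * ennreal (\<gamma>1 x) + ennreal (1/2) * ennreal (\<gamma>2 x))"
  proof (rule wug_add_le[OF wug_half[OF g1(1)] wug_half[OF g2(1)]])
    fix x y
    have "F x + (h1 x + h2 x) / 2 - (F y + (h1 y + h2 y) / 2)
        = ((F x + h1 x) / 2 - (F y + h1 y) / 2) + ((F x + h2 x) / 2 - (F y + h2 y) / 2)"
      by (simp add: field_simps)
    then show "\<bar>F x + (h1 x + h2 x) / 2 - (F y + (h1 y + h2 y) / 2)\<bar>
        \<le> \<bar>(F x + h1 x) / 2 - (F y + h1 y) / 2\<bar> + \<bar>(F x + h2 x) / 2 - (F y + h2 y) / 2\<bar>"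
      by (simp only: abs_triangle_ineq)
  qed
  then show ?thesis by (simp only: half)
qed

lemma midpoint_admissible:
  assumes 1: "admissible h1" and 2: "admissible h2"
    and g1: "wug E (\<lambda>x. F x + h1 x) (\<lambda>x. ennreal (\<gamma>1 x))" "\<And>x. 0 \<le> \<gamma>1 x" "pint \<gamma>1 < \<infinity>" "\<gamma>1 \<in> borel_measurable borel"
    and g2: "wug E (\<lambda>x. F x + h2 x) (\<lambda>x. ennreal (\<gamma>2 x))" "\<And>x. 0 \<le> \<gamma>2 x" "pint \<gamma>2 < \<infinity>" "\<gamma>2 \<in> borel_measurable borel"
  shows "admissible (\<lambda>x. (h1 x + h2 x) / 2)"
    and "shift_energy (\<lambda>x. (h1 x + h2 x) / 2) \<le> pint (\<lambda>x. (\<gamma>1 x + \<gamma>2 x) / 2)"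
    and "pint (\<lambda>x. (\<gamma>1 x + \<gamma>2 x) / 2) \<le> ennreal (1/2) * (pint \<gamma>1 + pint \<gamma>2)"
proof -
  note w = midpoint_gradient[OF g1(1,2) g2(1,2)]
  show le: "pint (\<lambda>x. (\<gamma>1 x + \<gamma>2 x) / 2) \<le> ennreal (1/2) * (pint \<gamma>1 + pint \<gamma>2)"
    by (intro pint_midpoint_le borel_measurable_M g1 g2)
  show "shift_energy (\<lambda>x. (h1 x + h2 x) / 2) \<le> pint (\<lambda>x. (\<gamma>1 x + \<gamma>2 x) / 2)"
    unfolding pint_epow by (rule shift_energy_le[OF w])
  have "ennreal (1/2) * (pint \<gamma>1 + pint \<gamma>2) < \<infinity>"
    using g1(3) g2(3) ennreal_less_top[of "1/2"]
    unfolding infinity_ennreal_def ennreal_mult_less_top by simp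
  with le have fin: "pint (\<lambda>x. (\<gamma>1 x + \<gamma>2 x) / 2) < \<infinity>" by (rule order.strict_trans1)
  show "admissible (\<lambda>x. (h1 x + h2 x) / 2)"
  proof (rule admissible_between[OF 1 2 _ _ _ w fin[unfolded pint_epow]])
    have "h1 \<in> borel_measurable M" "h2 \<in> borel_measurable M" using 1 2 by (simp_all add: admissible_def)
    then show "(\<lambda>x. (h1 x + h2 x) / 2) \<in> borel_measurable M" by measurable
  qed (auto simp: min_def max_def)
qed

lemma shift_limsup:
  assumes "bounded (range (\<lambda>j. k j x))"
  shows "shift (\<lambda>x. real_of_ereal (limsup (\<lambda>j. ereal (k j x)))) x = limsup (\<lambda>j. shift (k j) x)"
proof (cases "f x")
  case (real r)
  have "limsup (\<lambda>j. shift (k j) x) = limsup (\<lambda>j. ereal r + ereal (k j x))" by (simp only: shift_def real)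
  also have "\<dots> = ereal r + limsup (\<lambda>j. ereal (k j x))"
    by (rule ereal_limsup_lim_add) (rule tendsto_const, simp)
  also have "\<dots> = shift (\<lambda>x. real_of_ereal (limsup (\<lambda>j. ereal (k j x)))) x"
    unfolding shift_def real limsup_real_bounded[OF assms] ..
  finally show ?thesis ..
qed (simp_all add: shift_def Limsup_const)

text \<open>\<open>wug_limsup\<close> is used twice. On the whole space, with the crude densities
  \<open>\<kappa> j + gf\<close> of the extensions by zero, it shows that the limit is admissible.
  In \<open>E\<close>, with the sharp densities \<open>\<kappa> j\<close> of \<open>F + k j\<close>,
  it bounds the energy, the p-integral of the limit density being controlled by Fatou.\<close>

lemma limit_admissible:
  assumes k: "\<And>j. admissible (k j)"
    and \<kappa>: "\<And>j. \<kappa> j \<in> borel_measurable borel" "\<And>j x. 0 \<le> \<kappa> j x"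
      "\<And>j. wug E (\<lambda>x. F x + k j x) (\<lambda>x. ennreal (\<kappa> j x))"
    and fast: "\<And>j. pint (\<lambda>x. k (Suc j) x - k j x) \<le> ennreal ((1/2) ^ j / (2 ^ j) powr p)"
      "\<And>j. pint (\<lambda>x. \<kappa> (Suc j) x - \<kappa> j x) \<le> ennreal ((1/2) ^ j / (2 ^ j) powr p)"
    and I: "I < \<infinity>" "\<And>j. pint (\<kappa> j) \<le> I + ennreal (1 / Suc j)"
  shows "\<exists>h. admissible h \<and> shift_energy h \<le> I"
proof -
  have kM [measurable]: "k j \<in> borel_measurable M" for j using k[of j] by (simp add: admissible_def)
  have \<kappa>M [measurable]: "\<kappa> j \<in> borel_measurable M" for j by (rule borel_measurable_M[OF \<kappa>(1)])
  obtain \<rho>1 where \<rho>1: "\<rho>1 \<in> borel_measurable borel" "Lp_int \<rho>1 < \<infinity>"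
    "\<And>j x. ennreal \<bar>k (Suc j) x - k j x\<bar> \<le> ennreal ((1/2) ^ j) * \<rho>1 x"
    using fast_Cauchy_dominated[OF kM fast(1)] by blast
  obtain \<rho>2 where \<rho>2: "\<rho>2 \<in> borel_measurable borel" "Lp_int \<rho>2 < \<infinity>"
    "\<And>j x. ennreal \<bar>\<kappa> (Suc j) x - \<kappa> j x\<bar> \<le> ennreal ((1/2) ^ j) * \<rho>2 x"
    using fast_Cauchy_dominated[OF \<kappa>M fast(2)] by blast
  have AE_fin: "AE x in M. \<rho> x < \<infinity>" if "\<rho> \<in> borel_measurable borel" "Lp_int \<rho> < \<infinity>" for \<rho>
  proof -
    have "AE x in M. epow (\<rho> x) p \<noteq> \<infinity>"
      using that(2) borel_measurable_M[OF that(1)] by (intro nn_integral_noteq_infinite) auto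
    then show ?thesis by eventually_elim (metis epow_less_top_iff infinity_ennreal_def less_top)
  qed
  obtain gf where gf: "wug E F gf" "Lp_int gf < \<infinity>" using f_gradient by metis
  \<comment> \<open>The liminf is Borel on the whole space and equals the limit wherever
    \<open>\<rho>2\<close> is finite.\<close>
  define g where "g x = liminf (\<lambda>j. ennreal (\<kappa> j x))" for x
  define e where "e j = 2 * (1/2::real) ^ j" for j :: nat
  have e: "e \<longlonglongrightarrow> 0" "\<And>j. 0 \<le> e j"
  proof -
    have "(\<lambda>j. 2 * (1/2::real) ^ j) \<longlonglongrightarrow> 2 * 0" by (intro tendsto_intros LIMSEQ_power_zero) simp
    then show "e \<longlonglongrightarrow> 0" by (simp only: e_def[abs_def] mult_zero_right)
  qed (simp add: e_def)
  have g_borel: "g \<in> borel_measurable borel" unfolding g_def using \<kappa>(1) by measurable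
  have g_lim: "\<exists>L\<ge>0. (\<lambda>j. \<kappa> j x) \<longlonglongrightarrow> L \<and> g x = ennreal L \<and> (\<forall>j. \<bar>\<kappa> j x - L\<bar> \<le> e j * enn2real (\<rho>2 x))"
    if fin: "\<rho>2 x < \<infinity>" for x
  proof -
    obtain L where L: "(\<lambda>j. \<kappa> j x) \<longlonglongrightarrow> L" "\<And>j. \<bar>\<kappa> j x - L\<bar> \<le> 2 * (1/2) ^ j * enn2real (\<rho>2 x)"
      using dominated_limit[OF \<rho>2(3) fin] by blast
    have "0 \<le> L" by (rule LIMSEQ_le_const[OF L(1)]) (use \<kappa>(2) in blast)
    moreover have "g x = ennreal L"
      unfolding g_def by (rule lim_imp_Liminf[OF _ tendsto_ennrealI[OF L(1)]]) simp
    ultimately show ?thesis using L unfolding e_def by blast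
  qed
  \<comment> \<open>Line integrals require this at every point: where \<open>\<rho>2\<close> is
    infinite, so is the right side, because \<open>e j\<close> is positive.\<close>
  have \<kappa>_le: "ennreal (\<kappa> j x) \<le> g x + ennreal (e j) * \<rho>2 x" for j x
  proof (cases "\<rho>2 x < \<infinity>")
    case True
    obtain L where L: "0 \<le> L" "g x = ennreal L" "\<bar>\<kappa> j x - L\<bar> \<le> e j * enn2real (\<rho>2 x)"
      using g_lim[OF True] by blast
    have "ennreal (\<kappa> j x) \<le> ennreal (L + e j * enn2real (\<rho>2 x))" using L(3) by (intro ennreal_leI) linarith
    also have "\<dots> = ennreal L + ennreal (e j * enn2real (\<rho>2 x))" using L(1) e(2)[of j] by (intro ennreal_plus) simp_all
    also have "ennreal (e j * enn2real (\<rho>2 x)) = ennreal (e j) * \<rho>2 x"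
      using e(2)[of j] True by (simp add: ennreal_mult)
    finally show ?thesis by (simp only: L(2))
  next
    case False
    then have "\<rho>2 x = top" by (simp add: less_top[symmetric])
    moreover have "ennreal (e j) \<noteq> 0" by (simp add: e_def)
    ultimately show ?thesis by (simp add: ennreal_mult_top)
  qed
  have g_Lp: "Lp_int g \<le> I"
  proof -
    have "Lp_int g = (\<integral>\<^sup>+ x. liminf (\<lambda>j. ennreal (\<bar>\<kappa> j x\<bar> powr p)) \<partial>M)"
    proof (rule nn_integral_cong_AE, use AE_fin[OF \<rho>2(1,2)] in eventually_elim)
      fix x assume "\<rho>2 x < \<infinity>"
      then obtain L where L: "0 \<le> L" "(\<lambda>j. \<kappa> j x) \<longlonglongrightarrow> L" "g x = ennreal L" using g_lim by blast
      have "(\<lambda>j. \<bar>\<kappa> j x\<bar> powr p) \<longlonglongrightarrow> \<bar>L\<bar> powr p"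
        using p_pos by (intro tendsto_powr' tendsto_rabs L(2) tendsto_const) simp
      then have "liminf (\<lambda>j. ennreal (\<bar>\<kappa> j x\<bar> powr p)) = ennreal (\<bar>L\<bar> powr p)"
        by (intro lim_imp_Liminf tendsto_ennrealI) simp_all
      then show "epow (g x) p = liminf (\<lambda>j. ennreal (\<bar>\<kappa> j x\<bar> powr p))"
        using L(1,3) by (simp add: epow_ennreal)
    qed
    also have "\<dots> \<le> liminf (\<lambda>j. pint (\<kappa> j))"
      unfolding pint_def by (rule nn_integral_liminf) measurable
    also have "\<dots> \<le> liminf (\<lambda>j. I + ennreal (1 / Suc j))"
      by (intro Liminf_mono always_eventually allI I(2))
    also have "\<dots> = I"
    proof (rule lim_imp_Liminf)
      have "(\<lambda>j. I + ennreal (1 / Suc j)) \<longlonglongrightarrow> I + ennreal 0"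
        by (intro tendsto_add tendsto_const tendsto_ennrealI LIMSEQ_Suc lim_1_over_n)
      then show "(\<lambda>j. I + ennreal (1 / Suc j)) \<longlonglongrightarrow> I" by simp
    qed simp
    finally show ?thesis .
  qed
  then have g_fin: "Lp_int g < \<infinity>" using I(1) by (rule order.strict_trans1)
  have k_lim: "\<exists>L. (\<lambda>j. k j x) \<longlonglongrightarrow> L \<and> \<bar>k 0 x - L\<bar> \<le> 2 * enn2real (\<rho>1 x)" if fin: "\<rho>1 x < \<infinity>" for x
  proof -
    obtain L where L: "(\<lambda>j. k j x) \<longlonglongrightarrow> L" "\<And>j. \<bar>k j x - L\<bar> \<le> 2 * (1/2) ^ j * enn2real (\<rho>1 x)"
      using dominated_limit[OF \<rho>1(3) fin] by blast
    then show ?thesis using L(2)[of 0] by auto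
  qed
  have k_bdd: "bounded (range (\<lambda>j. k j x))" if "\<rho>1 x < \<infinity>" for x
    using k_lim[OF that] convergent_imp_bounded by blast
  define h where "h x = real_of_ereal (limsup (\<lambda>j. ereal (k j x)))" for x
  let ?g = "\<lambda>x. g x + gf x"
  have g_borel': "?g \<in> borel_measurable borel" using g_borel wug_borel[OF gf(1)] by measurable
  have g_fin': "Lp_int ?g < \<infinity>"
    by (rule Lp_add_finite[OF borel_measurable_M[OF g_borel] wug_borel_M[OF gf(1)] g_fin gf(2)])
  \<comment> \<open>A curve with finite integral of \<open>\<rho>1\<close> contains a point where
    \<open>\<rho>1\<close> is finite, and there the sequence converges.\<close>
  have bdd0: "aec UNIV (\<lambda>l \<gamma>. \<exists>t\<in>{0..l}. bounded (range (\<lambda>j. k j (\<gamma> t))))"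
  proof (rule aec_mono[OF aec_finite[OF \<rho>1(1,2)]])
    fix l \<gamma> assume c: "(l, \<gamma>) \<in> curves UNIV" and fin: "segment_integral \<rho>1 \<gamma> 0 l < \<infinity>"
    have "0 < l" using c by (simp add: curves_iff)
    then obtain t where "t \<in> {0..l}" "\<rho>1 (\<gamma> t) < \<infinity>"
      by (rule AE_exists_in_interval[OF segment_integral_finite_AE[OF c \<rho>1(1) fin]])
    then show "\<exists>t\<in>{0..l}. bounded (range (\<lambda>j. k j (\<gamma> t)))" using k_bdd by blast
  qed
  have le': "ennreal (\<kappa> j x) + gf x \<le> ?g x + ennreal (e j) * \<rho>2 x" for j x
  proof -
    have "ennreal (\<kappa> j x) + gf x \<le> (g x + ennreal (e j) * \<rho>2 x) + gf x" by (intro add_right_mono \<kappa>_le)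
    then show ?thesis by (simp only: ac_simps)
  qed
  note X = wug_limsup[OF admissible_zero_extension[OF k \<kappa>(3) gf(1)] g_borel' \<rho>2(1) le' e
      aec_finite[OF g_borel' g_fin'] aec_finite[OF \<rho>2(1,2)] bdd0]
  have bddE: "aec E (\<lambda>l \<gamma>. \<forall>t\<in>{0..l}. bounded (range (\<lambda>j. k j (\<gamma> t))))"
    by (rule aec_subset[OF X(1)]) simp
  have bddE': "aec E (\<lambda>l \<gamma>. \<exists>t\<in>{0..l}. bounded (range (\<lambda>j. F (\<gamma> t) + k j (\<gamma> t))))"
  proof (rule aec_mono[OF bddE])
    fix l \<gamma> assume c: "(l, \<gamma>) \<in> curves E" and *: "\<forall>t\<in>{0..l}. bounded (range (\<lambda>j. k j (\<gamma> t)))"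
    have "0 < l" using c by (simp add: curves_iff)
    then have "bounded (range (\<lambda>j. k j (\<gamma> 0)))" using * by simp
    then have "bounded ((\<lambda>y. F (\<gamma> 0) + y) ` range (\<lambda>j. k j (\<gamma> 0)))" by (rule bounded_translation)
    then show "\<exists>t\<in>{0..l}. bounded (range (\<lambda>j. F (\<gamma> t) + k j (\<gamma> t)))"
      using \<open>0 < l\<close> by (intro bexI[of _ 0]) (simp_all add: image_image)
  qed
  have "wug E (\<lambda>x. real_of_ereal (limsup (\<lambda>j. ereal (F x + k j x)))) g"
    by (rule wug_limsup(2)[OF \<kappa>(3) g_borel \<rho>2(1) \<kappa>_le e
      aec_finite[OF g_borel g_fin] aec_finite[OF \<rho>2(1,2)] bddE'])
  then have wE: "wug E (\<lambda>x. F x + h x) g"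
  proof (rule wug_cong, intro aec_mono[OF bddE] ballI)
    fix l \<gamma> t assume *: "\<forall>t\<in>{0..l}. bounded (range (\<lambda>j. k j (\<gamma> t)))" and t: "t \<in> {0..l}"
    from bspec[OF * t] have b: "bounded (range (\<lambda>j. k j (\<gamma> t)))" .
    have "limsup (\<lambda>j. ereal (F (\<gamma> t) + k j (\<gamma> t))) = limsup (\<lambda>j. ereal (F (\<gamma> t)) + ereal (k j (\<gamma> t)))" by simp
    also have "\<dots> = ereal (F (\<gamma> t)) + limsup (\<lambda>j. ereal (k j (\<gamma> t)))"
      by (rule ereal_limsup_lim_add) (rule tendsto_const, simp)
    also have "limsup (\<lambda>j. ereal (k j (\<gamma> t))) = ereal (h (\<gamma> t))"
      unfolding h_def by (rule limsup_real_bounded[OF b, symmetric])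
    finally show "real_of_ereal (limsup (\<lambda>j. ereal (F (\<gamma> t) + k j (\<gamma> t)))) = F (\<gamma> t) + h (\<gamma> t)" by simp
  qed
  \<comment> \<open>Off \<open>U\<close> the limsup is a real number, so
    \<open>real_of_ereal\<close> loses nothing and the limsup commutes with adding
    \<open>f\<close>.\<close>
  define U where "U = {x. \<not> bounded (range (\<lambda>j. k j x))}"
  have U: "exceptional U"
    unfolding exceptional_def
  proof
    have "AE x in M. bounded (range (\<lambda>j. k j x))"
      using AE_fin[OF \<rho>1(1,2)] by eventually_elim (rule k_bdd)
    then show "U \<in> null_sets M" by (simp add: AE_M_iff U_def)
    show "aec UNIV (\<lambda>l \<gamma>. \<forall>t\<in>{0..l}. \<gamma> t \<notin> U)"
      using X(1) by (rule aec_mono) (simp add: U_def)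
  qed
  have "admissible h"
    unfolding admissible_def
  proof (intro conjI)
    show "h \<in> borel_measurable M" unfolding h_def[abs_def] by measurable
    show "pint h < \<infinity>"
    proof -
      have "pint h \<le> Lp_int (\<lambda>x. ennreal \<bar>k 0 x\<bar> + (\<rho>1 x + \<rho>1 x))"
        unfolding pint_epow
      proof (rule nn_integral_mono_AE, use AE_fin[OF \<rho>1(1,2)] in eventually_elim)
        fix x assume x: "\<rho>1 x < \<infinity>"
        obtain L where L: "(\<lambda>j. k j x) \<longlonglongrightarrow> L" "\<bar>k 0 x - L\<bar> \<le> 2 * enn2real (\<rho>1 x)" using k_lim[OF x] by blast
        have "limsup (\<lambda>j. ereal (k j x)) = ereal L"
          using L(1) by (intro lim_imp_Limsup) simp_all
        then have "h x = L" by (simp add: h_def)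
        then have "\<bar>h x\<bar> \<le> \<bar>k 0 x\<bar> + (enn2real (\<rho>1 x) + enn2real (\<rho>1 x))" using L(2) by linarith
        then have "ennreal \<bar>h x\<bar> \<le> ennreal (\<bar>k 0 x\<bar> + (enn2real (\<rho>1 x) + enn2real (\<rho>1 x)))" by (rule ennreal_leI)
        also have "\<dots> = ennreal \<bar>k 0 x\<bar> + ennreal (enn2real (\<rho>1 x) + enn2real (\<rho>1 x))"
          by (rule ennreal_plus) simp_all
        also have "ennreal (enn2real (\<rho>1 x) + enn2real (\<rho>1 x)) = \<rho>1 x + \<rho>1 x"
          by (subst ennreal_plus) (use x in simp_all)
        finally show "epow (ennreal \<bar>h x\<bar>) p \<le> epow (ennreal \<bar>k 0 x\<bar> + (\<rho>1 x + \<rho>1 x)) p"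
          by (intro epow_mono p_pos)
      qed
      also have "\<dots> < \<infinity>"
      proof (rule Lp_add_finite)
        note [measurable] = borel_measurable_M[OF \<rho>1(1)]
        show "(\<lambda>x. ennreal \<bar>k 0 x\<bar>) \<in> borel_measurable M" "(\<lambda>x. \<rho>1 x + \<rho>1 x) \<in> borel_measurable M" by measurable
        show "Lp_int (\<lambda>x. ennreal \<bar>k 0 x\<bar>) < \<infinity>"
          using k[of 0] by (simp add: admissible_def pint_epow)
        show "Lp_int (\<lambda>x. \<rho>1 x + \<rho>1 x) < \<infinity>"
          by (intro Lp_add_finite borel_measurable_M \<rho>1)
      qed
      finally show ?thesis .
    qed
    show "\<exists>g. wug UNIV h g \<and> Lp_int g < \<infinity>"
      using X(2) g_fin' unfolding h_def[abs_def] by blast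
    show "\<forall>x. x \<notin> E \<longrightarrow> h x = 0"
      using k by (simp add: h_def admissible_def Limsup_const flip: zero_ereal_def)
    have "exceptional (\<Union>j. {x \<in> E. \<bar>f x\<bar> = \<infinity> \<and> k j x \<noteq> 0})"
      by (rule exceptional_UN) (use k in \<open>simp add: admissible_def\<close>)
    then show "exceptional {x \<in> E. \<bar>f x\<bar> = \<infinity> \<and> h x \<noteq> 0}"
    proof (rule exceptional_subset, intro subsetI)
      fix x assume x: "x \<in> {x \<in> E. \<bar>f x\<bar> = \<infinity> \<and> h x \<noteq> 0}"
      have "\<exists>j. k j x \<noteq> 0"
      proof (rule ccontr)
        assume "\<nexists>j. k j x \<noteq> 0"
        then have "h x = 0" by (simp add: h_def Limsup_const flip: zero_ereal_def)
        then show False using x by simp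
      qed
      then show "x \<in> (\<Union>j. {x \<in> E. \<bar>f x\<bar> = \<infinity> \<and> k j x \<noteq> 0})" using x by simp
    qed
    \<comment> \<open>Off this countable union the obstacle inequalities hold for all j at once, and
      a limsup preserves both of them.\<close>
    have exc: "exceptional ((\<Union>j. {x \<in> E. \<not> (\<psi>\<^sub>1 x \<le> shift (k j) x \<and> shift (k j) x \<le> \<psi>\<^sub>2 x)}) \<union> U)"
      by (intro exceptional_Un exceptional_UN U) (use k in \<open>simp add: admissible_def\<close>)
    show "exceptional {x \<in> E. \<not> (\<psi>\<^sub>1 x \<le> shift h x \<and> shift h x \<le> \<psi>\<^sub>2 x)}"
    proof (rule exceptional_subset[OF exc], rule subsetI, rule ccontr)
      fix x assume x: "x \<in> {x \<in> E. \<not> (\<psi>\<^sub>1 x \<le> shift h x \<and> shift h x \<le> \<psi>\<^sub>2 x)}"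
        and nx: "x \<notin> (\<Union>j. {x \<in> E. \<not> (\<psi>\<^sub>1 x \<le> shift (k j) x \<and> shift (k j) x \<le> \<psi>\<^sub>2 x)}) \<union> U"
      have b: "bounded (range (\<lambda>j. k j x))" and j: "\<And>j. \<psi>\<^sub>1 x \<le> shift (k j) x" "\<And>j. shift (k j) x \<le> \<psi>\<^sub>2 x"
        using x nx by (auto simp: U_def)
      have eq: "shift h x = limsup (\<lambda>j. shift (k j) x)"
        using shift_limsup[of k x, OF b] by (simp only: h_def[abs_def])
      have "\<psi>\<^sub>1 x \<le> shift h x" unfolding eq by (intro le_Limsup always_eventually allI j) simp
      moreover have "shift h x \<le> \<psi>\<^sub>2 x" unfolding eq by (intro Limsup_bounded always_eventually allI j)
      ultimately show False using x by simp
    qed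
  qed
  moreover have "shift_energy h \<le> I" using shift_energy_le[OF wE] g_Lp by (rule order_trans)
  ultimately show ?thesis by blast
qed


section \<open>Existence and uniqueness\<close>

lemma wug_diff_const: "wug S (\<lambda>x. u x - c) g \<longleftrightarrow> wug S u g"
  by (simp add: wug_def)

lemma minimal_energy_attained:
  assumes Poincare: "supports_Poincare_N0 p M" "bounded E" "0 < capacity p M (space M - E)"
    and ne: "\<exists>h. admissible h"
  shows "\<exists>h. admissible h \<and> (\<forall>k. admissible k \<longrightarrow> shift_energy h \<le> shift_energy k)"
proof -
  define I where "I = (INF h\<in>Collect admissible. shift_energy h)"
  have I_le: "I \<le> shift_energy h" if "admissible h" for h
    unfolding I_def using that by (intro INF_lower) simp
  have I_fin: "I < \<infinity>" using ne I_le admissible_gradient(1) by (meson order.strict_trans1)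
  define A where "A n = {h. admissible h \<and> shift_energy h \<le> I + ennreal (1 / Suc n)}" for n :: nat
  have A_ne: "A n \<noteq> {}" for n
  proof -
    have "0 < 1 / real (Suc n)" by simp
    from INF_approx_ennreal[OF this I_def] I_fin
    obtain h where "admissible h" "shift_energy h < I + ennreal (1 / Suc n)" by auto
    then show ?thesis unfolding A_def by (auto intro: less_imp_le)
  qed
  have A_anti: "A m \<subseteq> A n" if "n \<le> m" for n m
  proof
    fix h assume h: "h \<in> A m"
    have "ennreal (1 / Suc m) \<le> ennreal (1 / Suc n)"
      using that by (intro ennreal_leI divide_left_mono) auto
    then have "I + ennreal (1 / Suc m) \<le> I + ennreal (1 / Suc n)" by (rule add_left_mono)
    then show "h \<in> A n" using h unfolding A_def by (auto intro: order_trans)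
  qed
  obtain gf where gf: "wug E F gf" "Lp_int gf < \<infinity>" using f_gradient by metis
  obtain C :: real where C: "0 < C" and P: "\<And>h g. h \<in> borel_measurable M \<Longrightarrow> pint h < \<infinity> \<Longrightarrow> wug UNIV h g \<Longrightarrow>
    Lp_int g < \<infinity> \<Longrightarrow> (\<And>x. x \<notin> E \<Longrightarrow> h x = 0) \<Longrightarrow> pint h \<le> ennreal C * Lp_int g"
    using Poincare_bound[OF Poincare] by blast
  \<comment> \<open>The Poincare constant, the factor of \<open>Lp_add\<close>, the largest energy
    allowed in \<open>A 0\<close>, and the gradient of \<open>F\<close> that enters with the
    extension by zero.\<close>
  define B where "B = ennreal C * (ennreal (2 powr p) * ((I + ennreal 1) + Lp_int gf))"
  have B_fin: "B < \<infinity>"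
    unfolding B_def using I_fin gf(2) by (simp add: ennreal_mult_less_top)
  have pint_le_B: "pint h \<le> B" if h: "h \<in> A n" for h n
  proof -
    have adm: "admissible h" and e: "shift_energy h \<le> I + ennreal 1"
      using h A_anti[of 0 n] by (auto simp: A_def)
    obtain \<gamma> where \<gamma>: "\<gamma> \<in> borel_measurable borel" "\<And>x. 0 \<le> \<gamma> x" "wug E (\<lambda>x. F x + h x) (\<lambda>x. ennreal (\<gamma> x))"
      "pint \<gamma> = shift_energy h" using admissible_gradient(2)[OF adm] by blast
    have \<gamma>e: "Lp_int (\<lambda>x. ennreal (\<gamma> x)) = shift_energy h"
      using \<gamma>(2) by (simp add: \<gamma>(4)[symmetric] pint_epow)
    note w = admissible_zero_extension[OF adm \<gamma>(3) gf(1)]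
    have \<gamma>M: "(\<lambda>x. ennreal (\<gamma> x)) \<in> borel_measurable M" by (rule wug_borel_M[OF \<gamma>(3)])
    have "Lp_int (\<lambda>x. ennreal (\<gamma> x)) < \<infinity>" unfolding \<gamma>e by (rule admissible_gradient(1)[OF adm])
    then have "Lp_int (\<lambda>x. ennreal (\<gamma> x) + gf x) < \<infinity>"
      by (rule Lp_add_finite[OF \<gamma>M wug_borel_M[OF gf(1)] _ gf(2)])
    then have "pint h \<le> ennreal C * Lp_int (\<lambda>x. ennreal (\<gamma> x) + gf x)"
      by (intro P[OF _ _ w]) (use adm in \<open>auto simp: admissible_def\<close>)
    also have "\<dots> \<le> ennreal C * (ennreal (2 powr p) * (Lp_int (\<lambda>x. ennreal (\<gamma> x)) + Lp_int gf))"
      by (intro mult_left_mono Lp_add \<gamma>M wug_borel_M[OF gf(1)]) simp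
    also have "\<dots> \<le> B"
      unfolding B_def \<gamma>e by (intro mult_left_mono add_right_mono e) simp_all
    finally show ?thesis .
  qed
  \<comment> \<open>Infima over shrinking sets increase, and \<open>B\<close> bounds them. Near
    their limit, the norms of almost minimisers and of their midpoints are squeezed
    together.\<close>
  define a where "a n = (INF h\<in>A n. pint h)" for n
  have a_le: "a n \<le> pint h" if "h \<in> A n" for n h unfolding a_def by (rule INF_lower[OF that])
  have a_le_B: "a n \<le> B" for n
  proof -
    obtain h where "h \<in> A n" using A_ne by blast
    then show ?thesis using a_le pint_le_B by (meson order_trans)
  qed
  have a_mono: "a n \<le> a m" if "n \<le> m" for n m
    unfolding a_def by (rule INF_superset_mono[OF A_anti[OF that] order_refl])
  define \<alpha> where "\<alpha> = enn2real (SUP n. a n)"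
  have "(SUP n. a n) \<le> B" by (rule SUP_least) (rule a_le_B)
  then have SUP_a: "(SUP n. a n) = ennreal \<alpha>" using B_fin by (simp add: \<alpha>_def order.strict_trans1)
  have a_le_\<alpha>: "a n \<le> ennreal \<alpha>" for n unfolding SUP_a[symmetric] by (rule SUP_upper) simp
  have a_near: "\<exists>N. \<forall>n\<ge>N. ennreal (\<alpha> - \<delta>) \<le> a n" if \<delta>: "0 < \<delta>" for \<delta>
  proof (cases "\<alpha> \<le> \<delta>")
    case True
    then show ?thesis by (simp add: ennreal_neg)
  next
    case False
    have "ennreal (\<alpha> - \<delta>) < ennreal \<alpha>" using False \<delta> by (intro ennreal_lessI) auto
    then obtain N where N: "ennreal (\<alpha> - \<delta>) < a N" unfolding SUP_a[symmetric] less_SUP_iff by blast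
    have "ennreal (\<alpha> - \<delta>) \<le> a n" if "N \<le> n" for n
      using less_imp_le[OF N] a_mono[OF that] by (rule order_trans)
    then show ?thesis by blast
  qed
  have "\<exists>h. h \<in> A n \<and> pint h \<le> a n + ennreal (1 / Suc n)" for n
  proof -
    have pos: "0 < 1 / real (Suc n)" by simp
    have "a n \<noteq> \<infinity>" using a_le_B[of n] B_fin by (auto simp: top_unique)
    from INF_approx_ennreal[OF pos a_def this] obtain h where "h \<in> A n" "pint h < a n + ennreal (1 / Suc n)" by blast
    then show ?thesis by (auto intro: less_imp_le)
  qed
  then obtain h where h: "\<And>n. h n \<in> A n" "\<And>n. pint (h n) \<le> a n + ennreal (1 / Suc n)" by metis
  have adm: "admissible (h n)" and en: "shift_energy (h n) \<le> I + ennreal (1 / Suc n)" for n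
    using h(1)[of n] by (simp_all add: A_def)
  have "\<forall>n. \<exists>\<gamma>. \<gamma> \<in> borel_measurable borel \<and> (\<forall>x. 0 \<le> \<gamma> x) \<and> wug E (\<lambda>x. F x + h n x) (\<lambda>x. ennreal (\<gamma> x)) \<and>
      pint \<gamma> = shift_energy (h n)"
    using admissible_gradient(2)[OF adm] by blast
  then obtain \<gamma> where \<gamma>: "\<And>n. \<gamma> n \<in> borel_measurable borel" "\<And>n x. 0 \<le> \<gamma> n x"
    "\<And>n. wug E (\<lambda>x. F x + h n x) (\<lambda>x. ennreal (\<gamma> n x))" "\<And>n. pint (\<gamma> n) = shift_energy (h n)"
    by metis
  have \<gamma>_fin: "pint (\<gamma> n) < \<infinity>" for n unfolding \<gamma>(4) by (rule admissible_gradient(1)[OF adm])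
  note mid = midpoint_admissible[OF adm adm \<gamma>(3,2) \<gamma>_fin \<gamma>(1) \<gamma>(3,2) \<gamma>_fin \<gamma>(1)]
  have mid_A: "(\<lambda>x. (h n x + h m x) / 2) \<in> A N" if nm: "N \<le> n" "N \<le> m" for n m N
  proof -
    have le: "pint (\<gamma> i) \<le> I + ennreal (1 / Suc N)" if "N \<le> i" for i
    proof -
      have "h i \<in> A N" using h(1) A_anti[OF that] by blast
      then show ?thesis by (simp add: \<gamma>(4) A_def)
    qed
    have "shift_energy (\<lambda>x. (h n x + h m x) / 2) \<le> ennreal (1/2) * (pint (\<gamma> n) + pint (\<gamma> m))"
      by (rule order_trans[OF mid(2,3)])
    also have "\<dots> \<le> ennreal (1/2) * ((I + ennreal (1 / Suc N)) + (I + ennreal (1 / Suc N)))"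
      by (intro mult_left_mono add_mono le nm) simp
    also have "\<dots> = I + ennreal (1 / Suc N)"
    proof -
      have "ennreal (1/2) * (c + c) = c" for c :: ennreal
      proof (cases c)
        case (real r)
        have "c + c = ennreal (2 * r)" using real ennreal_plus[of r r] by simp
        moreover have "ennreal (1/2) * ennreal (2 * r) = ennreal (1/2 * (2 * r))"
          by (rule ennreal_mult[symmetric]) (use real in simp_all)
        ultimately show ?thesis using real(2) by (simp only:) simp
      qed (simp add: ennreal_mult_top)
      then show ?thesis .
    qed
    finally show ?thesis using mid(1) by (simp add: A_def)
  qed
  have small: "\<exists>N. \<forall>n\<ge>N. 1 / real (Suc n) \<le> \<delta>" if \<delta>: "0 < \<delta>" for \<delta>
  proof -
    obtain N where N: "1 / real (Suc N) < \<delta>" using nat_approx_posE[OF \<delta>] by blast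
    have "1 / real (Suc n) \<le> \<delta>" if "N \<le> n" for n
    proof -
      have "1 / real (Suc n) \<le> 1 / real (Suc N)" using that by (intro divide_left_mono) auto
      then show ?thesis using N by linarith
    qed
    then show ?thesis by blast
  qed
  have hM: "h n \<in> borel_measurable M" for n using adm[of n] by (simp add: admissible_def)
  \<comment> \<open>The lower bound for midpoints comes from \<open>a\<close>, because midpoints
    remain in the sets \<open>A\<close>.\<close>
  have Cauchy_h: "\<exists>N. \<forall>n\<ge>N. \<forall>m\<ge>N. pint (\<lambda>x. h n x - h m x) \<le> ennreal \<eta>" if \<eta>: "0 < \<eta>" for \<eta>
  proof -
    have \<alpha>0: "0 \<le> \<alpha>" by (simp add: \<alpha>_def)
    obtain \<delta> where \<delta>: "0 < \<delta>" and close: "\<And>n m. pint (h n) \<le> ennreal (\<alpha> + \<delta>) \<Longrightarrow> pint (h m) \<le> ennreal (\<alpha> + \<delta>) \<Longrightarrow>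
      ennreal (\<alpha> - \<delta>) \<le> pint (\<lambda>x. (h n x + h m x) / 2) \<Longrightarrow> pint (\<lambda>x. h n x - h m x) \<le> ennreal \<eta>"
      by (rule pint_Cauchy[OF hM \<alpha>0 \<eta>]) (rule that)
    obtain N1 where N1: "\<forall>n\<ge>N1. 1 / real (Suc n) \<le> \<delta>" using small[OF \<delta>] by blast
    obtain N2 where N2: "\<forall>n\<ge>N2. ennreal (\<alpha> - \<delta>) \<le> a n" using a_near[OF \<delta>] by blast
    let ?N = "max N1 N2"
    have up: "pint (h n) \<le> ennreal (\<alpha> + \<delta>)" if "?N \<le> n" for n
    proof -
      have "pint (h n) \<le> ennreal \<alpha> + ennreal (1 / Suc n)"
        by (rule order_trans[OF h(2)]) (intro add_right_mono a_le_\<alpha>)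
      also have "\<dots> \<le> ennreal \<alpha> + ennreal \<delta>" using N1 that by (intro add_left_mono ennreal_leI) simp
      also have "\<dots> = ennreal (\<alpha> + \<delta>)" using \<alpha>0 \<delta> by simp
      finally show ?thesis .
    qed
    have low: "ennreal (\<alpha> - \<delta>) \<le> pint (\<lambda>x. (h n x + h m x) / 2)" if "?N \<le> n" "?N \<le> m" for n m
    proof -
      have "ennreal (\<alpha> - \<delta>) \<le> a ?N" using N2 by simp
      also have "\<dots> \<le> pint (\<lambda>x. (h n x + h m x) / 2)" by (rule a_le[OF mid_A[OF that]])
      finally show ?thesis .
    qed
    show ?thesis using close up low by blast
  qed
  obtain c where c: "I = ennreal c" "0 \<le> c" using I_fin by (cases I) auto
  \<comment> \<open>Here the lower bound comes from the infimum \<open>I\<close>: the averaged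
    density is a gradient of \<open>F\<close> plus the admissible midpoint.\<close>
  have Cauchy_\<gamma>: "\<exists>N. \<forall>n\<ge>N. \<forall>m\<ge>N. pint (\<lambda>x. \<gamma> n x - \<gamma> m x) \<le> ennreal \<eta>" if \<eta>: "0 < \<eta>" for \<eta>
  proof -
    obtain \<delta> where \<delta>: "0 < \<delta>" and close: "\<And>n m. pint (\<gamma> n) \<le> ennreal (c + \<delta>) \<Longrightarrow> pint (\<gamma> m) \<le> ennreal (c + \<delta>) \<Longrightarrow>
      ennreal (c - \<delta>) \<le> pint (\<lambda>x. (\<gamma> n x + \<gamma> m x) / 2) \<Longrightarrow> pint (\<lambda>x. \<gamma> n x - \<gamma> m x) \<le> ennreal \<eta>"
      by (rule pint_Cauchy[OF borel_measurable_M[OF \<gamma>(1)] c(2) \<eta>]) (rule that)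
    obtain N where N: "\<forall>n\<ge>N. 1 / real (Suc n) \<le> \<delta>" using small[OF \<delta>] by blast
    have up: "pint (\<gamma> n) \<le> ennreal (c + \<delta>)" if "N \<le> n" for n
    proof -
      have "pint (\<gamma> n) \<le> ennreal c + ennreal (1 / Suc n)" using en[of n] by (simp only: \<gamma>(4) c(1))
      also have "\<dots> \<le> ennreal c + ennreal \<delta>" using N that by (intro add_left_mono ennreal_leI) simp
      also have "\<dots> = ennreal (c + \<delta>)" using c(2) \<delta> by simp
      finally show ?thesis .
    qed
    have low: "ennreal (c - \<delta>) \<le> pint (\<lambda>x. (\<gamma> n x + \<gamma> m x) / 2)" for n m
    proof -
      have "ennreal (c - \<delta>) \<le> I" unfolding c(1) using \<delta> by (intro ennreal_leI) simp
      also have "\<dots> \<le> shift_energy (\<lambda>x. (h n x + h m x) / 2)" by (rule I_le[OF mid(1)])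
      also have "\<dots> \<le> pint (\<lambda>x. (\<gamma> n x + \<gamma> m x) / 2)" by (rule mid(2))
      finally show ?thesis .
    qed
    show ?thesis using close up low by blast
  qed
  obtain r where r: "\<And>j. j \<le> r j"
    "\<And>j. pint (\<lambda>x. h (r (Suc j)) x - h (r j) x) \<le> ennreal ((1/2) ^ j / (2 ^ j) powr p)"
    "\<And>j. pint (\<lambda>x. \<gamma> (r (Suc j)) x - \<gamma> (r j) x) \<le> ennreal ((1/2) ^ j / (2 ^ j) powr p)"
    using fast_common_subsequence[OF Cauchy_h Cauchy_\<gamma>] by blast
  have "\<exists>h. admissible h \<and> shift_energy h \<le> I"
  proof (rule limit_admissible[where k="\<lambda>j. h (r j)" and \<kappa>="\<lambda>j. \<gamma> (r j)"])
    show "pint (\<gamma> (r j)) \<le> I + ennreal (1 / Suc j)" for j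
    proof -
      have "h (r j) \<in> A j" using h(1) A_anti[OF r(1)] by blast
      then show ?thesis by (simp add: \<gamma>(4) A_def)
    qed
  qed (rule adm \<gamma> r I_fin)+
  then show ?thesis using I_le by (meson order_trans)
qed

text \<open>The competitor \<open>k\<close> makes \<open>F + k\<close> equal to
  \<open>F + h2\<close> cut off above at the level c, but never below \<open>F + h1\<close>. It has
  the gradient \<open>\<gamma>\<close>, which can moreover be dropped where
  \<open>F + k = c\<close>. As \<open>\<gamma>\<close> already has the least p-integral, it vanishes
  almost everywhere on that level set, which contains all points with c strictly between the two
  functions.\<close>

lemma truncation_gradient_zero:
  assumes h1: "admissible h1" and h2: "admissible h2"
    and min: "\<And>k. admissible k \<Longrightarrow> pint \<gamma> \<le> shift_energy k"
    and \<gamma>: "\<gamma> \<in> borel_measurable borel" "\<And>x. 0 \<le> \<gamma> x" "pint \<gamma> < \<infinity>"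
    and w1: "wug E (\<lambda>x. F x + h1 x) (\<lambda>x. ennreal (\<gamma> x))" and w2: "wug E (\<lambda>x. F x + h2 x) (\<lambda>x. ennreal (\<gamma> x))"
  shows "AE x in M. F x + h1 x < c \<and> c < F x + h2 x \<longrightarrow> \<gamma> x = 0"
proof -
  have [measurable]: "h1 \<in> borel_measurable M" "h2 \<in> borel_measurable M" "F \<in> borel_measurable M"
    using h1 h2 by (simp_all add: admissible_def F_measurable)
  have \<gamma>M [measurable]: "\<gamma> \<in> borel_measurable M" by (rule borel_measurable_M[OF \<gamma>(1)])
  define k where "k x = max (h1 x) (min (h2 x) (c - F x))" for x
  have kM [measurable]: "k \<in> borel_measurable M" unfolding k_def[abs_def] by measurable
  have Fk: "F x + k x = max (F x + h1 x) (min (F x + h2 x) c)" for x by (simp add: k_def max_def min_def)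
  have \<gamma>_fin: "Lp_int (\<lambda>x. ennreal (\<gamma> x)) < \<infinity>"
    using \<gamma>(2,3) by (simp add: pint_epow)
  have wk: "wug E (\<lambda>x. F x + k x) (\<lambda>x. ennreal (\<gamma> x))"
  proof (rule wug_combine[OF w1 w2 wug_borel[OF w1]])
    fix l :: real and \<sigma> :: "real \<Rightarrow> 'a" and a b :: real
    assume 1: "ennreal \<bar>F (\<sigma> a) + h1 (\<sigma> a) - (F (\<sigma> b) + h1 (\<sigma> b))\<bar> \<le> segment_integral (\<lambda>x. ennreal (\<gamma> x)) \<sigma> a b"
      and 2: "ennreal \<bar>F (\<sigma> a) + h2 (\<sigma> a) - (F (\<sigma> b) + h2 (\<sigma> b))\<bar> \<le> segment_integral (\<lambda>x. ennreal (\<gamma> x)) \<sigma> a b"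
    \<comment> \<open>The truncation changes by no more than one of its two inputs does, so the
      common density serves without passing to a sum or a maximum.\<close>
    have "\<bar>max p1 (min p2 c) - max q1 (min q2 c)\<bar> \<le> \<bar>p1 - q1\<bar> \<or> \<bar>max p1 (min p2 c) - max q1 (min q2 c)\<bar> \<le> \<bar>p2 - q2\<bar>"
      for p1 p2 q1 q2 :: real by linarith
    then have "\<bar>F (\<sigma> a) + k (\<sigma> a) - (F (\<sigma> b) + k (\<sigma> b))\<bar> \<le> \<bar>F (\<sigma> a) + h1 (\<sigma> a) - (F (\<sigma> b) + h1 (\<sigma> b))\<bar> \<or>
        \<bar>F (\<sigma> a) + k (\<sigma> a) - (F (\<sigma> b) + k (\<sigma> b))\<bar> \<le> \<bar>F (\<sigma> a) + h2 (\<sigma> a) - (F (\<sigma> b) + h2 (\<sigma> b))\<bar>"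
      unfolding Fk .
    then show "ennreal \<bar>F (\<sigma> a) + k (\<sigma> a) - (F (\<sigma> b) + k (\<sigma> b))\<bar> \<le> segment_integral (\<lambda>x. ennreal (\<gamma> x)) \<sigma> a b"
      using 1 2 by (meson ennreal_leI order_trans)
  qed
  have "admissible k"
    by (rule admissible_between[OF h1 h2 kM _ _ wk \<gamma>_fin]) (auto simp: k_def min_def max_def)
  then have "pint \<gamma> \<le> shift_energy k" by (rule min)
  define V where "V = {x. F x + k x \<noteq> c}"
  have "{x \<in> space M. F x + k x \<noteq> c} \<in> sets M" by measurable
  then have V [measurable]: "V \<in> sets M" by (simp add: V_def)
  have "(\<lambda>x. ennreal (\<gamma> x) * indicator V x) \<in> borel_measurable M" by measurable
  then obtain g' where g': "g' \<in> borel_measurable borel" "\<And>x. ennreal (\<gamma> x) * indicator V x \<le> g' x"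
    "AE x in M. g' x = ennreal (\<gamma> x) * indicator V x" by (rule borel_majorant) (rule that)
  \<comment> \<open>Subtracting c turns the level set into a zero set, to which
    \<open>wug_extend\<close> applies.\<close>
  have wc: "wug E (\<lambda>x. F x + k x - c) (\<lambda>x. ennreal (\<gamma> x))"
    using wk wug_diff_const[of E "\<lambda>x. F x + k x" c] by blast
  have "wug E (\<lambda>x. F x + k x - c) g'"
  proof (rule wug_extend[OF wug_abs[OF wc] aec_finite[OF wug_borel[OF wc] \<gamma>_fin] _ _ wc g'(1)])
    show "ennreal (\<gamma> x) \<le> g' x" if "0 < \<bar>F x + k x - c\<bar>" for x
      using g'(2)[of x] that by (simp add: V_def)
  qed simp_all
  then have "wug E (\<lambda>x. F x + k x) g'" using wug_diff_const[of E "\<lambda>x. F x + k x" c] by blast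
  then have "shift_energy k \<le> Lp_int g'" by (rule shift_energy_le)
  also have "\<dots> = (\<integral>\<^sup>+ x. ennreal (\<bar>\<gamma> x\<bar> powr p) * indicator V x \<partial>M)"
    by (rule nn_integral_cong_AE, use g'(3) in eventually_elim)
      (use \<gamma>(2) in \<open>simp add: epow_ennreal split: split_indicator\<close>)
  finally have ge: "pint \<gamma> \<le> (\<integral>\<^sup>+ x. ennreal (\<bar>\<gamma> x\<bar> powr p) * indicator V x \<partial>M)"
    using \<open>pint \<gamma> \<le> shift_energy k\<close> by simp
  have "AE x in M. ennreal (\<bar>\<gamma> x\<bar> powr p) \<le> ennreal (\<bar>\<gamma> x\<bar> powr p) * indicator V x"
  proof (rule ccontr)
    assume *: "\<not> (AE x in M. ennreal (\<bar>\<gamma> x\<bar> powr p) \<le> ennreal (\<bar>\<gamma> x\<bar> powr p) * indicator V x)"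
    have le: "(\<integral>\<^sup>+ x. ennreal (\<bar>\<gamma> x\<bar> powr p) * indicator V x \<partial>M) \<le> pint \<gamma>"
      unfolding pint_def by (intro nn_integral_mono) (simp split: split_indicator)
    have "(\<integral>\<^sup>+ x. ennreal (\<bar>\<gamma> x\<bar> powr p) * indicator V x \<partial>M) < (\<integral>\<^sup>+ x. ennreal (\<bar>\<gamma> x\<bar> powr p) \<partial>M)"
    proof (rule nn_integral_less[OF _ _ _ _ *])
      show "(\<integral>\<^sup>+ x. ennreal (\<bar>\<gamma> x\<bar> powr p) * indicator V x \<partial>M) \<noteq> \<infinity>"
        using order.strict_trans1[OF le \<gamma>(3)] by simp
      show "AE x in M. ennreal (\<bar>\<gamma> x\<bar> powr p) * indicator V x \<le> ennreal (\<bar>\<gamma> x\<bar> powr p)"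
        by (intro AE_I2) (simp split: split_indicator)
    qed measurable
    then show False using ge unfolding pint_def by simp
  qed
  then show ?thesis
  proof eventually_elim
    case (elim x)
    show ?case
    proof
      assume "F x + h1 x < c \<and> c < F x + h2 x"
      then have "x \<notin> V" by (simp add: V_def Fk)
      then have "ennreal (\<bar>\<gamma> x\<bar> powr p) \<le> 0" using elim by simp
      then show "\<gamma> x = 0" by (simp add: ennreal_eq_0_iff)
    qed
  qed
qed

lemma minimizers_agree:
  assumes Poincare: "supports_Poincare_N0 p M" "bounded E" "0 < capacity p M (space M - E)"
    and h1: "admissible h1" and h2: "admissible h2"
    and min1: "\<And>k. admissible k \<Longrightarrow> shift_energy h1 \<le> shift_energy k"
    and min2: "\<And>k. admissible k \<Longrightarrow> shift_energy h2 \<le> shift_energy k"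
  shows "exceptional {x. h1 x \<noteq> h2 x}"
proof -
  have same: "shift_energy h2 = shift_energy h1" using min1[OF h2] min2[OF h1] by simp
  obtain \<gamma>1 where \<gamma>1: "\<gamma>1 \<in> borel_measurable borel" "\<And>x. 0 \<le> \<gamma>1 x" "wug E (\<lambda>x. F x + h1 x) (\<lambda>x. ennreal (\<gamma>1 x))"
    "pint \<gamma>1 = shift_energy h1" using admissible_gradient(2)[OF h1] by blast
  obtain \<gamma>2 where \<gamma>2: "\<gamma>2 \<in> borel_measurable borel" "\<And>x. 0 \<le> \<gamma>2 x" "wug E (\<lambda>x. F x + h2 x) (\<lambda>x. ennreal (\<gamma>2 x))"
    "pint \<gamma>2 = shift_energy h2" using admissible_gradient(2)[OF h2] by blast
  have fin1: "pint \<gamma>1 < \<infinity>" unfolding \<gamma>1(4) by (rule admissible_gradient(1)[OF h1])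
  have fin2: "pint \<gamma>2 < \<infinity>" unfolding \<gamma>2(4) by (rule admissible_gradient(1)[OF h2])
  note mid = midpoint_admissible[OF h1 h2 \<gamma>1(3,2) fin1 \<gamma>1(1) \<gamma>2(3,2) fin2 \<gamma>2(1)]
  have [measurable]: "\<gamma>1 \<in> borel_measurable M" "\<gamma>2 \<in> borel_measurable M" "h1 \<in> borel_measurable M" "h2 \<in> borel_measurable M"
    using h1 h2 \<gamma>1(1) \<gamma>2(1) by (simp_all add: borel_measurable_M admissible_def)
  obtain c where c: "pint \<gamma>1 = ennreal c" "0 \<le> c" using fin1 by (cases "pint \<gamma>1") auto
  have small: "pint (\<lambda>x. \<gamma>1 x - \<gamma>2 x) \<le> ennreal \<eta>" if \<eta>: "0 < \<eta>" for \<eta>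
  proof -
    \<comment> \<open>\<open>pint_Cauchy\<close> speaks of a sequence; the two densities are fed in
      as one with only two values.\<close>
    define \<sigma> where "\<sigma> n = (if n = (0::nat) then \<gamma>1 else \<gamma>2)" for n
    have \<sigma>M: "\<sigma> n \<in> borel_measurable M" for n by (simp add: \<sigma>_def)
    obtain \<delta> where \<delta>: "0 < \<delta>" and close: "\<And>n m. pint (\<sigma> n) \<le> ennreal (c + \<delta>) \<Longrightarrow> pint (\<sigma> m) \<le> ennreal (c + \<delta>) \<Longrightarrow>
      ennreal (c - \<delta>) \<le> pint (\<lambda>x. (\<sigma> n x + \<sigma> m x) / 2) \<Longrightarrow> pint (\<lambda>x. \<sigma> n x - \<sigma> m x) \<le> ennreal \<eta>"
      by (rule pint_Cauchy[OF \<sigma>M c(2) \<eta>]) (rule that)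
    have up: "ennreal c \<le> ennreal (c + \<delta>)" using \<delta> by (intro ennreal_leI) simp
    have "ennreal (c - \<delta>) \<le> shift_energy h1" unfolding \<gamma>1(4)[symmetric] c(1) using \<delta> by (intro ennreal_leI) simp
    also have "\<dots> \<le> shift_energy (\<lambda>x. (h1 x + h2 x) / 2)" by (rule min1[OF mid(1)])
    also have "\<dots> \<le> pint (\<lambda>x. (\<gamma>1 x + \<gamma>2 x) / 2)" by (rule mid(2))
    finally have low: "ennreal (c - \<delta>) \<le> pint (\<lambda>x. (\<gamma>1 x + \<gamma>2 x) / 2)" .
    have c2: "pint \<gamma>2 = ennreal c" using \<gamma>2(4) same \<gamma>1(4) c(1) by simp
    show ?thesis using close[of 0 1] up low by (simp add: \<sigma>_def c(1) c2)
  qed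
  have "pint (\<lambda>x. \<gamma>1 x - \<gamma>2 x) \<le> 0"
  proof (rule ennreal_le_epsilon)
    show "pint (\<lambda>x. \<gamma>1 x - \<gamma>2 x) \<le> 0 + ennreal e" if "0 < e" for e
      unfolding add_0 by (rule small[OF that])
  qed
  then have "(\<integral>\<^sup>+ x. ennreal (\<bar>\<gamma>1 x - \<gamma>2 x\<bar> powr p) \<partial>M) = 0" by (simp add: pint_def)
  then have "AE x in M. ennreal (\<bar>\<gamma>1 x - \<gamma>2 x\<bar> powr p) = 0" by (subst (asm) nn_integral_0_iff_AE) auto
  then have "AE x in M. \<gamma>1 x = \<gamma>2 x" by eventually_elim (simp add: ennreal_eq_0_iff)
  then have w2: "wug E (\<lambda>x. F x + h2 x) (\<lambda>x. ennreal (\<gamma>1 x))"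
    by (intro wug_AE_mono[OF \<gamma>2(3) wug_borel[OF \<gamma>1(3)]]) (auto elim!: eventually_mono)
  have min: "pint \<gamma>1 \<le> shift_energy k" if "admissible k" for k unfolding \<gamma>1(4) by (rule min1[OF that])
  \<comment> \<open>Rational levels are countably many and separate any two different
    values.\<close>
  have "AE x in M. \<forall>c\<in>\<rat>. (F x + h1 x < c \<and> c < F x + h2 x \<longrightarrow> \<gamma>1 x = 0) \<and>
      (F x + h2 x < c \<and> c < F x + h1 x \<longrightarrow> \<gamma>1 x = 0)"
    by (intro AE_ball_countable' countable_rat AE_conjI truncation_gradient_zero h1 h2 min \<gamma>1 fin1 w2)
  then have zero: "AE x in M. h1 x \<noteq> h2 x \<longrightarrow> \<gamma>1 x = 0"
  proof eventually_elim
    case (elim x)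
    show ?case
    proof
      assume "h1 x \<noteq> h2 x"
      then consider "F x + h1 x < F x + h2 x" | "F x + h2 x < F x + h1 x" by linarith
      then show "\<gamma>1 x = 0"
      proof cases
        case 1
        then obtain q where "q \<in> \<rat>" "F x + h1 x < q" "q < F x + h2 x" using Rats_dense_in_real by blast
        then show ?thesis using elim by blast
      next
        case 2
        then obtain q where "q \<in> \<rat>" "F x + h2 x < q" "q < F x + h1 x" using Rats_dense_in_real by blast
        then show ?thesis using elim by blast
      qed
    qed
  qed
  let ?h = "\<lambda>x. h1 x - h2 x"
  obtain g1 where g1: "wug UNIV h1 g1" "Lp_int g1 < \<infinity>" using h1 by (auto simp: admissible_def)
  obtain g2 where g2: "wug UNIV h2 g2" "Lp_int g2 < \<infinity>" using h2 by (auto simp: admissible_def)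
  have gh: "wug UNIV ?h (\<lambda>x. g1 x + g2 x)" by (rule wug_add_le[OF g1(1) g2(1)]) linarith
  have gh_fin: "Lp_int (\<lambda>x. g1 x + g2 x) < \<infinity>"
    by (rule Lp_add_finite[OF wug_borel_M[OF g1(1)] wug_borel_M[OF g2(1)] g1(2) g2(2)])
  \<comment> \<open>The sum of the two equal densities is a gradient of the difference in
    \<open>E\<close>. Cut down to the set where the difference is nonzero it still works, now on the
    whole space, and it vanishes almost everywhere; so 0 is a gradient there.\<close>
  have hE: "wug E ?h (\<lambda>x. ennreal (\<gamma>1 x) + ennreal (\<gamma>1 x))"
    by (rule wug_add_le[OF \<gamma>1(3) w2]) linarith
  define V where "V = {x. ?h x \<noteq> 0}"
  have "{x \<in> space M. ?h x \<noteq> 0} \<in> sets M" by measurable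
  then have [measurable]: "V \<in> sets M" by (simp add: V_def)
  have "(\<lambda>x. (ennreal (\<gamma>1 x) + ennreal (\<gamma>1 x)) * indicator V x) \<in> borel_measurable M" by measurable
  then obtain g' where g': "g' \<in> borel_measurable borel" "\<And>x. (ennreal (\<gamma>1 x) + ennreal (\<gamma>1 x)) * indicator V x \<le> g' x"
    "AE x in M. g' x = (ennreal (\<gamma>1 x) + ennreal (\<gamma>1 x)) * indicator V x" by (rule borel_majorant) (rule that)
  have w': "wug UNIV ?h g'"
  proof (rule wug_extend[OF wug_abs[OF gh] aec_finite[OF wug_borel[OF gh] gh_fin] _ _ hE g'(1)])
    show "ennreal (\<gamma>1 x) + ennreal (\<gamma>1 x) \<le> g' x" if "0 < \<bar>?h x\<bar>" for x
      using g'(2)[of x] that by (simp add: V_def)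
    show "x \<in> E" if "0 < \<bar>?h x\<bar>" for x
    proof (rule ccontr)
      assume "x \<notin> E"
      then have "h1 x = 0" "h2 x = 0" using h1 h2 by (simp_all add: admissible_def)
      then show False using that by simp
    qed
  qed simp
  have g'0: "AE x in M. g' x = 0"
    using g'(3) zero by eventually_elim (simp add: V_def split: split_indicator)
  have w0: "wug UNIV ?h (\<lambda>x. 0)"
    by (rule wug_AE_mono[OF w']) (use g'0 in \<open>auto elim!: eventually_mono\<close>)
  obtain C :: real where P: "\<And>h g. h \<in> borel_measurable M \<Longrightarrow> pint h < \<infinity> \<Longrightarrow> wug UNIV h g \<Longrightarrow>
    Lp_int g < \<infinity> \<Longrightarrow> (\<And>x. x \<notin> E \<Longrightarrow> h x = 0) \<Longrightarrow> pint h \<le> ennreal C * Lp_int g"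
    using Poincare_bound[OF Poincare] by blast
  have "pint ?h \<le> ennreal C * (\<integral>\<^sup>+ x. epow 0 p \<partial>M)"
  proof (rule P[OF _ _ w0])
    show "pint ?h < \<infinity>"
      by (rule pint_add_finite[of h1 h2]) (use h1 h2 in \<open>auto simp: admissible_def\<close>)
    show "?h x = 0" if "x \<notin> E" for x using h1 h2 that by (simp add: admissible_def)
  qed simp_all
  then have "(\<integral>\<^sup>+ x. ennreal (\<bar>?h x\<bar> powr p) \<partial>M) = 0" by (simp add: pint_def)
  then have "AE x in M. ennreal (\<bar>?h x\<bar> powr p) = 0" by (subst (asm) nn_integral_0_iff_AE) auto
  then have "AE x in M. ?h x = 0" by eventually_elim (simp add: ennreal_eq_0_iff)
  \<comment> \<open>Having 0 as a gradient upgrades equality almost everywhere to equality quasi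
    everywhere.\<close>
  from exceptional_of_zero_gradient[OF w0 this] show ?thesis by simp
qed

end

theorem theorem4p2:
  fixes M :: "'a::metric_space measure" and p :: real
    and E :: "'a set" and f \<psi>\<^sub>1 \<psi>\<^sub>2 :: "'a \<Rightarrow> ereal"
  assumes "metric_measure_space M"
    and "1 < p"
    and "supports_Poincare_N0 p M"
    and "bounded E"
    and "E \<in> sets M"
    and "0 < capacity p M (space M - E)"
    and "f \<in> Dp p (restrict_space M E)"
    and "obstacle_class p M \<psi>\<^sub>1 \<psi>\<^sub>2 f E \<noteq> {}"
  shows "\<exists>u. obstacle_solution p M \<psi>\<^sub>1 \<psi>\<^sub>2 f E u \<and>
           (\<forall>v. obstacle_solution p M \<psi>\<^sub>1 \<psi>\<^sub>2 f E v \<longrightarrow>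
              quasi_everywhere p M E (\<lambda>x. v x = u x))"
proof -
  interpret obstacle_setting M p E f \<psi>\<^sub>1 \<psi>\<^sub>2
    by unfold_locales (rule assms)+
  note Poincare = assms(3,4,6)
  obtain v0 where "v0 \<in> obstacle_class p M \<psi>\<^sub>1 \<psi>\<^sub>2 f E" using assms(8) by blast
  then have "\<exists>h. admissible h" using class_is_shift by metis
  from minimal_energy_attained[OF Poincare this]
  obtain h where h: "admissible h" and min: "\<And>k. admissible k \<Longrightarrow> shift_energy h \<le> shift_energy k" by blast
  have "obstacle_solution p M \<psi>\<^sub>1 \<psi>\<^sub>2 f E (shift h)"
    unfolding obstacle_solution_def
  proof (intro conjI ballI)
    show "shift h \<in> obstacle_class p M \<psi>\<^sub>1 \<psi>\<^sub>2 f E" by (rule shift_in_class[OF h])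
    fix v assume "v \<in> obstacle_class p M \<psi>\<^sub>1 \<psi>\<^sub>2 f E"
    then obtain k where "admissible k" "energy p (restrict_space M E) v = shift_energy k"
      using class_is_shift by metis
    then show "energy p (restrict_space M E) (shift h) \<le> energy p (restrict_space M E) v"
      using min by (simp add: shift_energy_def)
  qed
  moreover have "quasi_everywhere p M E (\<lambda>x. v x = shift h x)"
    if v: "obstacle_solution p M \<psi>\<^sub>1 \<psi>\<^sub>2 f E v" for v
  proof -
    have "v \<in> obstacle_class p M \<psi>\<^sub>1 \<psi>\<^sub>2 f E" using v by (simp add: obstacle_solution_def)
    then obtain k where k: "admissible k" "exceptional {x \<in> E. v x \<noteq> shift k x}"
      "energy p (restrict_space M E) v = shift_energy k" by (rule class_is_shift) (rule that)
    have min': "shift_energy k \<le> shift_energy k'" if "admissible k'" for k'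
      using v shift_in_class[OF that] k(3) by (auto simp: obstacle_solution_def shift_energy_def)
    have "exceptional {x. h x \<noteq> k x}"
      by (rule minimizers_agree[OF Poincare h k(1) min min'])
    from exceptional_Un[OF k(2) this] show ?thesis
      unfolding quasi_everywhere_iff by (rule exceptional_subset) (auto simp: shift_def)
  qed
  ultimately show ?thesis by blast
qed

end
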